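(* Let $\lambda>0$. Consider the data, for $0\le c\le\lambda-1$, $$u_c=(\xi^c1_{\mathcal F})\circ\eta'_\lambda,\qquad v_c=\sum_{a+b=\lambda-1-c}b^-_{b,\lambda}\circ\epsilon'_\lambda\circ(\xi^a1_{\mathcal F}),\qquad u_\lambda=\sigma'_\lambda,\qquad v_\lambda=-\sigma_\lambda,$$ (with $a,b\ge0$), which factor the decomposition of $1_{\mathcal{EF}\mathbf 1_\lambda}$ in relation (v) of the context as $1_{\mathcal{EF}\mathbf 1_\lambda}=\sum_{i=0}^\lambda u_iv_i$. For the differential $\partial_1$, these data yield a fantastic filtration on $\mathcal{EF}\mathbf 1_\lambda$ corresponding to this decomposition. Moreover, $\partial_1$ is the only specialization of the parameters (in the family of $p$-differentials on $\mathcal U$ described in the context) for which these data yield a fantastic filtration.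
   Context: $\Bbbk$ is a field of characteristic $p>0$. **The $2$-category $\mathcal U$.** Objects: $\lambda\in\mathbb Z$. $1$-morphisms: direct sums of grading shifts of composites of $\mathbf 1_\lambda$, $\mathcal E\mathbf 1_\lambda:\lambda\to\lambda+2$, $\mathcal F\mathbf 1_\lambda:\lambda\to\lambda-2$. Vertical composition is $\circ$ (or omitted), horizontal composition is juxtaposition. Generating $2$-morphisms, for all $\lambda$ (subscripts are omitted when clear; $1_X$ is the identity $2$-morphism of $X$): $\xi:\mathcal E\mathbf 1_\lambda\to\mathcal E\mathbf 1_\lambda$ and $\xi':\mathcal F\mathbf 1_\lambda\to\mathcal F\mathbf 1_\lambda$ of degree $2$; $\tau_\lambda:\mathcal{EE}\mathbf 1_\lambda\to\mathcal{EE}\mathbf 1_\lambda$ and $\tau'_\lambda:\mathcal{FF}\mathbf 1_\lambda\to\mathcal{FF}\mathbf 1_\lambda$ of degree $-2$; $\eta_\lambda:\mathbf 1_\lambda\to\mathcal{FE}\mathbf 1_\lambda$ and $\epsilon_\lambda:\mathcal{FE}\mathbf 1_\lambda\to\mathbf 1_\lambda$ of degree $1+\lambda$; $\eta'_\lambda:\mathbf 1_\lambda\to\mathcal{EF}\mathbf 1_\lambda$ and $\epsilon'_\lambda:\mathcal{EF}\mathbf 1_\lambda\to\mathbf 1_\lambda$ of degree $1-\lambda$. Bubbles $b^{\pm}_{k,\lambda}\in\mathrm{END}(\mathbf 1_\lambda)$, $k\in\mathbb Z$, of degree $2k$ (clockwise $+$, counter-clockwise $-$): real bubbles are $b^+_{k,\lambda}=\epsilon'_\lambda\circ(\xi^{k+\lambda-1}1_{\mathcal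 F})\circ\eta'_\lambda$ for $k\ge1-\lambda$ and $b^-_{k,\lambda}=\epsilon_\lambda\circ(1_{\mathcal F}\xi^{k-\lambda-1})\circ\eta_\lambda$ for $k\ge1+\lambda$; for other $k$ (fake bubbles) they are determined by relation (ii). Sideways crossings: $\sigma_\lambda:=(1_{\mathcal{FE}}\,\epsilon'_\lambda)\circ(1_{\mathcal F}\tau1_{\mathcal F})\circ(\eta_\lambda1_{\mathcal{EF}}):\mathcal{EF}\mathbf 1_\lambda\to\mathcal{FE}\mathbf 1_\lambda$ and $\sigma'_\lambda:=(\epsilon_\lambda1_{\mathcal{EF}})\circ(1_{\mathcal F}\tau1_{\mathcal F})\circ(1_{\mathcal{FE}}\eta'_\lambda):\mathcal{FE}\mathbf 1_\lambda\to\mathcal{EF}\mathbf 1_\lambda$. Relations (for all $\lambda$): (i) $(\epsilon'1_{\mathcal E})(1_{\mathcal E}\eta)=1_{\mathcal E}=(1_{\mathcal E}\epsilon)(\eta'1_{\mathcal E})$; $(\epsilon1_{\mathcal F})(1_{\mathcal F}\eta')=1_{\mathcal F}=(1_{\mathcal F}\epsilon')(\eta1_{\mathcal F})$; $\epsilon'(\xi1_{\mathcal F})=\epsilon'(1_{\mathcal E}\xi')$; $\epsilon(\xi'1_{\mathcal E})=\epsilon(1_{\mathcal F}\xi)$; with $\epsilon'_{(2)}=\epsilon'(1_{\mathcal E}\epsilon'1_{\mathcal F}):\mathcal{EEFF}\mathbf 1_\lambda\to\mathbf 1_\lambda$ and $\epsilon_{(2)}=\epsilon(1_{\mathcal F}\epsilon1_{\mathcal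 E}):\mathcal{FFEE}\mathbf 1_\lambda\to\mathbf 1_\lambda$: $\epsilon'_{(2)}(\tau1_{\mathcal{FF}})=\epsilon'_{(2)}(1_{\mathcal{EE}}\tau')$ and $\epsilon_{(2)}(\tau'1_{\mathcal{EE}})=\epsilon_{(2)}(1_{\mathcal{FF}}\tau)$. (ii) $b^\pm_{k,\lambda}=0$ for $k<0$; $b^\pm_{0,\lambda}=1$; $\sum_{a+b=m}b^+_{a,\lambda}b^-_{b,\lambda}=\delta_{m,0}$ for all $m$. (iii) $\tau^2=0$; $(\tau1_{\mathcal E})(1_{\mathcal E}\tau)(\tau1_{\mathcal E})=(1_{\mathcal E}\tau)(\tau1_{\mathcal E})(1_{\mathcal E}\tau)$; $\tau(\xi1_{\mathcal E})-(1_{\mathcal E}\xi)\tau=1_{\mathcal{EE}}=(\xi1_{\mathcal E})\tau-\tau(1_{\mathcal E}\xi)$. (iv) On $\mathcal E\mathbf 1_\lambda$: $(1_{\mathcal E}\epsilon'_\lambda)(\tau1_{\mathcal F})(1_{\mathcal E}\eta'_\lambda)=-\sum_{a+b=-\lambda}\xi^b\,b^+_{a,\lambda}$ (bubble to the right). On $\mathbf 1_\lambda\mathcal E$: $(\epsilon_\lambda1_{\mathcal E})(1_{\mathcal F}\tau)(\eta_\lambda1_{\mathcal E})=\sum_{a+b=\lambda}b^-_{a,\lambda}\,\xi^b$ (bubble to the left). Here $a,b\ge0$. (v) $1_{\mathcal{EF}\mathbf 1_\lambda}=-\sigma'_\lambda\sigma_\lambda+\sum_{a+b+c=\lambda-1}(\xi^c1_{\mathcal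 F})\circ\eta'_\lambda\circ b^-_{b,\lambda}\circ\epsilon'_\lambda\circ(\xi^a1_{\mathcal F})$ and $1_{\mathcal{FE}\mathbf 1_\lambda}=-\sigma_\lambda\sigma'_\lambda+\sum_{a+b+c=-\lambda-1}(1_{\mathcal F}\xi^c)\circ\eta_\lambda\circ b^+_{b,\lambda}\circ\epsilon_\lambda\circ(1_{\mathcal F}\xi^a)$, with $a,b,c\ge0$. **Family of $p$-differentials.** For parameters $x_\lambda,\bar x_\lambda,y_\lambda,\bar y_\lambda,a_\lambda,\bar a_\lambda\in\mathbb F_p$ ($\lambda\in\mathbb Z$) with $a_\lambda-\bar a_\lambda=x_{\lambda+2}-x_\lambda-2y_\lambda$, $x_\lambda+\bar x_\lambda=-\lambda$, $y_\lambda+\bar y_\lambda=-1$, there is a degree $2$, $p$-nilpotent operator $\partial$ on $2$-morphisms of $\mathcal U$, satisfying the Leibniz rule for vertical and horizontal composition, with $\partial\xi=\xi^2$; $\partial\xi'=(\xi')^2$; $\partial\tau_\lambda=a_\lambda1_{\mathcal{EE}}-(1+a_\lambda)(\xi1_{\mathcal E})\tau_\lambda+(a_\lambda-1)(1_{\mathcal E}\xi)\tau_\lambda$; $\partial\tau'_{\lambda+4}=\bar a_\lambda1_{\mathcal{FF}}-(1+\bar a_\lambda)\tau'_{\lambda+4}(1_{\mathcal F}\xi')+(\bar a_\lambda-1)\tau'_{\lambda+4}(\xi'1_{\mathcal F})$; $\partial\epsilon'_\lambda=x_{\lambda-2}\epsilon'_\lambda(\xi1_{\mathcal F})+y_{\lambda-2}b^+_{1,\lambda}\epsilon'_\lambda$;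 $\partial\eta'_\lambda=\bar x_{\lambda-2}(\xi1_{\mathcal F})\eta'_\lambda+\bar y_{\lambda-2}\eta'_\lambda b^+_{1,\lambda}$; $\partial\epsilon_\lambda=-(\bar x_\lambda+2\bar y_\lambda)\epsilon_\lambda(1_{\mathcal F}\xi)-\bar y_\lambda b^+_{1,\lambda}\epsilon_\lambda$; $\partial\eta_\lambda=-(x_\lambda+2y_\lambda)(1_{\mathcal F}\xi)\eta_\lambda-y_\lambda\eta_\lambda b^+_{1,\lambda}$. The differential $\partial_1$ is the member with $a_m=1$, $\bar a_m=-1$, $x_m=1$, $\bar x_m=-1-m$, $y_m=-1$, $\bar y_m=0$ for all $m\in\mathbb Z$. **Fantastic filtrations.** Let $R$ be a $p$-DG algebra (graded $\Bbbk$-algebra with a degree $2$ operator $\partial$, $\partial^p=0$, satisfying the Leibniz rule), $I$ a finite set, and $u_i,v_i\in R$ ($i\in I$) with $u_iv_iu_i=u_i$, $v_iu_iv_i=v_i$, $v_iu_j=0$ for $i\ne j$; put $\epsilon=\sum_iu_iv_i$. The data yield a fantastic filtration (Fc-filtration) on $R\epsilon$ if $\partial(\epsilon)=0$, $\partial(v_iu_i)=0$ for all $i$, and there is a total order on $I$ such that, with $F^{<i}=\sum_{k<i}Ru_kv_k$, one has $v_i\partial(u_i)=0$ and $u_i\partial(v_i)\in F^{<i}$ for all $i\in I$. (The last two conditions are equivalent to: $F^{\le i}=\sum_{k\le i}Ru_kv_k$ is a filtration of $R\epsilon$ by $p$-DG modules, each $Rv_iu_i$ is a $p$-DG module, and the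 isomorphisms $F^{\le i}/F^{<i}\cong Rv_iu_i$ given by right multiplication by $u_i$ and $v_i$ are isomorphisms of $p$-DG modules.) Here $R$ is the endomorphism algebra in $\mathcal U$ of the direct sum of $\mathcal{EF}\mathbf 1_\lambda$, $\mathcal{FE}\mathbf 1_\lambda$ and $\lambda$ copies of $\mathbf 1_\lambda$, with grading shifts $1-\lambda,3-\lambda,\dots,\lambda-1$; $I=\{0,\dots,\lambda\}$, the $u_c,v_c$ with $c<\lambda$ are maps between $\mathcal{EF}\mathbf 1_\lambda$ and the $c$-th copy of $\mathbf 1_\lambda$, $u_\lambda,v_\lambda$ are maps between $\mathcal{EF}\mathbf 1_\lambda$ and $\mathcal{FE}\mathbf 1_\lambda$, and $\epsilon=1_{\mathcal{EF}\mathbf 1_\lambda}$.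
   Formalization: Uniqueness is stated only for parameters of index m≥−1 (data fantastic for all λ>0), or for those entering at one fixed λ≥2; parameters of index below −1 never enter for λ>0, so literal uniqueness fails, and it fails for λ=1 taken alone. *)

theory Defs
  imports Complex_Main "HOL-Algebra.Ring"
begin

section \<open>The 2-category U, presented by generators and relations\<close>

text \<open>
  A 1-morphism without shift is a word with the weight of its source object: the word
  \<open>[\<E>, \<F>]\<close> with source \<open>l\<close> is EF1_l.  Letters act from right to left, as in composition.
\<close>

datatype letter = \<E> | \<F>

type_synonym word = "letter list"

text \<open>The target of the 1-morphism with word \<open>w\<close> and source \<open>l\<close> is \<open>l + wt w\<close>.\<close>

definition wt :: "word \<Rightarrow> int" where
  "wt w = sum_list (map (\<lambda>c. case c of \<E> \<Rightarrow> 2 | \<F> \<Rightarrow> - 2) w)"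

text \<open>
  The argument of a generator is always the weight of its source object (the region at the
  far right of the diagram).  Primed constants are those on F, respectively the ones
  between 1_l and EF1_l.
\<close>

datatype gen = Xi int | Xi' int | Tau int | Tau' int | Eta int | Eps int | Eta' int | Eps' int

fun gen_wt :: "gen \<Rightarrow> int" where
  "gen_wt (Xi l) = l" | "gen_wt (Xi' l) = l" | "gen_wt (Tau l) = l" | "gen_wt (Tau' l) = l"
| "gen_wt (Eta l) = l" | "gen_wt (Eps l) = l" | "gen_wt (Eta' l) = l" | "gen_wt (Eps' l) = l"

fun gen_dom :: "gen \<Rightarrow> word" where
  "gen_dom (Xi l) = [\<E>]" | "gen_dom (Xi' l) = [\<F>]"
| "gen_dom (Tau l) = [\<E>, \<E>]" | "gen_dom (Tau' l) = [\<F>, \<F>]"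
| "gen_dom (Eta l) = []" | "gen_dom (Eps l) = [\<F>, \<E>]"
| "gen_dom (Eta' l) = []" | "gen_dom (Eps' l) = [\<E>, \<F>]"

fun gen_cod :: "gen \<Rightarrow> word" where
  "gen_cod (Xi l) = [\<E>]" | "gen_cod (Xi' l) = [\<F>]"
| "gen_cod (Tau l) = [\<E>, \<E>]" | "gen_cod (Tau' l) = [\<F>, \<F>]"
| "gen_cod (Eta l) = [\<F>, \<E>]" | "gen_cod (Eps l) = []"
| "gen_cod (Eta' l) = [\<E>, \<F>]" | "gen_cod (Eps' l) = []"

fun gen_deg :: "gen \<Rightarrow> int" where
  "gen_deg (Xi l) = 2" | "gen_deg (Xi' l) = 2" | "gen_deg (Tau l) = - 2" | "gen_deg (Tau' l) = - 2"
| "gen_deg (Eta l) = 1 + l" | "gen_deg (Eps l) = 1 + l"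
| "gen_deg (Eta' l) = 1 - l" | "gen_deg (Eps' l) = 1 - l"

text \<open>Formal 2-morphisms; \<open>\<bullet>\<close> is vertical composition, \<open>\<star>\<close> horizontal composition.\<close>

datatype 'k tm =
    Zero
  | Gen gen
  | Id word int
  | Add "'k tm" "'k tm" (infixl "\<boxplus>" 65)
  | Scl 'k "'k tm" (infixr "\<cdot>" 67)
  | VC "'k tm" "'k tm" (infixr "\<bullet>" 70)
  | HC "'k tm" "'k tm" (infixr "\<star>" 75)

text \<open>\<open>typed t l u v\<close>: \<open>t\<close> is a formal 2-morphism from u1_l to v1_l.\<close>

primrec typed :: "'k tm \<Rightarrow> int \<Rightarrow> word \<Rightarrow> word \<Rightarrow> bool" where
  "typed Zero l u v \<longleftrightarrow> wt u = wt v"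
| "typed (Gen g) l u v \<longleftrightarrow> l = gen_wt g \<and> u = gen_dom g \<and> v = gen_cod g"
| "typed (Id w m) l u v \<longleftrightarrow> l = m \<and> u = w \<and> v = w"
| "typed (Add s t) l u v \<longleftrightarrow> typed s l u v \<and> typed t l u v"
| "typed (Scl c t) l u v \<longleftrightarrow> typed t l u v"
| "typed (VC s t) l u v \<longleftrightarrow> (\<exists>w. typed s l w v \<and> typed t l u w)"
| "typed (HC s t) l u v \<longleftrightarrow> (\<exists>u1 u2 v1 v2. u = u1 @ u2 \<and> v = v1 @ v2 \<and>
      typed s (l + wt u2) u1 v1 \<and> typed t l u2 v2)"

text \<open>\<open>has_deg t d\<close>: \<open>t\<close> is visibly homogeneous of degree \<open>d\<close>.\<close>

primrec has_deg :: "'k tm \<Rightarrow> int \<Rightarrow> bool" where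
  "has_deg Zero d \<longleftrightarrow> True"
| "has_deg (Gen g) d \<longleftrightarrow> d = gen_deg g"
| "has_deg (Id w m) d \<longleftrightarrow> d = 0"
| "has_deg (Add s t) d \<longleftrightarrow> has_deg s d \<and> has_deg t d"
| "has_deg (Scl c t) d \<longleftrightarrow> has_deg t d"
| "has_deg (VC s t) d \<longleftrightarrow> (\<exists>a b. d = a + b \<and> has_deg s a \<and> has_deg t b)"
| "has_deg (HC s t) d \<longleftrightarrow> (\<exists>a b. d = a + b \<and> has_deg s a \<and> has_deg t b)"

abbreviation xi :: "int \<Rightarrow> 'k tm" where "xi l \<equiv> Gen (Xi l)"
abbreviation xi' :: "int \<Rightarrow> 'k tm" where "xi' l \<equiv> Gen (Xi' l)"
abbreviation tau :: "int \<Rightarrow> 'k tm" where "tau l \<equiv> Gen (Tau l)"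
abbreviation tau' :: "int \<Rightarrow> 'k tm" where "tau' l \<equiv> Gen (Tau' l)"
abbreviation eta :: "int \<Rightarrow> 'k tm" where "eta l \<equiv> Gen (Eta l)"
abbreviation eps :: "int \<Rightarrow> 'k tm" where "eps l \<equiv> Gen (Eps l)"
abbreviation eta' :: "int \<Rightarrow> 'k tm" where "eta' l \<equiv> Gen (Eta' l)"
abbreviation eps' :: "int \<Rightarrow> 'k tm" where "eps' l \<equiv> Gen (Eps' l)"

definition neg :: "'k::field tm \<Rightarrow> 'k tm" where
  "neg t = (- 1) \<cdot> t"

definition Sums :: "'k tm list \<Rightarrow> 'k tm" where
  "Sums ts = foldr Add ts Zero"

text \<open>Pairs and triples of nonnegative integers with sum \<open>m\<close>; empty for negative \<open>m\<close>.\<close>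

definition pairs :: "int \<Rightarrow> (int \<times> int) list" where
  "pairs m = [(a, b). a \<leftarrow> [0..m], b \<leftarrow> [0..m], a + b = m]"

definition triples :: "int \<Rightarrow> (int \<times> int \<times> int) list" where
  "triples m = [(a, b, c). a \<leftarrow> [0..m], b \<leftarrow> [0..m], c \<leftarrow> [0..m], a + b + c = m]"

text \<open>\<open>xipow n l\<close> is the \<open>n\<close>-th vertical power of xi on E1_l; only \<open>n \<ge> 0\<close> is used.\<close>

definition xipow :: "int \<Rightarrow> int \<Rightarrow> 'k tm" where
  "xipow n l = ((\<lambda>t. xi l \<bullet> t) ^^ nat n) (Id [\<E>] l)"

text \<open>\<open>xipow_F n l\<close> is xi^n 1_F on EF1_l, and \<open>F_xipow n l\<close> is 1_F xi^n on FE1_l.\<close>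

definition xipow_F :: "int \<Rightarrow> int \<Rightarrow> 'k tm" where
  "xipow_F n l = xipow n (l - 2) \<star> Id [\<F>] l"

definition F_xipow :: "int \<Rightarrow> int \<Rightarrow> 'k tm" where
  "F_xipow n l = Id [\<F>] (l + 2) \<star> xipow n l"


subsection \<open>Bubbles\<close>

text \<open>Real bubbles, indexed by half their degree \<open>k\<close>, not by their number of dots.\<close>

definition real_bubble_plus :: "int \<Rightarrow> int \<Rightarrow> 'k tm" where
  "real_bubble_plus k l = eps' l \<bullet> xipow_F (k + l - 1) l \<bullet> eta' l"

definition real_bubble_minus :: "int \<Rightarrow> int \<Rightarrow> 'k tm" where
  "real_bubble_minus k l = eps l \<bullet> F_xipow (k - l - 1) l \<bullet> eta l"

text \<open>
  Fake bubbles of nonnegative degree, obtained by solving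
  \<open>\<Sum>a+b=k. b\<^sup>+\<^sub>a b\<^sup>-\<^sub>b = 0\<close> recursively with constant terms 1.  A bubble of positive degree in
  weight \<open>l\<close> can only be fake for one of the two orientations (for plus if \<open>l < 0\<close>, for
  minus if \<open>l > 0\<close>), so the other factors occurring in the recursion are real.
\<close>

fun fake_bubble_plus :: "nat \<Rightarrow> int \<Rightarrow> 'k::field tm" where
  "fake_bubble_plus k l = (if k = 0 then Id [] l else
     neg (Sums (map (\<lambda>a. fake_bubble_plus a l \<bullet> real_bubble_minus (int k - int a) l) [0..<k])))"

fun fake_bubble_minus :: "nat \<Rightarrow> int \<Rightarrow> 'k::field tm" where
  "fake_bubble_minus k l = (if k = 0 then Id [] l else
     neg (Sums (map (\<lambda>b. real_bubble_plus (int k - int b) l \<bullet> fake_bubble_minus b l) [0..<k])))"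

declare fake_bubble_plus.simps [simp del] fake_bubble_minus.simps [simp del]

definition bubble_plus :: "int \<Rightarrow> int \<Rightarrow> 'k::field tm" where
  "bubble_plus k l =
     (if k \<ge> 1 - l then real_bubble_plus k l
      else if k < 0 then Zero else fake_bubble_plus (nat k) l)"

definition bubble_minus :: "int \<Rightarrow> int \<Rightarrow> 'k::field tm" where
  "bubble_minus k l =
     (if k \<ge> 1 + l then real_bubble_minus k l
      else if k < 0 then Zero else fake_bubble_minus (nat k) l)"


subsection \<open>Sideways crossings\<close>

definition sigma :: "int \<Rightarrow> 'k tm" where
  "sigma l = (Id [\<F>, \<E>] l \<star> eps' l)
           \<bullet> (Id [\<F>] (l + 2) \<star> tau (l - 2) \<star> Id [\<F>] l)
           \<bullet> (eta l \<star> Id [\<E>, \<F>] l)"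

definition sigma' :: "int \<Rightarrow> 'k tm" where
  "sigma' l = (eps l \<star> Id [\<E>, \<F>] l)
            \<bullet> (Id [\<F>] (l + 2) \<star> tau (l - 2) \<star> Id [\<F>] l)
            \<bullet> (Id [\<F>, \<E>] l \<star> eta' l)"


subsection \<open>Defining relations\<close>

inductive rel :: "'k::field tm \<Rightarrow> 'k tm \<Rightarrow> bool" where
  \<comment> \<open>adjunctions and cyclicity\<close>
  adj1: "rel ((eps' (l + 2) \<star> Id [\<E>] l) \<bullet> (Id [\<E>] l \<star> eta l)) (Id [\<E>] l)"
| adj2: "rel ((Id [\<E>] l \<star> eps l) \<bullet> (eta' (l + 2) \<star> Id [\<E>] l)) (Id [\<E>] l)"
| adj3: "rel ((eps (l - 2) \<star> Id [\<F>] l) \<bullet> (Id [\<F>] l \<star> eta' l)) (Id [\<F>] l)"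
| adj4: "rel ((Id [\<F>] l \<star> eps' l) \<bullet> (eta (l - 2) \<star> Id [\<F>] l)) (Id [\<F>] l)"
| cyc_xi1: "rel (eps' l \<bullet> (xi (l - 2) \<star> Id [\<F>] l)) (eps' l \<bullet> (Id [\<E>] (l - 2) \<star> xi' l))"
| cyc_xi2: "rel (eps l \<bullet> (xi' (l + 2) \<star> Id [\<E>] l)) (eps l \<bullet> (Id [\<F>] (l + 2) \<star> xi l))"
| cyc_tau1: "rel
    ((eps' l \<bullet> (Id [\<E>] (l - 2) \<star> eps' (l - 2) \<star> Id [\<F>] l)) \<bullet> (tau (l - 4) \<star> Id [\<F>, \<F>] l))
    ((eps' l \<bullet> (Id [\<E>] (l - 2) \<star> eps' (l - 2) \<star> Id [\<F>] l)) \<bullet> (Id [\<E>, \<E>] (l - 4) \<star> tau' l))"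
| cyc_tau2: "rel
    ((eps l \<bullet> (Id [\<F>] (l + 2) \<star> eps (l + 2) \<star> Id [\<E>] l)) \<bullet> (tau' (l + 4) \<star> Id [\<E>, \<E>] l))
    ((eps l \<bullet> (Id [\<F>] (l + 2) \<star> eps (l + 2) \<star> Id [\<E>] l)) \<bullet> (Id [\<F>, \<F>] (l + 4) \<star> tau l))"
  \<comment> \<open>bubble relations\<close>
| bubble_plus_neg: "k < 0 \<Longrightarrow> rel (bubble_plus k l) Zero"
| bubble_minus_neg: "k < 0 \<Longrightarrow> rel (bubble_minus k l) Zero"
| bubble_plus_0: "rel (bubble_plus 0 l) (Id [] l)"
| bubble_minus_0: "rel (bubble_minus 0 l) (Id [] l)"
| bubble_sum: "rel (Sums (map (\<lambda>(a, b). bubble_plus a l \<bullet> bubble_minus b l) (pairs m)))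
                   (if m = 0 then Id [] l else Zero)"
  \<comment> \<open>nilHecke relations\<close>
| tau_sq: "rel (tau l \<bullet> tau l) Zero"
| braid: "rel
    ((tau (l + 2) \<star> Id [\<E>] l) \<bullet> (Id [\<E>] (l + 4) \<star> tau l) \<bullet> (tau (l + 2) \<star> Id [\<E>] l))
    ((Id [\<E>] (l + 4) \<star> tau l) \<bullet> (tau (l + 2) \<star> Id [\<E>] l) \<bullet> (Id [\<E>] (l + 4) \<star> tau l))"
| dot1: "rel (tau l \<bullet> (xi (l + 2) \<star> Id [\<E>] l) \<boxplus> neg ((Id [\<E>] (l + 2) \<star> xi l) \<bullet> tau l))
             (Id [\<E>, \<E>] l)"
| dot2: "rel ((xi (l + 2) \<star> Id [\<E>] l) \<bullet> tau l \<boxplus> neg (tau l \<bullet> (Id [\<E>] (l + 2) \<star> xi l)))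
             (Id [\<E>, \<E>] l)"
  \<comment> \<open>curls\<close>
| curl1: "rel
    ((Id [\<E>] l \<star> eps' l) \<bullet> (tau (l - 2) \<star> Id [\<F>] l) \<bullet> (Id [\<E>] l \<star> eta' l))
    (neg (Sums (map (\<lambda>(a, b). xipow b l \<star> bubble_plus a l) (pairs (- l)))))"
| curl2: "rel
    ((eps l \<star> Id [\<E>] (l - 2)) \<bullet> (Id [\<F>] (l + 2) \<star> tau (l - 2)) \<bullet> (eta l \<star> Id [\<E>] (l - 2)))
    (Sums (map (\<lambda>(a, b). bubble_minus a l \<star> xipow b (l - 2)) (pairs l)))"
  \<comment> \<open>decompositions of EF and FE\<close>
| dec_EF: "rel (Id [\<E>, \<F>] l)
    (neg (sigma' l \<bullet> sigma l) \<boxplus>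
     Sums (map (\<lambda>(a, b, c). xipow_F c l \<bullet> eta' l \<bullet> bubble_minus b l \<bullet> eps' l \<bullet> xipow_F a l)
               (triples (l - 1))))"
| dec_FE: "rel (Id [\<F>, \<E>] l)
    (neg (sigma l \<bullet> sigma' l) \<boxplus>
     Sums (map (\<lambda>(a, b, c). F_xipow c l \<bullet> eta l \<bullet> bubble_plus b l \<bullet> eps l \<bullet> F_xipow a l)
               (triples (- l - 1))))"

text \<open>
  The congruence generated by the axioms of a strict k-linear 2-category and by \<open>rel\<close>.
  The linear axioms and associativity are imposed on all terms, so that the quotient is one
  vector space in which every 2-morphism space of U is a subspace; ill-typed terms do not
  belong to any of these subspaces.
\<close>

inductive eqv :: "'k::field tm \<Rightarrow> 'k tm \<Rightarrow> bool" (infix "\<simeq>" 50) where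
  rel: "rel s t \<Longrightarrow> s \<simeq> t"
| refl: "t \<simeq> t"
| sym: "s \<simeq> t \<Longrightarrow> t \<simeq> s"
| trans: "s \<simeq> t \<Longrightarrow> t \<simeq> r \<Longrightarrow> s \<simeq> r"
| cong_Add: "s \<simeq> s' \<Longrightarrow> t \<simeq> t' \<Longrightarrow> s \<boxplus> t \<simeq> s' \<boxplus> t'"
| cong_Scl: "t \<simeq> t' \<Longrightarrow> c \<cdot> t \<simeq> c \<cdot> t'"
| cong_VC: "s \<simeq> s' \<Longrightarrow> t \<simeq> t' \<Longrightarrow> s \<bullet> t \<simeq> s' \<bullet> t'"
| cong_HC: "s \<simeq> s' \<Longrightarrow> t \<simeq> t' \<Longrightarrow> s \<star> t \<simeq> s' \<star> t'"
| add_assoc: "(s \<boxplus> t) \<boxplus> r \<simeq> s \<boxplus> (t \<boxplus> r)"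
| add_comm: "s \<boxplus> t \<simeq> t \<boxplus> s"
| add_zero: "Zero \<boxplus> t \<simeq> t"
| add_neg: "neg t \<boxplus> t \<simeq> Zero"
| scl_add: "c \<cdot> (s \<boxplus> t) \<simeq> c \<cdot> s \<boxplus> c \<cdot> t"
| add_scl: "(c + d) \<cdot> t \<simeq> c \<cdot> t \<boxplus> d \<cdot> t"
| scl_scl: "c \<cdot> (d \<cdot> t) \<simeq> (c * d) \<cdot> t"
| scl_one: "1 \<cdot> t \<simeq> t"
| VC_addl: "(s \<boxplus> t) \<bullet> r \<simeq> s \<bullet> r \<boxplus> t \<bullet> r"
| VC_addr: "r \<bullet> (s \<boxplus> t) \<simeq> r \<bullet> s \<boxplus> r \<bullet> t"
| VC_scll: "(c \<cdot> s) \<bullet> t \<simeq> c \<cdot> (s \<bullet> t)"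
| VC_sclr: "s \<bullet> (c \<cdot> t) \<simeq> c \<cdot> (s \<bullet> t)"
| HC_addl: "(s \<boxplus> t) \<star> r \<simeq> s \<star> r \<boxplus> t \<star> r"
| HC_addr: "r \<star> (s \<boxplus> t) \<simeq> r \<star> s \<boxplus> r \<star> t"
| HC_scll: "(c \<cdot> s) \<star> t \<simeq> c \<cdot> (s \<star> t)"
| HC_sclr: "s \<star> (c \<cdot> t) \<simeq> c \<cdot> (s \<star> t)"
| VC_assoc: "(s \<bullet> t) \<bullet> r \<simeq> s \<bullet> (t \<bullet> r)"
| HC_assoc: "(s \<star> t) \<star> r \<simeq> s \<star> (t \<star> r)"
| VC_idl: "typed t l u v \<Longrightarrow> Id v l \<bullet> t \<simeq> t"
| VC_idr: "typed t l u v \<Longrightarrow> t \<bullet> Id u l \<simeq> t"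
| HC_idl: "typed t l u v \<Longrightarrow> Id [] (l + wt u) \<star> t \<simeq> t"
| HC_idr: "typed t l u v \<Longrightarrow> t \<star> Id [] l \<simeq> t"
| HC_id: "Id u (l + wt v) \<star> Id v l \<simeq> Id (u @ v) l"
| interchange: "typed s (l + wt u2) u1 v1 \<Longrightarrow> typed s' (l + wt u2) v1 w1 \<Longrightarrow>
    typed t l u2 v2 \<Longrightarrow> typed t' l v2 w2 \<Longrightarrow> (s' \<bullet> s) \<star> (t' \<bullet> t) \<simeq> (s' \<star> t') \<bullet> (s \<star> t)"

quotient_type (overloaded) 'k mor = "'k::field tm" / eqv
  morphisms rep_mor cls
  by (rule equivpI) (auto intro: reflpI sympI transpI eqv.refl eqv.sym eqv.trans)

instantiation mor :: (field) ab_group_add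
begin

lift_definition zero_mor :: "'a mor" is Zero .
lift_definition plus_mor :: "'a mor \<Rightarrow> 'a mor \<Rightarrow> 'a mor" is Add by (rule eqv.cong_Add)
lift_definition uminus_mor :: "'a mor \<Rightarrow> 'a mor" is neg
  unfolding neg_def by (rule eqv.cong_Scl)
definition minus_mor :: "'a mor \<Rightarrow> 'a mor \<Rightarrow> 'a mor" where "minus_mor f g = f + - g"

instance
proof
  fix f g h :: "'a mor"
  show "f + g + h = f + (g + h)" by transfer (rule eqv.add_assoc)
  show "f + g = g + f" by transfer (rule eqv.add_comm)
  show "0 + f = f" by transfer (rule eqv.add_zero)
  show "- f + f = 0" by transfer (rule eqv.add_neg)
  show "f - g = f + - g" by (rule minus_mor_def)
qed

end

lift_definition scl :: "'k::field \<Rightarrow> 'k mor \<Rightarrow> 'k mor" is Scl by (rule eqv.cong_Scl)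

lift_definition vcomp :: "'k::field mor \<Rightarrow> 'k mor \<Rightarrow> 'k mor" (infixr "\<circ>\<^sub>v" 70) is VC
  by (rule eqv.cong_VC)

lift_definition hcomp :: "'k::field mor \<Rightarrow> 'k mor \<Rightarrow> 'k mor" (infixr "\<circ>\<^sub>h" 75) is HC
  by (rule eqv.cong_HC)

text \<open>2-morphisms from u1_l to v1_l, of all degrees, and those that are homogeneous of
  degree \<open>d\<close>.\<close>

definition HOM :: "int \<Rightarrow> word \<Rightarrow> word \<Rightarrow> 'k::field mor set" where
  "HOM l u v = {cls t | t. typed t l u v}"

definition HOM_deg :: "int \<Rightarrow> int \<Rightarrow> word \<Rightarrow> word \<Rightarrow> 'k::field mor set" where
  "HOM_deg d l u v = {cls t | t. typed t l u v \<and> has_deg t d}"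


section \<open>The family of p-differentials\<close>

text \<open>The suffix \<open>b\<close> marks the barred parameters.\<close>

record 'k pars =
  px :: "int \<Rightarrow> 'k"
  pxb :: "int \<Rightarrow> 'k"
  py :: "int \<Rightarrow> 'k"
  pyb :: "int \<Rightarrow> 'k"
  pa :: "int \<Rightarrow> 'k"
  pab :: "int \<Rightarrow> 'k"

text \<open>\<open>range of_int\<close> is the prime field of \<open>'k\<close>.\<close>

definition admissible :: "'k::field pars \<Rightarrow> bool" where
  "admissible P \<longleftrightarrow> (\<forall>l.
     {px P l, pxb P l, py P l, pyb P l, pa P l, pab P l} \<subseteq> range of_int \<and>
     pa P l - pab P l = px P (l + 2) - px P l - 2 * py P l \<and>
     px P l + pxb P l = - of_int l \<and>
     py P l + pyb P l = - 1)"

text \<open>\<open>differential P D\<close>: \<open>D\<close> is the p-differential on U with parameters \<open>P\<close>.  The values of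
  \<open>D\<close> outside of the 2-morphism spaces of U are irrelevant.\<close>

definition differential :: "'k::field pars \<Rightarrow> ('k mor \<Rightarrow> 'k mor) \<Rightarrow> bool" where
  "differential P D \<longleftrightarrow>
     \<comment> \<open>linear operator of degree 2, p-nilpotent\<close>
     (\<forall>l u v. D ` HOM l u v \<subseteq> HOM l u v) \<and>
     (\<forall>l u v. \<forall>f\<in>HOM l u v. \<forall>g\<in>HOM l u v. D (f + g) = D f + D g) \<and>
     (\<forall>l u v c. \<forall>f\<in>HOM l u v. D (scl c f) = scl c (D f)) \<and>
     (\<forall>d l u v. D ` HOM_deg d l u v \<subseteq> HOM_deg (d + 2) l u v) \<and>
     (\<forall>l u v. \<forall>f\<in>HOM l u v. (D ^^ CHAR('k)) f = 0) \<and>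
     \<comment> \<open>Leibniz rules\<close>
     (\<forall>l u v w. \<forall>f\<in>HOM l v w. \<forall>g\<in>HOM l u v.
        D (f \<circ>\<^sub>v g) = D f \<circ>\<^sub>v g + f \<circ>\<^sub>v D g) \<and>
     (\<forall>l u v u' v'. \<forall>f\<in>HOM (l + wt u) u' v'. \<forall>g\<in>HOM l u v.
        D (f \<circ>\<^sub>h g) = D f \<circ>\<^sub>h g + f \<circ>\<^sub>h D g) \<and>
     \<comment> \<open>values on the generators\<close>
     (\<forall>l. D (cls (xi l)) = cls (xi l \<bullet> xi l)) \<and>
     (\<forall>l. D (cls (xi' l)) = cls (xi' l \<bullet> xi' l)) \<and>
     (\<forall>l. D (cls (tau l)) = cls (
        pa P l \<cdot> Id [\<E>, \<E>] l
        \<boxplus> (- (1 + pa P l)) \<cdot> ((xi (l + 2) \<star> Id [\<E>] l) \<bullet> tau l)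
        \<boxplus> (pa P l - 1) \<cdot> ((Id [\<E>] (l + 2) \<star> xi l) \<bullet> tau l))) \<and>
     (\<forall>l. D (cls (tau' (l + 4))) = cls (
        pab P l \<cdot> Id [\<F>, \<F>] (l + 4)
        \<boxplus> (- (1 + pab P l)) \<cdot> (tau' (l + 4) \<bullet> (Id [\<F>] (l + 2) \<star> xi' (l + 4)))
        \<boxplus> (pab P l - 1) \<cdot> (tau' (l + 4) \<bullet> (xi' (l + 2) \<star> Id [\<F>] (l + 4))))) \<and>
     (\<forall>l. D (cls (eps' l)) = cls (
        px P (l - 2) \<cdot> (eps' l \<bullet> (xi (l - 2) \<star> Id [\<F>] l))
        \<boxplus> py P (l - 2) \<cdot> (bubble_plus 1 l \<bullet> eps' l))) \<and>
     (\<forall>l. D (cls (eta' l)) = cls (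
        pxb P (l - 2) \<cdot> ((xi (l - 2) \<star> Id [\<F>] l) \<bullet> eta' l)
        \<boxplus> pyb P (l - 2) \<cdot> (eta' l \<bullet> bubble_plus 1 l))) \<and>
     (\<forall>l. D (cls (eps l)) = cls (
        (- (pxb P l + 2 * pyb P l)) \<cdot> (eps l \<bullet> (Id [\<F>] (l + 2) \<star> xi l))
        \<boxplus> (- pyb P l) \<cdot> (bubble_plus 1 l \<bullet> eps l))) \<and>
     (\<forall>l. D (cls (eta l)) = cls (
        (- (px P l + 2 * py P l)) \<cdot> ((Id [\<F>] (l + 2) \<star> xi l) \<bullet> eta l)
        \<boxplus> (- py P l) \<cdot> (eta l \<bullet> bubble_plus 1 l)))"

definition pars1 :: "'k::field pars" where
  "pars1 = \<lparr> px = (\<lambda>m. 1), pxb = (\<lambda>m. - 1 - of_int m), py = (\<lambda>m. - 1), pyb = (\<lambda>m. 0),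
             pa = (\<lambda>m. 1), pab = (\<lambda>m. - 1) \<rparr>"

text \<open>Equality of the parameters x, y (barred and not), respectively a, at the index \<open>m\<close>.\<close>

definition same_xy :: "'k pars \<Rightarrow> 'k pars \<Rightarrow> int \<Rightarrow> bool" where
  "same_xy P Q m \<longleftrightarrow>
     px P m = px Q m \<and> pxb P m = pxb Q m \<and> py P m = py Q m \<and> pyb P m = pyb Q m"

definition same_a :: "'k pars \<Rightarrow> 'k pars \<Rightarrow> int \<Rightarrow> bool" where
  "same_a P Q m \<longleftrightarrow> pa P m = pa Q m \<and> pab P m = pab Q m"


section \<open>Fantastic filtrations\<close>

text \<open>The left ideal \<open>\<Sum>k<i. R u\<^sub>k v\<^sub>k\<close>, for a (reflexive) order \<open>r\<close>.\<close>

definition Fc_less ::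
  "('r, 'm) ring_scheme \<Rightarrow> 'i set \<Rightarrow> 'i rel \<Rightarrow> ('i \<Rightarrow> 'r) \<Rightarrow> ('i \<Rightarrow> 'r) \<Rightarrow> 'i \<Rightarrow> 'r set" where
  "Fc_less R I r u v i =
     {\<Oplus>\<^bsub>R\<^esub>k\<in>{k \<in> I. (k, i) \<in> r \<and> k \<noteq> i}. s k \<otimes>\<^bsub>R\<^esub> u k \<otimes>\<^bsub>R\<^esub> v k | s. \<forall>k\<in>I. s k \<in> carrier R}"

definition fantastic_filtration ::
  "('r, 'm) ring_scheme \<Rightarrow> ('r \<Rightarrow> 'r) \<Rightarrow> 'i set \<Rightarrow> ('i \<Rightarrow> 'r) \<Rightarrow> ('i \<Rightarrow> 'r) \<Rightarrow> bool" where
  "fantastic_filtration R dd I u v \<longleftrightarrow>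
     \<comment> \<open>the data\<close>
     finite I \<and>
     (\<forall>i\<in>I. u i \<in> carrier R \<and> v i \<in> carrier R) \<and>
     (\<forall>i\<in>I. u i \<otimes>\<^bsub>R\<^esub> v i \<otimes>\<^bsub>R\<^esub> u i = u i \<and> v i \<otimes>\<^bsub>R\<^esub> u i \<otimes>\<^bsub>R\<^esub> v i = v i) \<and>
     (\<forall>i\<in>I. \<forall>j\<in>I. i \<noteq> j \<longrightarrow> v i \<otimes>\<^bsub>R\<^esub> u j = \<zero>\<^bsub>R\<^esub>) \<and>
     \<comment> \<open>the Fc-conditions\<close>
     dd (\<Oplus>\<^bsub>R\<^esub>i\<in>I. u i \<otimes>\<^bsub>R\<^esub> v i) = \<zero>\<^bsub>R\<^esub> \<and>
     (\<forall>i\<in>I. dd (v i \<otimes>\<^bsub>R\<^esub> u i) = \<zero>\<^bsub>R\<^esub>) \<and>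
     (\<exists>r. linear_order_on I r \<and>
        (\<forall>i\<in>I. v i \<otimes>\<^bsub>R\<^esub> dd (u i) = \<zero>\<^bsub>R\<^esub> \<and> u i \<otimes>\<^bsub>R\<^esub> dd (v i) \<in> Fc_less R I r u v i))"


section \<open>Endomorphism algebras of direct sums of shifted 1-morphisms\<close>

text \<open>
  A 1-morphism of U with source \<open>l\<close> is a list of words with grading shifts.  Its endomorphism
  algebra consists of matrices whose entry \<open>(i, j)\<close> is a 2-morphism, of any degree, from the
  \<open>j\<close>-th to the \<open>i\<close>-th summand (and 0 outside of the index range, for extensionality).  Shifts
  do not change this algebra, only its grading \<open>END_deg\<close>.
\<close>

definition END :: "int \<Rightarrow> (word \<times> int) list \<Rightarrow> (nat \<Rightarrow> nat \<Rightarrow> 'k::field mor) ring" where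
  "END l X = \<lparr>
     carrier = {M. \<forall>i j. if i < length X \<and> j < length X
                          then M i j \<in> HOM l (fst (X ! j)) (fst (X ! i)) else M i j = 0},
     mult = (\<lambda>M N i j. \<Sum>k<length X. M i k \<circ>\<^sub>v N k j),
     one = (\<lambda>i j. if i = j \<and> i < length X then cls (Id (fst (X ! i)) l) else 0),
     zero = (\<lambda>i j. 0),
     add = (\<lambda>M N i j. M i j + N i j) \<rparr>"

definition END_deg :: "int \<Rightarrow> int \<Rightarrow> (word \<times> int) list \<Rightarrow> (nat \<Rightarrow> nat \<Rightarrow> 'k::field mor) set" where
  "END_deg d l X = {M. M \<in> carrier (END l X) \<and> (\<forall>i<length X. \<forall>j<length X.
     M i j \<in> HOM_deg (d + snd (X ! j) - snd (X ! i)) l (fst (X ! j)) (fst (X ! i)))}"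

definition END_diff ::
  "('k mor \<Rightarrow> 'k mor) \<Rightarrow> (nat \<Rightarrow> nat \<Rightarrow> 'k::field mor) \<Rightarrow> nat \<Rightarrow> nat \<Rightarrow> 'k mor" where
  "END_diff D M = (\<lambda>i j. D (M i j))"

definition matrix_unit :: "nat \<Rightarrow> nat \<Rightarrow> 'k::field mor \<Rightarrow> nat \<Rightarrow> nat \<Rightarrow> 'k mor" where
  "matrix_unit i j f = (\<lambda>i' j'. if i' = i \<and> j' = j then f else 0)"


section \<open>The decomposition of EF1_l\<close>

text \<open>EF1_l, FE1_l and copies of 1_l with shifts 1-l, 3-l, ..., l-1: summand 0 is EF1_l,
  summand 1 is FE1_l, and summand \<open>c + 2\<close> is the \<open>c\<close>-th copy of 1_l.\<close>

definition EF_sum :: "int \<Rightarrow> (word \<times> int) list" where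
  "EF_sum l = ([\<E>, \<F>], 0) # ([\<F>, \<E>], 0) # map (\<lambda>c. ([], 1 - l + 2 * c)) [0..l - 1]"

definition EF_u :: "int \<Rightarrow> nat \<Rightarrow> nat \<Rightarrow> nat \<Rightarrow> 'k::field mor" where
  "EF_u l c = (if int c < l then matrix_unit 0 (c + 2) (cls (xipow_F (int c) l \<bullet> eta' l))
               else matrix_unit 0 1 (cls (sigma' l)))"

definition EF_v :: "int \<Rightarrow> nat \<Rightarrow> nat \<Rightarrow> nat \<Rightarrow> 'k::field mor" where
  "EF_v l c = (if int c < l then matrix_unit (c + 2) 0
                 (cls (Sums (map (\<lambda>(a, b). bubble_minus b l \<bullet> eps' l \<bullet> xipow_F a l)
                                 (pairs (l - 1 - int c)))))
               else matrix_unit 1 0 (cls (neg (sigma l))))"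

definition EF_fantastic :: "('k::field mor \<Rightarrow> 'k mor) \<Rightarrow> int \<Rightarrow> bool" where
  "EF_fantastic D l \<longleftrightarrow>
     fantastic_filtration (END l (EF_sum l)) (END_diff D) {0..nat l} (EF_u l) (EF_v l)"

end

(*
  The maps v_i and u_j compose to delta_ij because curls with fewer than l dots vanish, so the
  filtration conditions say that v_i D(u_k) = 0 whenever k is not below i.  The Leibniz rule gives
    v_c D(u_c') = (c' + xb_{l-2}) v_c u_{c'+1} + yb_{l-2} delta_{c,c'} b^+_1,
    - sigma D(sigma') = A (xi' 1_E) + (a_{l-2} - 1) (1_F xi) - yb_l (b^+_1 1_FE) + yb_{l-2} (1_FE b^+_1)
  with A = xb_{l-2} - xb_l - 2 yb_l - 1 - a_{l-2}.  For D = D_1 all of these vanish for the order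
  l < 0 < 1 < ... < l-1 on the index set.

  Conversely, the parameters can be read off once b^+_1 and the 2-morphisms on the right are known
  to be linearly independent in U.  This is seen in a 2-representation: the torus-equivariant
  cohomology of Grassmannians, localized at the fixed points.  Objects become subsets S of a finite
  set X of elements of a field, E adds a point and F removes one, a word becomes the set of paths of
  its type, and a dot acts by the point that is moved.  The relations of U turn into partial fraction
  identities for prod_{b in X - S} (z - b) / prod_{a in S} (z - a).  Taking for X powers of the
  variable of the field of formal Laurent series gives the independence.
*)
theory Submission
  imports Defs "HOL-Computational_Algebra.Formal_Laurent_Series"
begin

section \<open>The strict 2-category structure on 2-morphisms\<close>

lemma wt_append: "wt (u @ v) = wt u + wt v" by (simp add: wt_def)
lemma typed_wt: "typed t l u v \<Longrightarrow> wt u = wt v"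
proof (induction t arbitrary: l u v)
  case (Gen g) then show ?case by (cases g) (auto simp: wt_def)
next case (VC s t) then show ?case by simp metis
next case (HC s t) then show ?case by (simp add: wt_append) (metis wt_append)
qed auto

lemma cls_VC: "cls (s \<bullet> t) = cls s \<circ>\<^sub>v cls t" by (simp add: vcomp.abs_eq)
lemma cls_HC: "cls (s \<star> t) = cls s \<circ>\<^sub>h cls t" by (simp add: hcomp.abs_eq)
lemma cls_Add: "cls (s \<boxplus> t) = cls s + cls t" by (simp add: plus_mor.abs_eq)
lemma cls_Scl: "cls (c \<cdot> t) = scl c (cls t)" by (simp add: scl.abs_eq)
lemma cls_Zero: "cls Zero = 0" by (simp add: zero_mor_def)
lemma cls_neg: "cls (neg t) = - cls t" by (simp add: uminus_mor.abs_eq)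
lemma cls_Sums: "cls (Sums ts) = sum_list (map cls ts)"
  by (induction ts) (simp_all add: Sums_def cls_Zero cls_Add)

lemmas cls_simps = cls_VC cls_HC cls_Add cls_Scl cls_Zero cls_neg cls_Sums

lemma cls_rel: "rel s t \<Longrightarrow> cls s = cls t"
  by (simp add: mor.abs_eq_iff eqv.rel)

lemma vcomp_assoc: "(f \<circ>\<^sub>v g) \<circ>\<^sub>v h = f \<circ>\<^sub>v g \<circ>\<^sub>v h" by transfer (rule eqv.VC_assoc)
lemma hcomp_assoc: "(f \<circ>\<^sub>h g) \<circ>\<^sub>h h = f \<circ>\<^sub>h g \<circ>\<^sub>h h" by transfer (rule eqv.HC_assoc)
lemma vcomp_add_left: "(f + g) \<circ>\<^sub>v h = f \<circ>\<^sub>v h + g \<circ>\<^sub>v h" by transfer (rule eqv.VC_addl)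
lemma vcomp_add_right: "h \<circ>\<^sub>v (f + g) = h \<circ>\<^sub>v f + h \<circ>\<^sub>v g" by transfer (rule eqv.VC_addr)
lemma hcomp_add_left: "(f + g) \<circ>\<^sub>h h = f \<circ>\<^sub>h h + g \<circ>\<^sub>h h" by transfer (rule eqv.HC_addl)
lemma hcomp_add_right: "h \<circ>\<^sub>h (f + g) = h \<circ>\<^sub>h f + h \<circ>\<^sub>h g" by transfer (rule eqv.HC_addr)
lemma vcomp_scl_left: "scl c f \<circ>\<^sub>v g = scl c (f \<circ>\<^sub>v g)" by transfer (rule eqv.VC_scll)
lemma vcomp_scl_right: "f \<circ>\<^sub>v scl c g = scl c (f \<circ>\<^sub>v g)" by transfer (rule eqv.VC_sclr)
lemma hcomp_scl_left: "scl c f \<circ>\<^sub>h g = scl c (f \<circ>\<^sub>h g)" by transfer (rule eqv.HC_scll)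
lemma hcomp_scl_right: "f \<circ>\<^sub>h scl c g = scl c (f \<circ>\<^sub>h g)" by transfer (rule eqv.HC_sclr)
lemma scl_add_right: "scl c (f + g) = scl c f + scl c g" by transfer (rule eqv.scl_add)
lemma scl_add_left: "scl (c + d) f = scl c f + scl d f" by transfer (rule eqv.add_scl)
lemma scl_scl: "scl c (scl d f) = scl (c * d) f" by transfer (rule eqv.scl_scl)
lemma scl_one [simp]: "scl 1 f = f" by transfer (rule eqv.scl_one)
lemma uminus_eq_scl: "- f = scl (- 1) f" by transfer (simp add: neg_def eqv.refl)

interpretation mor: module scl
  by unfold_locales (simp_all add: scl_add_right scl_add_left scl_scl)

interpretation vcomp_right: additive "(\<circ>\<^sub>v) f" for f :: "'k::field mor"
  by unfold_locales (rule vcomp_add_right)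
interpretation vcomp_left: additive "\<lambda>f. f \<circ>\<^sub>v g" for g :: "'k::field mor"
  by unfold_locales (rule vcomp_add_left)
interpretation hcomp_right: additive "(\<circ>\<^sub>h) f" for f :: "'k::field mor"
  by unfold_locales (rule hcomp_add_right)
interpretation hcomp_left: additive "\<lambda>f. f \<circ>\<^sub>h g" for g :: "'k::field mor"
  by unfold_locales (rule hcomp_add_left)

lemmas comp_zero [simp] = vcomp_right.zero vcomp_left.zero hcomp_right.zero hcomp_left.zero
lemmas comp_minus = vcomp_right.minus vcomp_left.minus hcomp_right.minus hcomp_left.minus
lemmas comp_diff = vcomp_right.diff vcomp_left.diff hcomp_right.diff hcomp_left.diff
lemmas comp_add = vcomp_add_left vcomp_add_right hcomp_add_left hcomp_add_right
lemmas comp_scl = vcomp_scl_left vcomp_scl_right hcomp_scl_left hcomp_scl_right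

abbreviation idm :: "word \<Rightarrow> int \<Rightarrow> 'k::field mor" where "idm w l \<equiv> cls (Id w l)"

lemma HOM_E:
  assumes "f \<in> HOM l u v"
  obtains t where "f = cls t" "typed t l u v"
  using assms unfolding HOM_def by blast
lemma HOM_cls: "typed t l u v \<Longrightarrow> cls t \<in> HOM l u v" by (auto simp: HOM_def)
lemma HOM_id: "idm w l \<in> HOM l w w" by (rule HOM_cls) simp
lemma HOM_gen: "l = gen_wt g \<Longrightarrow> u = gen_dom g \<Longrightarrow> v = gen_cod g \<Longrightarrow> cls (Gen g) \<in> HOM l u v"
  by (rule HOM_cls) simp
lemma HOM_zero: "wt u = wt v \<Longrightarrow> 0 \<in> HOM l u v"
  using HOM_cls[of Zero l u v] by (simp add: cls_Zero)
lemma HOM_add: "f \<in> HOM l u v \<Longrightarrow> g \<in> HOM l u v \<Longrightarrow> f + g \<in> HOM l u v"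
  by (elim HOM_E, hypsubst, subst cls_Add[symmetric], rule HOM_cls) simp
lemma HOM_scl: "f \<in> HOM l u v \<Longrightarrow> scl c f \<in> HOM l u v"
  by (elim HOM_E, hypsubst, subst cls_Scl[symmetric], rule HOM_cls) simp
lemma HOM_uminus: "f \<in> HOM l u v \<Longrightarrow> - f \<in> HOM l u v"
  unfolding uminus_eq_scl by (rule HOM_scl)
lemma HOM_diff: "f \<in> HOM l u v \<Longrightarrow> g \<in> HOM l u v \<Longrightarrow> f - g \<in> HOM l u v"
  unfolding minus_mor_def by (intro HOM_add HOM_uminus)
lemma HOM_vcomp: "f \<in> HOM l v w \<Longrightarrow> g \<in> HOM l u v \<Longrightarrow> f \<circ>\<^sub>v g \<in> HOM l u w"
  by (elim HOM_E, hypsubst, subst cls_VC[symmetric], rule HOM_cls) auto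
lemma HOM_hcomp:
  "f \<in> HOM m u1 v1 \<Longrightarrow> g \<in> HOM l u2 v2 \<Longrightarrow> m = l + wt u2 \<Longrightarrow> u = u1 @ u2 \<Longrightarrow> v = v1 @ v2
    \<Longrightarrow> f \<circ>\<^sub>h g \<in> HOM l u v"
  by (elim HOM_E, hypsubst, subst cls_HC[symmetric], rule HOM_cls) auto

lemma vcomp_idl: "f \<in> HOM l u v \<Longrightarrow> idm v l \<circ>\<^sub>v f = f"
  by (elim HOM_E, hypsubst, subst cls_VC[symmetric]) (auto simp: mor.abs_eq_iff intro: eqv.VC_idl)
lemma vcomp_idr: "f \<in> HOM l u v \<Longrightarrow> f \<circ>\<^sub>v idm u l = f"
  by (elim HOM_E, hypsubst, subst cls_VC[symmetric]) (auto simp: mor.abs_eq_iff intro: eqv.VC_idr)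
lemma hcomp_idl: "f \<in> HOM l u v \<Longrightarrow> m = l + wt u \<Longrightarrow> idm [] m \<circ>\<^sub>h f = f"
  by (elim HOM_E, hypsubst, subst cls_HC[symmetric]) (auto simp: mor.abs_eq_iff intro: eqv.HC_idl)
lemma hcomp_idr: "f \<in> HOM l u v \<Longrightarrow> f \<circ>\<^sub>h idm [] l = f"
  by (elim HOM_E, hypsubst, subst cls_HC[symmetric]) (auto simp: mor.abs_eq_iff intro: eqv.HC_idr)
lemma hcomp_id: "m = l + wt v \<Longrightarrow> idm u m \<circ>\<^sub>h idm v l = idm (u @ v) l"
  by (subst cls_HC[symmetric]) (simp add: mor.abs_eq_iff eqv.HC_id)
lemma interchange:
  assumes "f \<in> HOM m u1 v1" "f' \<in> HOM m v1 w1" "g \<in> HOM l u2 v2" "g' \<in> HOM l v2 w2" "m = l + wt u2"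
  shows "(f' \<circ>\<^sub>v f) \<circ>\<^sub>h (g' \<circ>\<^sub>v g) = (f' \<circ>\<^sub>h g') \<circ>\<^sub>v (f \<circ>\<^sub>h g)"
  using assms
  by (elim HOM_E, hypsubst, unfold cls_VC[symmetric] cls_HC[symmetric])
     (auto simp: mor.abs_eq_iff intro!: eqv.interchange)

lemma whisker_left:
  assumes "f \<in> HOM l v w" "g \<in> HOM l u v" "m = l + wt u"
  shows "idm x m \<circ>\<^sub>h (f \<circ>\<^sub>v g) = (idm x m \<circ>\<^sub>h f) \<circ>\<^sub>v (idm x m \<circ>\<^sub>h g)"
  using interchange[OF HOM_id HOM_id assms(2,1,3), of x] by (simp add: vcomp_idl[OF HOM_id])

lemma whisker_right:
  assumes "f \<in> HOM m v w" "g \<in> HOM m u v" "m = l + wt x"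
  shows "(f \<circ>\<^sub>v g) \<circ>\<^sub>h idm x l = (f \<circ>\<^sub>h idm x l) \<circ>\<^sub>v (g \<circ>\<^sub>h idm x l)"
  using interchange[OF assms(2,1) HOM_id HOM_id assms(3)] by (simp add: vcomp_idl[OF HOM_id])

lemma slide_left:
  assumes "f \<in> HOM m u1 v1" "g \<in> HOM l u2 v2" "m = l + wt u2"
  shows "(f \<circ>\<^sub>h idm v2 l) \<circ>\<^sub>v (idm u1 m \<circ>\<^sub>h g) = f \<circ>\<^sub>h g"
  using interchange[OF HOM_id assms(1,2) HOM_id assms(3)]
  by (simp add: vcomp_idl[OF assms(2)] vcomp_idr[OF assms(1)])

lemma slide_right:
  assumes "f \<in> HOM m u1 v1" "g \<in> HOM l u2 v2" "m = l + wt u2"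
  shows "(idm v1 m \<circ>\<^sub>h g) \<circ>\<^sub>v (f \<circ>\<^sub>h idm u2 l) = f \<circ>\<^sub>h g"
  using interchange[OF assms(1) HOM_id HOM_id assms(2,3)]
  by (simp add: vcomp_idl[OF assms(1)] vcomp_idr[OF assms(2)])

lemma endo_one_commute:
  assumes "f \<in> HOM l [] []" "g \<in> HOM l [] []"
  shows "f \<circ>\<^sub>v g = g \<circ>\<^sub>v f"
proof -
  have m: "l = l + wt []" by (simp add: wt_def)
  have "f \<circ>\<^sub>v g = f \<circ>\<^sub>h g"
    using slide_left[OF assms m] by (simp add: hcomp_idr[OF assms(1)] hcomp_idl[OF assms(2) m])
  also have "\<dots> = g \<circ>\<^sub>v f"
    using slide_right[OF assms m] by (simp add: hcomp_idr[OF assms(1)] hcomp_idl[OF assms(2) m])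
  finally show ?thesis .
qed

lemma HOM_gens:
  "cls (xi l) \<in> HOM l [\<E>] [\<E>]" "cls (xi' l) \<in> HOM l [\<F>] [\<F>]"
  "cls (tau l) \<in> HOM l [\<E>, \<E>] [\<E>, \<E>]" "cls (tau' l) \<in> HOM l [\<F>, \<F>] [\<F>, \<F>]"
  "cls (eta l) \<in> HOM l [] [\<F>, \<E>]" "cls (eps l) \<in> HOM l [\<F>, \<E>] []"
  "cls (eta' l) \<in> HOM l [] [\<E>, \<F>]" "cls (eps' l) \<in> HOM l [\<E>, \<F>] []"
  by (auto intro: HOM_gen)

lemma wt_simps [simp]: "wt [] = 0" "wt (\<E> # w) = 2 + wt w" "wt (\<F> # w) = - 2 + wt w"
  by (simp_all add: wt_def)

definition xp :: "nat \<Rightarrow> int \<Rightarrow> 'k::field mor" where "xp n l = cls (xipow (int n) l)"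
definition xF :: "nat \<Rightarrow> int \<Rightarrow> 'k::field mor" where "xF n l = cls (xipow_F (int n) l)"

lemma xp_0: "xp 0 l = idm [\<E>] l" by (simp add: xp_def xipow_def)
lemma xp_Suc: "xp (Suc n) l = cls (xi l) \<circ>\<^sub>v xp n l"
  unfolding xp_def xipow_def nat_int by (simp add: cls_VC)
lemma HOM_xp: "xp n l \<in> HOM l [\<E>] [\<E>]"
  by (induction n) (auto simp: xp_0 xp_Suc intro: HOM_id HOM_vcomp HOM_gens)
lemma xF_eq: "xF n l = xp n (l - 2) \<circ>\<^sub>h idm [\<F>] l"
  by (simp add: xF_def xp_def xipow_F_def cls_HC)
lemma HOM_xF: "xF n l \<in> HOM l [\<E>, \<F>] [\<E>, \<F>]"
  unfolding xF_eq by (rule HOM_hcomp[OF HOM_xp HOM_id]) auto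
lemmas HOM_intros = HOM_gens HOM_id HOM_xp HOM_xF HOM_vcomp HOM_hcomp HOM_add HOM_scl HOM_uminus HOM_diff
lemma xF_0: "xF 0 l = idm [\<E>, \<F>] l"
  by (simp add: xF_eq xp_0 hcomp_id)
lemma xF_Suc: "xF (Suc n) l = (cls (xi (l - 2)) \<circ>\<^sub>h idm [\<F>] l) \<circ>\<^sub>v xF n l"
  unfolding xF_eq xp_Suc by (rule whisker_right[OF HOM_gens(1) HOM_xp]) simp
lemma xF_add: "xF m l \<circ>\<^sub>v xF n l = xF (m + n) l"
  by (induction m) (simp_all add: xF_0 xF_Suc vcomp_assoc vcomp_idl[OF HOM_xF])
lemma xF_Suc2: "xF (Suc n) l = (xF n l :: 'a::field mor) \<circ>\<^sub>v (cls (xi (l - 2)) \<circ>\<^sub>h idm [\<F>] l)"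
proof -
  have "cls (xi (l - 2)) \<circ>\<^sub>h idm [\<F>] l = (xF 1 l :: 'a mor)"
    by (subst One_nat_def, subst xF_Suc, subst xF_0, rule vcomp_idr[symmetric])
      (rule HOM_intros | simp)+
  then show ?thesis by (simp add: xF_add)
qed

abbreviation bpl :: "int \<Rightarrow> int \<Rightarrow> 'k::field mor" where "bpl k l \<equiv> cls (bubble_plus k l)"
abbreviation bmi :: "int \<Rightarrow> int \<Rightarrow> 'k::field mor" where "bmi k l \<equiv> cls (bubble_minus k l)"

lemma typed_Sums: "typed (Sums ts) l u v \<longleftrightarrow> (\<forall>t\<in>set ts. typed t l u v) \<and> wt u = wt v"
  by (induction ts) (auto simp: Sums_def intro: typed_wt)

lemma typed_xipow: "typed (xipow n l) l [\<E>] [\<E>]"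
proof -
  have "typed (((\<lambda>t. xi l \<bullet> t) ^^ m) (Id [\<E>] l)) l [\<E>] [\<E>]" for m
    by (induction m) auto
  then show ?thesis by (simp add: xipow_def)
qed
lemma typed_xipow_F: "typed (xipow_F n l) l [\<E>, \<F>] [\<E>, \<F>]"
  unfolding xipow_F_def using typed_xipow[of n "l - 2"]
  by (auto intro!: exI[of _ "[\<E>]"])
lemma typed_F_xipow: "typed (F_xipow n l) l [\<F>, \<E>] [\<F>, \<E>]"
  unfolding F_xipow_def using typed_xipow[of n "l"]
  by (auto intro!: exI[of _ "[\<F>]"] simp: add.commute)

lemma typed_real_bubble_plus: "typed (real_bubble_plus k l) l [] []"
  unfolding real_bubble_plus_def by (auto intro!: typed_xipow_F)
lemma typed_real_bubble_minus: "typed (real_bubble_minus k l) l [] []"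
  unfolding real_bubble_minus_def by (auto intro!: typed_F_xipow)
lemma typed_fake_bubble_plus: "typed (fake_bubble_plus k l) l [] []"
  by (induction k l rule: fake_bubble_plus.induct, subst fake_bubble_plus.simps)
    (fastforce simp: neg_def typed_Sums intro: typed_real_bubble_minus)
lemma typed_fake_bubble_minus: "typed (fake_bubble_minus k l) l [] []"
  by (induction k l rule: fake_bubble_minus.induct, subst fake_bubble_minus.simps)
    (fastforce simp: neg_def typed_Sums intro: typed_real_bubble_plus)
lemma typed_bubble_plus: "typed (bubble_plus k l) l [] []"
  by (simp add: bubble_plus_def typed_real_bubble_plus typed_fake_bubble_plus)
lemma typed_bubble_minus: "typed (bubble_minus k l) l [] []"
  by (simp add: bubble_minus_def typed_real_bubble_minus typed_fake_bubble_minus)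
lemmas HOM_bubble = typed_bubble_plus[THEN HOM_cls] typed_bubble_minus[THEN HOM_cls]

lemma xF_eps_eta:
  "cls (eps' l) \<circ>\<^sub>v xF n l \<circ>\<^sub>v cls (eta' l) = bpl (int n + 1 - l) l"
  by (simp add: bubble_plus_def real_bubble_plus_def cls_simps xF_def)

lemma bubble_neg: "k < 0 \<Longrightarrow> bpl k l = 0" "k < 0 \<Longrightarrow> bmi k l = 0"
  using cls_rel[OF rel.bubble_plus_neg] cls_rel[OF rel.bubble_minus_neg] by (auto simp: cls_Zero)
lemma bubble_0: "bpl 0 l = idm [] l" "bmi 0 l = idm [] l"
  using cls_rel[OF rel.bubble_plus_0] cls_rel[OF rel.bubble_minus_0] by auto

lemma sum_list_map_concat:
  fixes f :: "'b \<Rightarrow> 'a::comm_monoid_add"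
  shows "(\<Sum>x\<leftarrow>concat xss. f x) = (\<Sum>xs\<leftarrow>xss. \<Sum>x\<leftarrow>xs. f x)"
  by (induction xss) simp_all

lemma sum_list_pairs:
  fixes f :: "int \<Rightarrow> int \<Rightarrow> 'a::comm_monoid_add"
  shows "(\<Sum>(a, b)\<leftarrow>pairs m. f a b) = (\<Sum>a\<in>{0..m}. f a (m - a))"
proof -
  have *: "(\<Sum>b\<leftarrow>[0..m]. \<Sum>x\<leftarrow>(if a + b = m then [(a, b)] else []). f (fst x) (snd x)) = f a (m - a)"
    if "a \<in> {0..m}" for a
  proof -
    have "(\<Sum>b\<leftarrow>[0..m]. \<Sum>x\<leftarrow>(if a + b = m then [(a, b)] else []). f (fst x) (snd x))
        = (\<Sum>b\<leftarrow>[0..m]. if b = m - a then f a b else 0)"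
      by (rule arg_cong[of _ _ sum_list]) (auto simp: algebra_simps)
    also have "\<dots> = (\<Sum>b\<in>{0..m}. if b = m - a then f a b else 0)"
      by (simp add: sum_list_distinct_conv_sum_set)
    also have "\<dots> = f a (m - a)" using that by (simp add: sum.delta)
    finally show ?thesis .
  qed
  have "(\<Sum>(a, b)\<leftarrow>pairs m. f a b) = (\<Sum>a\<leftarrow>[0..m]. \<Sum>b\<leftarrow>[0..m].
       \<Sum>x\<leftarrow>(if a + b = m then [(a, b)] else []). f (fst x) (snd x))"
    by (simp add: pairs_def sum_list_map_concat o_def case_prod_beta if_distrib cong: if_cong)
  also have "\<dots> = (\<Sum>a\<in>{0..m}. \<Sum>b\<leftarrow>[0..m].
       \<Sum>x\<leftarrow>(if a + b = m then [(a, b)] else []). f (fst x) (snd x))"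
    by (simp add: sum_list_distinct_conv_sum_set)
  also have "\<dots> = (\<Sum>a\<in>{0..m}. f a (m - a))" by (rule sum.cong[OF HOL.refl *])
  finally show ?thesis .
qed

lemma sum_list_triples:
  fixes f :: "int \<Rightarrow> int \<Rightarrow> int \<Rightarrow> 'a::comm_monoid_add"
  shows "(\<Sum>(a, b, c)\<leftarrow>triples m. f a b c) = (\<Sum>c\<in>{0..m}. \<Sum>a\<in>{0..m - c}. f a (m - c - a) c)"
proof -
  have *: "(\<Sum>c\<leftarrow>[0..m]. \<Sum>x\<leftarrow>(if a + b + c = m then [(a, b, c)] else []). case x of (a, b, c) \<Rightarrow> f a b c)
         = (\<Sum>c\<in>{0..m}. if a + b + c = m then f a b c else 0)" for a b
    by (subst sum_list_distinct_conv_sum_set) (auto intro!: sum.cong)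
  have "(\<Sum>(a, b, c)\<leftarrow>triples m. f a b c) = (\<Sum>a\<leftarrow>[0..m]. \<Sum>b\<leftarrow>[0..m]. \<Sum>c\<leftarrow>[0..m].
       \<Sum>x\<leftarrow>(if a + b + c = m then [(a, b, c)] else []). case x of (a, b, c) \<Rightarrow> f a b c)"
    by (simp add: triples_def sum_list_map_concat o_def if_distrib cong: if_cong)
  also have "\<dots> = (\<Sum>a\<in>{0..m}. \<Sum>b\<in>{0..m}. \<Sum>c\<in>{0..m}. if a + b + c = m then f a b c else 0)"
    unfolding * by (simp add: sum_list_distinct_conv_sum_set)
  also have "\<dots> = (\<Sum>c\<in>{0..m}. \<Sum>a\<in>{0..m}. \<Sum>b\<in>{0..m}. if a + b + c = m then f a b c else 0)"
    by (subst sum.swap, subst (2) sum.swap, subst sum.swap) (subst (2) sum.swap, simp)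
  also have "\<dots> = (\<Sum>c\<in>{0..m}. \<Sum>a\<in>{0..m - c}. f a (m - c - a) c)"
  proof (rule sum.cong[OF HOL.refl])
    fix c assume c: "c \<in> {0..m}"
    have "(\<Sum>b\<in>{0..m}. if a + b + c = m then f a b c else 0) = (if a \<in> {0..m - c} then f a (m - c - a) c else 0)"
      if "a \<in> {0..m}" for a
    proof -
      have "(\<Sum>b\<in>{0..m}. if a + b + c = m then f a b c else 0) = (\<Sum>b\<in>{0..m}. if b = m - c - a then f a b c else 0)"
        by (rule sum.cong) auto
      then show ?thesis using that c by (auto simp: sum.delta)
    qed
    then have "(\<Sum>a\<in>{0..m}. \<Sum>b\<in>{0..m}. if a + b + c = m then f a b c else 0)
        = (\<Sum>a\<in>{0..m}. if a \<in> {0..m - c} then f a (m - c - a) c else 0)" by simp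
    also have "\<dots> = (\<Sum>a\<in>{0..m - c}. f a (m - c - a) c)"
      using c by (intro sum.mono_neutral_cong_right) auto
    finally show "(\<Sum>a\<in>{0..m}. \<Sum>b\<in>{0..m}. if a + b + c = m then f a b c else 0)
        = (\<Sum>a\<in>{0..m - c}. f a (m - c - a) c)" .
  qed
  finally show ?thesis .
qed

lemma bubble_sum:
  "(\<Sum>a\<in>{0..m}. bpl a l \<circ>\<^sub>v bmi (m - a) l) = (if m = 0 then idm [] l else 0)"
proof -
  have "(\<Sum>a\<in>{0..m}. bpl a l \<circ>\<^sub>v bmi (m - a) l)
      = cls (Sums (map (\<lambda>(a, b). bubble_plus a l \<bullet> bubble_minus b l) (pairs m)))"
    unfolding cls_Sums map_map o_def
    by (subst sum_list_pairs[symmetric]) (simp add: cls_simps case_prod_unfold)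
  also have "\<dots> = (if m = 0 then idm [] l else 0)"
    by (subst cls_rel[OF rel.bubble_sum]) (simp add: cls_Zero)
  finally show ?thesis .
qed

section \<open>The maps in the decomposition of EF1\<close>

lemma sum_int_atLeastAtMost_0: "(\<Sum>a\<in>{0..m}. f a) = (\<Sum>a<nat (m + 1). f (int a))"
proof -
  have "{0..m} = int ` {..<nat (m + 1)}" by (auto simp: image_iff intro!: bexI[of _ "nat _"])
  then show ?thesis by (simp add: sum.reindex)
qed

definition uu :: "int \<Rightarrow> nat \<Rightarrow> 'k::field mor" where
  "uu l c = xF c l \<circ>\<^sub>v cls (eta' l)"
definition vv :: "int \<Rightarrow> nat \<Rightarrow> 'k::field mor" where
  "vv l c = (\<Sum>a<nat l - c. bmi (l - 1 - int c - int a) l \<circ>\<^sub>v cls (eps' l) \<circ>\<^sub>v xF a l)"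
abbreviation sg :: "int \<Rightarrow> 'k::field mor" where "sg l \<equiv> cls (sigma l)"
abbreviation sg' :: "int \<Rightarrow> 'k::field mor" where "sg' l \<equiv> cls (sigma' l)"

lemma cls_EF_u: "cls (xipow_F (int c) l \<bullet> eta' l) = uu l c"
  by (simp add: uu_def xF_def cls_VC)

lemma cls_EF_v:
  "cls (Sums (map (\<lambda>(a, b). bubble_minus b l \<bullet> eps' l \<bullet> xipow_F a l) (pairs (l - 1 - int c)))) = (vv l c :: 'k::field mor)"
proof -
  have "nat (l - int c) = nat l - c" by auto
  then have "(vv l c :: 'k mor) = (\<Sum>a\<in>{0..l - 1 - int c}. cls (bubble_minus (l - 1 - int c - a) l \<bullet> eps' l \<bullet> xipow_F a l))"
    by (simp add: sum_int_atLeastAtMost_0 vv_def xF_def cls_VC)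
  also have "\<dots> = (\<Sum>(a, b)\<leftarrow>pairs (l - 1 - int c). cls (bubble_minus b l \<bullet> eps' l \<bullet> xipow_F a l))"
    by (rule sum_list_pairs[symmetric])
  finally show ?thesis
    unfolding cls_Sums map_map o_def by (simp add: case_prod_unfold)
qed

lemma HOM_sum: "(\<And>i. i \<in> I \<Longrightarrow> f i \<in> HOM l u v) \<Longrightarrow> wt u = wt v \<Longrightarrow> sum f I \<in> HOM l u v"
  by (induction I rule: infinite_finite_induct) (auto intro: HOM_zero HOM_add)

lemma HOM_uu: "uu l c \<in> HOM l [] [\<E>, \<F>]"
  unfolding uu_def by (rule HOM_intros)+
lemma HOM_vv: "vv l c \<in> HOM l [\<E>, \<F>] []"
  unfolding vv_def by (rule HOM_sum HOM_intros HOM_bubble)+ simp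
lemma cls_sigma: "sg l = (idm [\<F>, \<E>] l \<circ>\<^sub>h cls (eps' l))
   \<circ>\<^sub>v (idm [\<F>] (l + 2) \<circ>\<^sub>h cls (tau (l - 2)) \<circ>\<^sub>h idm [\<F>] l) \<circ>\<^sub>v (cls (eta l) \<circ>\<^sub>h idm [\<E>, \<F>] l)"
  by (simp add: sigma_def cls_simps)
lemma HOM_sigma: "sg l \<in> HOM l [\<E>, \<F>] [\<F>, \<E>]"
  unfolding cls_sigma by (rule HOM_intros | simp)+

lemma vcomp_sum_left: "sum f I \<circ>\<^sub>v g = (\<Sum>i\<in>I. f i \<circ>\<^sub>v g)" by (rule vcomp_left.sum)
lemma vcomp_sum_right: "g \<circ>\<^sub>v sum f I = (\<Sum>i\<in>I. g \<circ>\<^sub>v f i)" by (rule vcomp_right.sum)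

lemma vv_uu:
  assumes "int c < l" "int c' < l"
  shows "vv l c \<circ>\<^sub>v uu l c' = (if c = c' then idm [] l else 0 :: 'k::field mor)"
proof -
  define k where "k = nat l - 1 - c"
  define m where "m = int c' - int c"
  have l: "l = int k + 1 + int c" using assms by (auto simp: k_def)
  have "vv l c \<circ>\<^sub>v (uu l c' :: 'k mor) = (\<Sum>a<Suc k. bmi (int k - int a) l \<circ>\<^sub>v bpl (m - (int k - int a)) l)"
  proof -
    have "nat l - c = Suc k" using l by auto
    moreover have "cls (eps' l) \<circ>\<^sub>v xF a l \<circ>\<^sub>v xF c' l \<circ>\<^sub>v cls (eta' l) = (bpl (m - (int k - int a)) l :: 'k mor)" for a
    proof -
      have "xF a l \<circ>\<^sub>v xF c' l \<circ>\<^sub>v cls (eta' l) = (xF (a + c') l \<circ>\<^sub>v cls (eta' l) :: 'k mor)"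
        by (simp add: xF_add flip: vcomp_assoc)
      then show ?thesis by (simp add: xF_eps_eta l m_def algebra_simps)
    qed
    ultimately show ?thesis by (simp add: vv_def uu_def vcomp_sum_left vcomp_assoc l del: sum.lessThan_Suc)
  qed
  also have "\<dots> = (\<Sum>b<Suc k. bmi (int b) l \<circ>\<^sub>v bpl (m - int b) l)"
    by (subst sum.nat_diff_reindex[symmetric]) (simp add: of_nat_diff)
  also have "\<dots> = (\<Sum>b<nat (m + 1). bmi (int b) l \<circ>\<^sub>v bpl (m - int b) l)"
    using assms(2) by (intro sum.mono_neutral_right) (auto simp: bubble_neg m_def l)
  also have "\<dots> = (\<Sum>b<nat (m + 1). bpl (int b) l \<circ>\<^sub>v bmi (m - int b) l)"
  proof (subst sum.nat_diff_reindex[symmetric], rule sum.cong[OF HOL.refl])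
    fix b assume b: "b \<in> {..<nat (m + 1)}"
    then have "int (nat (m + 1) - Suc b) = m - int b" by auto
    then show "bmi (int (nat (m + 1) - Suc b)) l \<circ>\<^sub>v bpl (m - int (nat (m + 1) - Suc b)) l
        = bpl (int b) l \<circ>\<^sub>v bmi (m - int b) l"
      by (simp add: endo_one_commute[OF HOM_bubble(2,1)])
  qed
  also have "\<dots> = (if m = 0 then idm [] l else 0)"
    unfolding sum_int_atLeastAtMost_0[of "\<lambda>b. bpl b l \<circ>\<^sub>v bmi (m - b) l", symmetric] by (rule bubble_sum)
  also have "(m = 0) = (c = c')" by (auto simp: m_def)
  finally show ?thesis .
qed

lemma decomposition:
  "idm [\<E>, \<F>] l = - (sg' l \<circ>\<^sub>v sg l) + (\<Sum>c<nat l. uu l c \<circ>\<^sub>v vv l c)"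
proof -
  let ?f = "\<lambda>a b c. cls (xipow_F c l \<bullet> eta' l \<bullet> bubble_minus b l \<bullet> eps' l \<bullet> xipow_F a l)"
  have "idm [\<E>, \<F>] l = - (sg' l \<circ>\<^sub>v sg l) + (\<Sum>(a, b, c)\<leftarrow>triples (l - 1). ?f a b c)"
    by (subst cls_rel[OF rel.dec_EF])
      (simp add: cls_Add cls_neg cls_Sums cls_VC[of "sigma' l"] o_def case_prod_unfold)
  also have "(\<Sum>(a, b, c)\<leftarrow>triples (l - 1). ?f a b c) = (\<Sum>c<nat l. uu l c \<circ>\<^sub>v vv l c)"
  proof -
    have "nat (l - int c) = nat l - c" for c by auto
    then show ?thesis
      by (simp add: sum_list_triples sum_int_atLeastAtMost_0 uu_def vv_def vcomp_sum_right
          cls_VC xF_def vcomp_assoc algebra_simps)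
  qed
  finally show ?thesis .
qed

lemma sg_sg': assumes "l > 0" shows "sg l \<circ>\<^sub>v sg' l = - (idm [\<F>, \<E>] l :: 'k::field mor)"
proof -
  have "triples (- l - 1) = []" using assms by (simp add: triples_def)
  then have "(idm [\<F>, \<E>] l :: 'k mor) = - (sg l \<circ>\<^sub>v sg' l)"
    by (subst cls_rel[OF rel.dec_FE]) (simp add: cls_simps)
  then show ?thesis by simp
qed

lemma tau_dots:
  "(cls (xi (l + 2)) \<circ>\<^sub>h idm [\<E>] l) \<circ>\<^sub>v cls (tau l) - cls (tau l) \<circ>\<^sub>v (idm [\<E>] (l + 2) \<circ>\<^sub>h cls (xi l)) = idm [\<E>, \<E>] l"
  "cls (tau l) \<circ>\<^sub>v (cls (xi (l + 2)) \<circ>\<^sub>h idm [\<E>] l) - (idm [\<E>] (l + 2) \<circ>\<^sub>h cls (xi l)) \<circ>\<^sub>v cls (tau l) = idm [\<E>, \<E>] l"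
  using cls_rel[OF rel.dot1[of l]] cls_rel[OF rel.dot2[of l]]
  by (simp_all add: cls_simps)

lemmas norm_id = hcomp_id hcomp_assoc

lemma tau_slide1:
  "cls (tau (l - 2)) \<circ>\<^sub>v (idm [\<E>] l \<circ>\<^sub>h cls (xi (l - 2)))
     = (cls (xi l) \<circ>\<^sub>h idm [\<E>] (l - 2)) \<circ>\<^sub>v cls (tau (l - 2)) - idm [\<E>, \<E>] (l - 2)"
  using tau_dots(1)[of "l - 2", symmetric] by (simp add: algebra_simps)
lemma tau_slide2:
  "(idm [\<E>] l \<circ>\<^sub>h cls (xi (l - 2))) \<circ>\<^sub>v cls (tau (l - 2))
     = cls (tau (l - 2)) \<circ>\<^sub>v (cls (xi l) \<circ>\<^sub>h idm [\<E>] (l - 2)) - idm [\<E>, \<E>] (l - 2)"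
  using tau_dots(2)[of "l - 2", symmetric] by (simp add: algebra_simps)

definition curl_bot :: "int \<Rightarrow> nat \<Rightarrow> 'k::field mor" where
  "curl_bot l c = (idm [\<E>] l \<circ>\<^sub>h cls (eps' l)) \<circ>\<^sub>v (cls (tau (l - 2)) \<circ>\<^sub>h idm [\<F>] l) \<circ>\<^sub>v (idm [\<E>] l \<circ>\<^sub>h uu l c)"

definition curl_top :: "int \<Rightarrow> nat \<Rightarrow> 'k::field mor" where
  "curl_top l a = (idm [\<E>] l \<circ>\<^sub>h (cls (eps' l) \<circ>\<^sub>v xF a l)) \<circ>\<^sub>v (cls (tau (l - 2)) \<circ>\<^sub>h idm [\<F>] l)
     \<circ>\<^sub>v (idm [\<E>] l \<circ>\<^sub>h cls (eta' l))"

lemma curl_0: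
  assumes "l > 0"
  shows "(idm [\<E>] l \<circ>\<^sub>h cls (eps' l)) \<circ>\<^sub>v (cls (tau (l - 2)) \<circ>\<^sub>h idm [\<F>] l) \<circ>\<^sub>v (idm [\<E>] l \<circ>\<^sub>h cls (eta' l)) = 0"
  using cls_rel[OF rel.curl1[of l]] assms by (simp add: cls_simps pairs_def)

lemma curl_bot_0: "l > 0 \<Longrightarrow> curl_bot l 0 = 0"
  unfolding curl_bot_def uu_def xF_0
  by (subst vcomp_idl[OF HOM_gens(7)]) (rule curl_0)
lemma curl_top_0: "l > 0 \<Longrightarrow> curl_top l 0 = 0"
  unfolding curl_top_def xF_0
  by (subst vcomp_idr[OF HOM_gens(8)]) (rule curl_0)

lemma curl_bot_Suc:
  "curl_bot l (Suc c) = cls (xi l) \<circ>\<^sub>v curl_bot l c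
      - idm [\<E>] l \<circ>\<^sub>h (bpl (int c + 1 - l) l :: 'k::field mor)"
proof -
  let ?e = "idm [\<E>] l \<circ>\<^sub>h cls (eps' l) :: 'k mor"
  let ?t = "cls (tau (l - 2)) :: 'k mor"
  let ?x = "cls (xi l) \<circ>\<^sub>h idm [\<E>] (l - 2) :: 'k mor" and ?y = "idm [\<E>] l \<circ>\<^sub>h cls (xi (l - 2)) :: 'k mor"
  let ?F = "idm [\<F>] l :: 'k mor"
  let ?U = "idm [\<E>] l \<circ>\<^sub>h uu l c :: 'k mor"
  have 1: "idm [\<E>] l \<circ>\<^sub>h uu l (Suc c) = (?y \<circ>\<^sub>h ?F) \<circ>\<^sub>v ?U"
    unfolding uu_def xF_Suc vcomp_assoc hcomp_assoc
    by (rule whisker_left) (rule HOM_intros | simp)+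
  have 2: "(?t \<circ>\<^sub>h ?F) \<circ>\<^sub>v (?y \<circ>\<^sub>h ?F)
     = (?x \<circ>\<^sub>h ?F) \<circ>\<^sub>v (?t \<circ>\<^sub>h ?F) - idm [\<E>, \<E>, \<F>] l"
  proof -
    have "(?t \<circ>\<^sub>h ?F) \<circ>\<^sub>v (?y \<circ>\<^sub>h ?F)
        = (?t \<circ>\<^sub>v ?y) \<circ>\<^sub>h ?F"
      by (rule whisker_right[symmetric]) (rule HOM_intros | simp)+
    also have "\<dots> = (?x \<circ>\<^sub>v ?t) \<circ>\<^sub>h ?F - idm [\<E>, \<E>] (l - 2) \<circ>\<^sub>h ?F"
      unfolding tau_slide1 comp_diff ..
    also have "(?x \<circ>\<^sub>v ?t) \<circ>\<^sub>h ?F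
        = (?x \<circ>\<^sub>h ?F) \<circ>\<^sub>v (?t \<circ>\<^sub>h ?F)"
      by (rule whisker_right) (rule HOM_intros | simp)+
    finally show ?thesis by (simp add: hcomp_id)
  qed
  have 3: "?e \<circ>\<^sub>v (?x \<circ>\<^sub>h ?F) = cls (xi l) \<circ>\<^sub>v ?e"
  proof -
    have "?e \<circ>\<^sub>v (?x \<circ>\<^sub>h ?F) = cls (xi l) \<circ>\<^sub>h cls (eps' l)"
      by (simp add: norm_id slide_right[OF HOM_gens(1) HOM_gens(8)])
    also have "\<dots> = cls (xi l) \<circ>\<^sub>v ?e"
      using slide_left[OF HOM_gens(1) HOM_gens(8), of l l, symmetric] by (simp add: hcomp_idr[OF HOM_gens(1)])
    finally show ?thesis .
  qed
  have 4: "?e \<circ>\<^sub>v ?U = idm [\<E>] l \<circ>\<^sub>h bpl (int c + 1 - l) l"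
    unfolding xF_eps_eta[symmetric] uu_def[symmetric]
    by (rule whisker_left[symmetric]) (rule HOM_intros HOM_uu | simp)+
  have 5: "idm [\<E>, \<E>, \<F>] l \<circ>\<^sub>v ?U = ?U"
    by (rule vcomp_idl) (rule HOM_intros HOM_uu | simp)+
  have "curl_bot l (Suc c) = ?e \<circ>\<^sub>v ((?t \<circ>\<^sub>h ?F) \<circ>\<^sub>v (?y \<circ>\<^sub>h ?F)) \<circ>\<^sub>v ?U"
    unfolding curl_bot_def 1 by (simp only: vcomp_assoc)
  also have "\<dots> = (?e \<circ>\<^sub>v (?x \<circ>\<^sub>h ?F)) \<circ>\<^sub>v (?t \<circ>\<^sub>h ?F) \<circ>\<^sub>v ?U - ?e \<circ>\<^sub>v ?U"
    unfolding 2 by (simp only: comp_diff vcomp_assoc 5)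
  finally show ?thesis unfolding 3 4 curl_bot_def by (simp only: vcomp_assoc)
qed

lemma curl_top_Suc:
  "curl_top l (Suc c) = curl_top l c \<circ>\<^sub>v cls (xi l)
      - idm [\<E>] l \<circ>\<^sub>h (bpl (int c + 1 - l) l :: 'k::field mor)"
proof -
  let ?h = "idm [\<E>] l \<circ>\<^sub>h cls (eta' l) :: 'k mor"
  let ?t = "cls (tau (l - 2)) :: 'k mor"
  let ?x = "cls (xi l) \<circ>\<^sub>h idm [\<E>] (l - 2) :: 'k mor" and ?y = "idm [\<E>] l \<circ>\<^sub>h cls (xi (l - 2)) :: 'k mor"
  let ?F = "idm [\<F>] l :: 'k mor"
  let ?V = "idm [\<E>] l \<circ>\<^sub>h (cls (eps' l) \<circ>\<^sub>v xF c l) :: 'k mor"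
  have 1: "idm [\<E>] l \<circ>\<^sub>h (cls (eps' l) \<circ>\<^sub>v xF (Suc c) l) = ?V \<circ>\<^sub>v (?y \<circ>\<^sub>h ?F)"
    unfolding xF_Suc2 vcomp_assoc[symmetric] hcomp_assoc
    by (rule whisker_left) (rule HOM_intros | simp)+
  have 2: "(?y \<circ>\<^sub>h ?F) \<circ>\<^sub>v (?t \<circ>\<^sub>h ?F)
     = (?t \<circ>\<^sub>h ?F) \<circ>\<^sub>v (?x \<circ>\<^sub>h ?F) - idm [\<E>, \<E>, \<F>] l"
  proof -
    have "(?y \<circ>\<^sub>h ?F) \<circ>\<^sub>v (?t \<circ>\<^sub>h ?F)
        = (?y \<circ>\<^sub>v ?t) \<circ>\<^sub>h ?F"
      by (rule whisker_right[symmetric]) (rule HOM_intros | simp)+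
    also have "\<dots> = (?t \<circ>\<^sub>v ?x) \<circ>\<^sub>h ?F - idm [\<E>, \<E>] (l - 2) \<circ>\<^sub>h ?F"
      unfolding tau_slide2 comp_diff ..
    also have "(?t \<circ>\<^sub>v ?x) \<circ>\<^sub>h ?F
        = (?t \<circ>\<^sub>h ?F) \<circ>\<^sub>v (?x \<circ>\<^sub>h ?F)"
      by (rule whisker_right) (rule HOM_intros | simp)+
    finally show ?thesis by (simp add: hcomp_id)
  qed
  have 3: "(?x \<circ>\<^sub>h ?F) \<circ>\<^sub>v ?h = ?h \<circ>\<^sub>v cls (xi l)"
  proof -
    have "(?x \<circ>\<^sub>h ?F) \<circ>\<^sub>v ?h = cls (xi l) \<circ>\<^sub>h cls (eta' l)"
      by (simp add: norm_id slide_left[OF HOM_gens(1) HOM_gens(7)])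
    also have "\<dots> = ?h \<circ>\<^sub>v cls (xi l)"
      using slide_right[OF HOM_gens(1) HOM_gens(7), of l l, symmetric] by (simp add: hcomp_idr[OF HOM_gens(1)])
    finally show ?thesis .
  qed
  have 4: "?V \<circ>\<^sub>v ?h = idm [\<E>] l \<circ>\<^sub>h bpl (int c + 1 - l) l"
    unfolding xF_eps_eta[symmetric] vcomp_assoc[symmetric]
    by (rule whisker_left[symmetric]) (rule HOM_intros | simp)+
  have 5: "idm [\<E>, \<E>, \<F>] l \<circ>\<^sub>v ?h = ?h"
    by (rule vcomp_idl) (rule HOM_intros | simp)+
  have "curl_top l (Suc c) = ?V \<circ>\<^sub>v ((?y \<circ>\<^sub>h ?F) \<circ>\<^sub>v (?t \<circ>\<^sub>h ?F)) \<circ>\<^sub>v ?h"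
    unfolding curl_top_def 1 by (simp only: vcomp_assoc)
  also have "\<dots> = ?V \<circ>\<^sub>v (?t \<circ>\<^sub>h ?F) \<circ>\<^sub>v ((?x \<circ>\<^sub>h ?F) \<circ>\<^sub>v ?h) - ?V \<circ>\<^sub>v ?h"
    unfolding 2 by (simp only: comp_diff vcomp_assoc 5)
  finally show ?thesis unfolding 3 4 curl_top_def by (simp only: vcomp_assoc)
qed

lemma curl_bot_zero: "int c < l \<Longrightarrow> curl_bot l c = 0"
  by (induction c) (simp_all add: curl_bot_0 curl_bot_Suc bubble_neg)
lemma curl_top_zero: "int c < l \<Longrightarrow> curl_top l c = 0"
  by (induction c) (simp_all add: curl_top_0 curl_top_Suc bubble_neg)

lemma sg_uu_eq: "sg l \<circ>\<^sub>v uu l c = (idm [\<F>] (l + 2) \<circ>\<^sub>h curl_bot l c) \<circ>\<^sub>v (cls (eta l) :: 'k::field mor)"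
proof -
  let ?F = "idm [\<F>] (l + 2) :: 'k mor"
  have 1: "(cls (eta l) \<circ>\<^sub>h idm [\<E>, \<F>] l) \<circ>\<^sub>v uu l c = (?F \<circ>\<^sub>h (idm [\<E>] l \<circ>\<^sub>h uu l c)) \<circ>\<^sub>v cls (eta l)"
  proof -
    have "(cls (eta l) \<circ>\<^sub>h idm [\<E>, \<F>] l) \<circ>\<^sub>v uu l c = (cls (eta l) \<circ>\<^sub>h uu l c :: 'k mor)"
      using slide_left[OF HOM_gens(5) HOM_uu, of l l c] by (simp add: hcomp_idl[OF HOM_uu])
    also have "\<dots> = (idm [\<F>, \<E>] l \<circ>\<^sub>h uu l c) \<circ>\<^sub>v cls (eta l)"
      by (subst slide_right[OF HOM_gens(5) HOM_uu, symmetric]) (simp_all add: hcomp_idr[OF HOM_gens(5)])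
    finally show ?thesis by (simp add: hcomp_id flip: hcomp_assoc)
  qed
  have 2: "idm [\<F>, \<E>] l \<circ>\<^sub>h cls (eps' l) = ?F \<circ>\<^sub>h (idm [\<E>] l \<circ>\<^sub>h cls (eps' l))"
    by (simp add: hcomp_id flip: hcomp_assoc)
  have "?F \<circ>\<^sub>h curl_bot l c = (?F \<circ>\<^sub>h (idm [\<E>] l \<circ>\<^sub>h cls (eps' l))) \<circ>\<^sub>v
     ?F \<circ>\<^sub>h ((cls (tau (l - 2)) \<circ>\<^sub>h idm [\<F>] l) \<circ>\<^sub>v (idm [\<E>] l \<circ>\<^sub>h uu l c))"
    unfolding curl_bot_def by (rule whisker_left) (rule HOM_intros HOM_uu | simp)+
  also have "?F \<circ>\<^sub>h ((cls (tau (l - 2)) \<circ>\<^sub>h idm [\<F>] l) \<circ>\<^sub>v (idm [\<E>] l \<circ>\<^sub>h uu l c))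
     = (?F \<circ>\<^sub>h (cls (tau (l - 2)) \<circ>\<^sub>h idm [\<F>] l)) \<circ>\<^sub>v (?F \<circ>\<^sub>h (idm [\<E>] l \<circ>\<^sub>h uu l c))"
    by (rule whisker_left) (rule HOM_intros HOM_uu | simp)+
  finally show ?thesis unfolding cls_sigma vcomp_assoc 1 2 by (simp only: vcomp_assoc)
qed

definition arc :: "int \<Rightarrow> 'k::field mor \<Rightarrow> 'k mor" where
  "arc l m = (cls (eps l) \<circ>\<^sub>h idm [\<E>, \<F>] l) \<circ>\<^sub>v (idm [\<F>] (l + 2) \<circ>\<^sub>h m \<circ>\<^sub>h idm [\<F>] l)
     \<circ>\<^sub>v (idm [\<F>, \<E>] l \<circ>\<^sub>h cls (eta' l))"

lemma sg'_arc: "sg' l = arc l (cls (tau (l - 2)))"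
  by (simp add: sigma'_def arc_def cls_simps)

lemma HOM_arc: "m \<in> HOM (l - 2) [\<E>, \<E>] [\<E>, \<E>] \<Longrightarrow> arc l m \<in> HOM l [\<F>, \<E>] [\<E>, \<F>]"
  unfolding arc_def by (assumption | rule HOM_intros | simp)+
lemma HOM_sigma': "sg' l \<in> HOM l [\<F>, \<E>] [\<E>, \<F>]"
  unfolding sg'_arc by (rule HOM_arc HOM_gens)+

lemma eps_sg'_eq:
  "(cls (eps' l) \<circ>\<^sub>v xF a l) \<circ>\<^sub>v sg' l = (cls (eps l) :: 'k::field mor) \<circ>\<^sub>v (idm [\<F>] (l + 2) \<circ>\<^sub>h curl_top l a)"
proof -
  let ?F = "idm [\<F>] (l + 2) :: 'k mor"
  let ?v = "cls (eps' l) \<circ>\<^sub>v xF a l :: 'k mor"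
  have v: "?v \<in> HOM l [\<E>, \<F>] []" by (rule HOM_intros)+
  have 1: "?v \<circ>\<^sub>v (cls (eps l) \<circ>\<^sub>h idm [\<E>, \<F>] l) = cls (eps l) \<circ>\<^sub>v (?F \<circ>\<^sub>h (idm [\<E>] l \<circ>\<^sub>h ?v))"
  proof -
    have "?v \<circ>\<^sub>v (cls (eps l) \<circ>\<^sub>h idm [\<E>, \<F>] l) = cls (eps l) \<circ>\<^sub>h ?v"
      using slide_right[OF HOM_gens(6) v, of l] by (simp add: hcomp_idl[OF v])
    also have "\<dots> = cls (eps l) \<circ>\<^sub>v (idm [\<F>, \<E>] l \<circ>\<^sub>h ?v)"
      using slide_left[OF HOM_gens(6) v, of l] by (simp add: hcomp_idr[OF HOM_gens(6)])
    finally show ?thesis by (simp add: hcomp_id flip: hcomp_assoc)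
  qed
  have 2: "idm [\<F>, \<E>] l \<circ>\<^sub>h cls (eta' l) = ?F \<circ>\<^sub>h (idm [\<E>] l \<circ>\<^sub>h cls (eta' l))"
    by (simp add: hcomp_id flip: hcomp_assoc)
  have "?F \<circ>\<^sub>h curl_top l a = (?F \<circ>\<^sub>h (idm [\<E>] l \<circ>\<^sub>h ?v)) \<circ>\<^sub>v
     ?F \<circ>\<^sub>h ((cls (tau (l - 2)) \<circ>\<^sub>h idm [\<F>] l) \<circ>\<^sub>v (idm [\<E>] l \<circ>\<^sub>h cls (eta' l)))"
    unfolding curl_top_def by (rule whisker_left) (rule HOM_intros | simp)+
  also have "?F \<circ>\<^sub>h ((cls (tau (l - 2)) \<circ>\<^sub>h idm [\<F>] l) \<circ>\<^sub>v (idm [\<E>] l \<circ>\<^sub>h cls (eta' l)))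
     = (?F \<circ>\<^sub>h (cls (tau (l - 2)) \<circ>\<^sub>h idm [\<F>] l)) \<circ>\<^sub>v (?F \<circ>\<^sub>h (idm [\<E>] l \<circ>\<^sub>h cls (eta' l)))"
    by (rule whisker_left) (rule HOM_intros | simp)+
  finally show ?thesis
    unfolding sg'_arc arc_def by (simp only: vcomp_assoc[symmetric] 1[unfolded vcomp_assoc[symmetric]] 2)
qed

lemma sg_uu: "int c < l \<Longrightarrow> sg l \<circ>\<^sub>v uu l c = 0"
  by (simp add: sg_uu_eq curl_bot_zero)
lemma vv_sg': "int c < l \<Longrightarrow> vv l c \<circ>\<^sub>v sg' l = 0"
  unfolding vv_def vcomp_sum_left
  by (rule sum.neutral) (auto simp: vcomp_assoc eps_sg'_eq[unfolded vcomp_assoc] curl_top_zero)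

section \<open>The differential on the sideways crossing\<close>

lemma arc_add: "arc l (m + n) = arc l m + arc l n" by (simp add: arc_def comp_add)
lemma arc_diff: "arc l (m - n) = arc l m - arc l n" by (simp add: arc_def comp_diff)
lemma arc_scl: "arc l (scl c m) = scl c (arc l m)" by (simp add: arc_def comp_scl)

lemma arc_middle_vcomp:
  assumes "m \<in> HOM (l - 2) [\<E>, \<E>] [\<E>, \<E>]" "n \<in> HOM (l - 2) [\<E>, \<E>] [\<E>, \<E>]"
  shows "idm [\<F>] (l + 2) \<circ>\<^sub>h (m \<circ>\<^sub>v n) \<circ>\<^sub>h idm [\<F>] l
    = (idm [\<F>] (l + 2) \<circ>\<^sub>h m \<circ>\<^sub>h idm [\<F>] l) \<circ>\<^sub>v (idm [\<F>] (l + 2) \<circ>\<^sub>h n \<circ>\<^sub>h idm [\<F>] l)"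
proof -
  have "(m \<circ>\<^sub>v n) \<circ>\<^sub>h idm [\<F>] l = (m \<circ>\<^sub>h idm [\<F>] l) \<circ>\<^sub>v (n \<circ>\<^sub>h idm [\<F>] l)"
    by (rule whisker_right[OF assms]) simp
  then show ?thesis
    by (simp only:) (rule whisker_left, (rule HOM_intros assms | simp)+)
qed

lemma arc_dot_top:
  fixes m :: "'k::field mor"
  assumes m: "m \<in> HOM (l - 2) [\<E>, \<E>] [\<E>, \<E>]"
  shows "arc l ((cls (xi l) \<circ>\<^sub>h idm [\<E>] (l - 2)) \<circ>\<^sub>v m) = arc l m \<circ>\<^sub>v (cls (xi' (l + 2)) \<circ>\<^sub>h idm [\<E>] l)"
proof -
  let ?e = "cls (eps l) \<circ>\<^sub>h idm [\<E>, \<F>] l :: 'k mor"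
  let ?d = "cls (xi l) \<circ>\<^sub>h idm [\<E>] (l - 2) :: 'k mor"
  let ?m = "idm [\<F>] (l + 2) \<circ>\<^sub>h m \<circ>\<^sub>h idm [\<F>] l"
  let ?h = "idm [\<F>, \<E>] l \<circ>\<^sub>h cls (eta' l) :: 'k mor"
  let ?x = "cls (xi' (l + 2)) \<circ>\<^sub>h idm [\<E>, \<E>, \<F>] l :: 'k mor"
  let ?x1 = "cls (xi' (l + 2)) \<circ>\<^sub>h idm [\<E>] l :: 'k mor"
  have 1: "?e \<circ>\<^sub>v (idm [\<F>] (l + 2) \<circ>\<^sub>h ?d \<circ>\<^sub>h idm [\<F>] l) = ?e \<circ>\<^sub>v ?x"
  proof -
    have "?e \<circ>\<^sub>v (idm [\<F>] (l + 2) \<circ>\<^sub>h ?d \<circ>\<^sub>h idm [\<F>] l)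
        = ?e \<circ>\<^sub>v ((idm [\<F>] (l + 2) \<circ>\<^sub>h cls (xi l)) \<circ>\<^sub>h idm [\<E>, \<F>] l)"
      by (simp add: norm_id)
    also have "\<dots> = (cls (eps l) \<circ>\<^sub>v (idm [\<F>] (l + 2) \<circ>\<^sub>h cls (xi l))) \<circ>\<^sub>h idm [\<E>, \<F>] l"
      by (rule whisker_right[symmetric]) (rule HOM_intros | simp)+
    also have "cls (eps l) \<circ>\<^sub>v (idm [\<F>] (l + 2) \<circ>\<^sub>h cls (xi l)) = cls (eps l) \<circ>\<^sub>v ?x1"
      by (simp add: cls_rel[OF rel.cyc_xi2, unfolded cls_simps])
    also have "(cls (eps l) \<circ>\<^sub>v ?x1) \<circ>\<^sub>h idm [\<E>, \<F>] l = ?e \<circ>\<^sub>v (?x1 \<circ>\<^sub>h idm [\<E>, \<F>] l)"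
      by (rule whisker_right) (rule HOM_intros | simp)+
    also have "?x1 \<circ>\<^sub>h idm [\<E>, \<F>] l = ?x" by (simp add: norm_id)
    finally show ?thesis .
  qed
  have mF: "m \<circ>\<^sub>h idm [\<F>] l \<in> HOM l [\<E>, \<E>, \<F>] [\<E>, \<E>, \<F>]"
    by (rule HOM_hcomp[OF m HOM_id]) auto
  have 2: "?x \<circ>\<^sub>v ?m = ?m \<circ>\<^sub>v ?x"
    using slide_left[OF HOM_gens(2) mF, of "l + 2"] slide_right[OF HOM_gens(2) mF, of "l + 2"] by simp
  have 3: "?x \<circ>\<^sub>v ?h = ?h \<circ>\<^sub>v ?x1"
  proof -
    have x1: "?x1 \<in> HOM l [\<F>, \<E>] [\<F>, \<E>]" by (rule HOM_intros | simp)+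
    have "?x = ?x1 \<circ>\<^sub>h idm [\<E>, \<F>] l" by (simp add: norm_id)
    then have "?x \<circ>\<^sub>v ?h = ?x1 \<circ>\<^sub>h cls (eta' l)"
      by (simp only:) (rule slide_left[OF x1 HOM_gens(7)], simp)
    also have "\<dots> = ?h \<circ>\<^sub>v ?x1"
      by (subst slide_right[OF x1 HOM_gens(7), symmetric]) (simp_all add: hcomp_idr[OF x1])
    finally show ?thesis .
  qed
  have "arc l (?d \<circ>\<^sub>v m)
      = (?e \<circ>\<^sub>v (idm [\<F>] (l + 2) \<circ>\<^sub>h ?d \<circ>\<^sub>h idm [\<F>] l)) \<circ>\<^sub>v ?m \<circ>\<^sub>v ?h"
    unfolding arc_def by (subst arc_middle_vcomp[OF _ m], (rule HOM_intros | simp)+) (simp only: vcomp_assoc)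
  also have "\<dots> = ?e \<circ>\<^sub>v (?x \<circ>\<^sub>v ?m) \<circ>\<^sub>v ?h" unfolding 1 by (simp only: vcomp_assoc)
  also have "\<dots> = ?e \<circ>\<^sub>v ?m \<circ>\<^sub>v (?x \<circ>\<^sub>v ?h)" unfolding 2 by (simp only: vcomp_assoc)
  finally show ?thesis unfolding 3 arc_def by (simp only: vcomp_assoc)
qed

lemma arc_dot_bot:
  fixes m :: "'k::field mor"
  assumes m: "m \<in> HOM (l - 2) [\<E>, \<E>] [\<E>, \<E>]"
  shows "arc l (m \<circ>\<^sub>v (cls (xi l) \<circ>\<^sub>h idm [\<E>] (l - 2))) = arc l m \<circ>\<^sub>v (idm [\<F>] (l + 2) \<circ>\<^sub>h cls (xi l))"
proof -
  let ?e = "cls (eps l) \<circ>\<^sub>h idm [\<E>, \<F>] l :: 'k mor"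
  let ?d = "cls (xi l) \<circ>\<^sub>h idm [\<E>] (l - 2) :: 'k mor"
  let ?m = "idm [\<F>] (l + 2) \<circ>\<^sub>h m \<circ>\<^sub>h idm [\<F>] l"
  let ?h = "idm [\<F>, \<E>] l \<circ>\<^sub>h cls (eta' l) :: 'k mor"
  let ?x1 = "idm [\<F>] (l + 2) \<circ>\<^sub>h cls (xi l) :: 'k mor"
  have 1: "(idm [\<F>] (l + 2) \<circ>\<^sub>h ?d \<circ>\<^sub>h idm [\<F>] l) \<circ>\<^sub>v ?h = ?h \<circ>\<^sub>v ?x1"
  proof -
    have x1: "?x1 \<in> HOM l [\<F>, \<E>] [\<F>, \<E>]" by (rule HOM_intros | simp)+
    have "idm [\<F>] (l + 2) \<circ>\<^sub>h ?d \<circ>\<^sub>h idm [\<F>] l = ?x1 \<circ>\<^sub>h idm [\<E>, \<F>] l"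
      by (simp add: norm_id)
    then have "(idm [\<F>] (l + 2) \<circ>\<^sub>h ?d \<circ>\<^sub>h idm [\<F>] l) \<circ>\<^sub>v ?h = ?x1 \<circ>\<^sub>h cls (eta' l)"
      by (simp only:) (rule slide_left[OF x1 HOM_gens(7)], simp)
    also have "\<dots> = ?h \<circ>\<^sub>v ?x1"
      by (subst slide_right[OF x1 HOM_gens(7), symmetric]) (simp_all add: hcomp_idr[OF x1])
    finally show ?thesis .
  qed
  have "arc l (m \<circ>\<^sub>v ?d)
      = ?e \<circ>\<^sub>v ?m \<circ>\<^sub>v ((idm [\<F>] (l + 2) \<circ>\<^sub>h ?d \<circ>\<^sub>h idm [\<F>] l) \<circ>\<^sub>v ?h)"
    unfolding arc_def by (subst arc_middle_vcomp[OF m], (rule HOM_intros | simp)+) (simp only: vcomp_assoc)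
  then show ?thesis unfolding 1 arc_def by (simp only: vcomp_assoc)
qed

lemma arc_id: "arc l (idm [\<E>, \<E>] (l - 2)) = cls (eta' l) \<circ>\<^sub>v (cls (eps l) :: 'k::field mor)"
proof -
  have "arc l (idm [\<E>, \<E>] (l - 2)) = (cls (eps l) \<circ>\<^sub>h idm [\<E>, \<F>] l) \<circ>\<^sub>v (idm [\<F>, \<E>] l \<circ>\<^sub>h (cls (eta' l) :: 'k mor))"
    unfolding arc_def
    by (simp add: hcomp_id) (subst vcomp_idl[of _ l "[\<F>, \<E>]"], (rule HOM_intros | simp)+)
  also have "\<dots> = cls (eps l) \<circ>\<^sub>h cls (eta' l)" by (rule slide_left[OF HOM_gens(6,7)]) simp
  also have "\<dots> = cls (eta' l) \<circ>\<^sub>v cls (eps l)"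
    by (subst slide_right[OF HOM_gens(6,7), symmetric])
      (simp_all add: hcomp_idl[OF HOM_gens(7)] hcomp_idr[OF HOM_gens(6)])
  finally show ?thesis .
qed

locale p_differential =
  fixes P :: "'k::field pars" and D :: "'k mor \<Rightarrow> 'k mor"
  assumes differential: "differential P D"
begin

lemmas differential_rules = differential[unfolded differential_def]

lemma D_HOM: "f \<in> HOM l u v \<Longrightarrow> D f \<in> HOM l u v"
  using differential_rules[THEN conjunct1] by blast
lemma D_add: "f \<in> HOM l u v \<Longrightarrow> g \<in> HOM l u v \<Longrightarrow> D (f + g) = D f + D g"
  using differential_rules[THEN conjunct2, THEN conjunct1] by blast
lemma D_vcomp: "f \<in> HOM l v w \<Longrightarrow> g \<in> HOM l u v \<Longrightarrow> D (f \<circ>\<^sub>v g) = D f \<circ>\<^sub>v g + f \<circ>\<^sub>v D g"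
  using differential_rules[THEN conjunct2, THEN conjunct2, THEN conjunct2, THEN conjunct2, THEN conjunct2, THEN conjunct1]
  by blast
lemma D_hcomp: "f \<in> HOM m u' v' \<Longrightarrow> g \<in> HOM l u v \<Longrightarrow> m = l + wt u \<Longrightarrow>
    D (f \<circ>\<^sub>h g) = D f \<circ>\<^sub>h g + f \<circ>\<^sub>h D g"
  using differential_rules[THEN conjunct2, THEN conjunct2, THEN conjunct2, THEN conjunct2, THEN conjunct2,
      THEN conjunct2, THEN conjunct1]
  by blast

lemma D_xi: "D (cls (xi l)) = cls (xi l) \<circ>\<^sub>v cls (xi l)"
  and D_tau: "D (cls (tau l)) = scl (pa P l) (idm [\<E>, \<E>] l)
     + scl (- (1 + pa P l)) ((cls (xi (l + 2)) \<circ>\<^sub>h idm [\<E>] l) \<circ>\<^sub>v cls (tau l))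
     + scl (pa P l - 1) ((idm [\<E>] (l + 2) \<circ>\<^sub>h cls (xi l)) \<circ>\<^sub>v cls (tau l))"
  and D_eta': "D (cls (eta' l)) = scl (pxb P (l - 2)) ((cls (xi (l - 2)) \<circ>\<^sub>h idm [\<F>] l) \<circ>\<^sub>v cls (eta' l))
     + scl (pyb P (l - 2)) (cls (eta' l) \<circ>\<^sub>v bpl 1 l)"
  and D_eps: "D (cls (eps l)) =
     scl (- (pxb P l + 2 * pyb P l)) (cls (eps l) \<circ>\<^sub>v (idm [\<F>] (l + 2) \<circ>\<^sub>h cls (xi l)))
     + scl (- pyb P l) (bpl 1 l \<circ>\<^sub>v cls (eps l))"
  using differential unfolding differential_def by (simp_all add: cls_simps)

lemma D_zero: "D 0 = 0"
  using D_add[OF HOM_zero HOM_zero, of "[]" "[]"] by simp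

lemma D_id: "D (idm w l) = 0"
proof -
  have "D (idm w l) \<in> HOM l w w" by (rule D_HOM[OF HOM_id])
  then show ?thesis
    using D_vcomp[OF HOM_id HOM_id, of w l] by (simp add: vcomp_idl vcomp_idr vcomp_idl[OF HOM_id])
qed

lemma D_whisker_right: "f \<in> HOM m u v \<Longrightarrow> m = l + wt w \<Longrightarrow> D (f \<circ>\<^sub>h idm w l) = D f \<circ>\<^sub>h idm w l"
  by (subst D_hcomp[OF _ HOM_id]) (auto simp: D_id)
lemma D_whisker_left: "f \<in> HOM l u v \<Longrightarrow> m = l + wt u \<Longrightarrow> D (idm w m \<circ>\<^sub>h f) = idm w m \<circ>\<^sub>h D f"
  by (subst D_hcomp[OF HOM_id]) (auto simp: D_id)

lemma D_xF: "D (xF c l) = scl (of_nat c) (xF (Suc c) l)"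
proof (induction c)
  case 0 then show ?case by (simp add: xF_0 D_id)
next
  case (Suc c)
  let ?X = "cls (xi (l - 2)) \<circ>\<^sub>h idm [\<F>] l :: 'k mor"
  have X: "?X \<in> HOM l [\<E>, \<F>] [\<E>, \<F>]" by (rule HOM_intros | simp)+
  have DX: "D ?X = ?X \<circ>\<^sub>v ?X"
    by (subst D_whisker_right[OF HOM_gens(1)]) (simp_all add: D_xi whisker_right[OF HOM_gens(1,1)])
  show ?case
    by (subst xF_Suc, subst D_vcomp[OF X HOM_xF])
      (simp add: DX Suc xF_Suc comp_scl vcomp_assoc mor.scale_left_distrib)
qed

lemma D_uu: "D (uu l c) = scl (of_nat c + pxb P (l - 2)) (uu l (Suc c)) + scl (pyb P (l - 2)) (uu l c \<circ>\<^sub>v bpl 1 l)"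
  unfolding uu_def
  by (subst D_vcomp[OF HOM_xF HOM_gens(7)])
    (simp add: D_xF D_eta' comp_add comp_scl vcomp_assoc xF_Suc2 mor.scale_left_distrib add.assoc)

lemma D_arc:
  assumes m: "m \<in> HOM (l - 2) [\<E>, \<E>] [\<E>, \<E>]"
  shows "D (arc l m) =
      scl (- (pxb P l + 2 * pyb P l)) (arc l ((cls (xi l) \<circ>\<^sub>h idm [\<E>] (l - 2)) \<circ>\<^sub>v m))
    - scl (pyb P l) (arc l m \<circ>\<^sub>v (bpl 1 l \<circ>\<^sub>h idm [\<F>, \<E>] l))
    + arc l (D m)
    + scl (pxb P (l - 2)) (arc l (m \<circ>\<^sub>v (idm [\<E>] l \<circ>\<^sub>h cls (xi (l - 2)))))
    + scl (pyb P (l - 2)) (arc l m \<circ>\<^sub>v (idm [\<F>, \<E>] l \<circ>\<^sub>h bpl 1 l))"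
proof -
  let ?e = "cls (eps l) \<circ>\<^sub>h idm [\<E>, \<F>] l :: 'k mor"
  let ?M = "\<lambda>m. idm [\<F>] (l + 2) \<circ>\<^sub>h m \<circ>\<^sub>h idm [\<F>] l"
  let ?h = "idm [\<F>, \<E>] l \<circ>\<^sub>h cls (eta' l) :: 'k mor"
  let ?x = "cls (xi l) \<circ>\<^sub>h idm [\<E>] (l - 2) :: 'k mor"
  let ?y = "idm [\<E>] l \<circ>\<^sub>h cls (xi (l - 2)) :: 'k mor"
  let ?b = "bpl 1 l :: 'k mor"
  have x: "?x \<in> HOM (l - 2) [\<E>, \<E>] [\<E>, \<E>]" and y: "?y \<in> HOM (l - 2) [\<E>, \<E>] [\<E>, \<E>]"
    by (rule HOM_intros | simp)+
  have mF: "m \<circ>\<^sub>h idm [\<F>] l \<in> HOM l [\<E>, \<E>, \<F>] [\<E>, \<E>, \<F>]"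
    by (rule HOM_hcomp[OF m HOM_id]) auto
  have e: "?e \<in> HOM l [\<F>, \<E>, \<E>, \<F>] [\<E>, \<F>]" and h: "?h \<in> HOM l [\<F>, \<E>] [\<F>, \<E>, \<E>, \<F>]"
    and M: "?M m \<in> HOM l [\<F>, \<E>, \<E>, \<F>] [\<F>, \<E>, \<E>, \<F>]"
    by (rule HOM_intros m | simp)+
  have De: "D ?e = scl (- (pxb P l + 2 * pyb P l)) (?e \<circ>\<^sub>v ?M ?x) - scl (pyb P l) ((?b \<circ>\<^sub>h idm [\<E>, \<F>] l) \<circ>\<^sub>v ?e)"
  proof -
    have "(cls (eps l) \<circ>\<^sub>v (idm [\<F>] (l + 2) \<circ>\<^sub>h cls (xi l))) \<circ>\<^sub>h idm [\<E>, \<F>] l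
        = ?e \<circ>\<^sub>v ((idm [\<F>] (l + 2) \<circ>\<^sub>h cls (xi l)) \<circ>\<^sub>h idm [\<E>, \<F>] l)"
      by (rule whisker_right) (rule HOM_intros | simp)+
    also have "(idm [\<F>] (l + 2) \<circ>\<^sub>h cls (xi l)) \<circ>\<^sub>h idm [\<E>, \<F>] l = ?M ?x" by (simp add: norm_id)
    finally have 1: "(cls (eps l) \<circ>\<^sub>v (idm [\<F>] (l + 2) \<circ>\<^sub>h cls (xi l))) \<circ>\<^sub>h idm [\<E>, \<F>] l = ?e \<circ>\<^sub>v ?M ?x" .
    have 2: "(?b \<circ>\<^sub>v cls (eps l)) \<circ>\<^sub>h idm [\<E>, \<F>] l = (?b \<circ>\<^sub>h idm [\<E>, \<F>] l) \<circ>\<^sub>v ?e"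
      by (rule whisker_right[OF HOM_bubble(1) HOM_gens(6)]) simp
    show ?thesis
      by (subst D_whisker_right[OF HOM_gens(6)])
        (simp_all add: D_eps hcomp_add_left hcomp_scl_left comp_minus comp_diff 1 2)
  qed
  have Dh: "D ?h = scl (pxb P (l - 2)) (?M ?y \<circ>\<^sub>v ?h) + scl (pyb P (l - 2)) (?h \<circ>\<^sub>v (idm [\<F>, \<E>] l \<circ>\<^sub>h ?b))"
  proof -
    have "idm [\<F>, \<E>] l \<circ>\<^sub>h ((cls (xi (l - 2)) \<circ>\<^sub>h idm [\<F>] l) \<circ>\<^sub>v cls (eta' l))
        = (idm [\<F>, \<E>] l \<circ>\<^sub>h cls (xi (l - 2)) \<circ>\<^sub>h idm [\<F>] l) \<circ>\<^sub>v ?h"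
      by (rule whisker_left) (rule HOM_intros | simp)+
    also have "idm [\<F>, \<E>] l \<circ>\<^sub>h cls (xi (l - 2)) \<circ>\<^sub>h idm [\<F>] l = ?M ?y"
    proof -
      have "idm [\<F>, \<E>] l = idm [\<F>] (l + 2) \<circ>\<^sub>h (idm [\<E>] l :: 'k mor)" by (simp add: hcomp_id)
      then show ?thesis by (simp only: hcomp_assoc)
    qed
    finally have 1: "idm [\<F>, \<E>] l \<circ>\<^sub>h ((cls (xi (l - 2)) \<circ>\<^sub>h idm [\<F>] l) \<circ>\<^sub>v cls (eta' l)) = ?M ?y \<circ>\<^sub>v ?h" .
    have 2: "idm [\<F>, \<E>] l \<circ>\<^sub>h (cls (eta' l) \<circ>\<^sub>v ?b) = ?h \<circ>\<^sub>v (idm [\<F>, \<E>] l \<circ>\<^sub>h ?b)"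
      by (rule whisker_left[OF HOM_gens(7) HOM_bubble(1)]) simp
    show ?thesis
      by (subst D_whisker_left[OF HOM_gens(7)]) (simp_all add: D_eta' hcomp_add_right hcomp_scl_right 1 2)
  qed
  have DM: "D (?M m) = ?M (D m)"
    by (subst D_whisker_left[OF mF]) (simp_all add: D_whisker_right[OF m])
  have b: "(?b \<circ>\<^sub>h idm [\<E>, \<F>] l) \<circ>\<^sub>v arc l m = arc l m \<circ>\<^sub>v (?b \<circ>\<^sub>h idm [\<F>, \<E>] l)"
    using slide_left[OF HOM_bubble(1) HOM_arc[OF m], of l] slide_right[OF HOM_bubble(1) HOM_arc[OF m], of l]
    by (simp add: hcomp_idl[OF HOM_arc[OF m]])
  have Mh: "?M m \<circ>\<^sub>v ?h \<in> HOM l [\<F>, \<E>] [\<F>, \<E>, \<E>, \<F>]" by (rule HOM_vcomp[OF M h])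
  have "D (arc l m) = D ?e \<circ>\<^sub>v ?M m \<circ>\<^sub>v ?h + ?e \<circ>\<^sub>v ?M (D m) \<circ>\<^sub>v ?h + ?e \<circ>\<^sub>v ?M m \<circ>\<^sub>v D ?h"
    unfolding arc_def by (simp add: D_vcomp[OF e Mh] D_vcomp[OF M h] DM comp_add add.assoc)
  also have "D ?e \<circ>\<^sub>v ?M m \<circ>\<^sub>v ?h = scl (- (pxb P l + 2 * pyb P l)) (arc l (?x \<circ>\<^sub>v m))
      - scl (pyb P l) ((?b \<circ>\<^sub>h idm [\<E>, \<F>] l) \<circ>\<^sub>v arc l m)"
    unfolding De arc_def arc_middle_vcomp[OF x m] comp_diff comp_scl vcomp_assoc ..
  also have "?e \<circ>\<^sub>v ?M m \<circ>\<^sub>v D ?h = scl (pxb P (l - 2)) (arc l (m \<circ>\<^sub>v ?y))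
      + scl (pyb P (l - 2)) (arc l m \<circ>\<^sub>v (idm [\<F>, \<E>] l \<circ>\<^sub>h ?b))"
    unfolding Dh arc_def arc_middle_vcomp[OF m y] comp_add comp_scl vcomp_assoc ..
  finally show ?thesis unfolding b by (simp add: arc_def)
qed

lemma D_sg': 
  "D (sg' l) =
      scl (pxb P (l - 2) - (pxb P l + 2 * pyb P l) - (1 + pa P (l - 2))) (sg' l \<circ>\<^sub>v (cls (xi' (l + 2)) \<circ>\<^sub>h idm [\<E>] l))
    + scl (pa P (l - 2) - 1) (sg' l \<circ>\<^sub>v (idm [\<F>] (l + 2) \<circ>\<^sub>h cls (xi l)))
    + scl (1 - pxb P (l - 2)) (cls (eta' l) \<circ>\<^sub>v cls (eps l))
    - scl (pyb P l) (sg' l \<circ>\<^sub>v (bpl 1 l \<circ>\<^sub>h idm [\<F>, \<E>] l))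
    + scl (pyb P (l - 2)) (sg' l \<circ>\<^sub>v (idm [\<F>, \<E>] l \<circ>\<^sub>h bpl 1 l))"
proof -
  note D_tau' = D_tau[of "l - 2", simplified]
  show ?thesis
    unfolding sg'_arc D_arc[OF HOM_gens(3)] D_tau' tau_slide1 tau_slide2 arc_add arc_diff arc_scl arc_id
      arc_dot_top[OF HOM_gens(3)] arc_dot_bot[OF HOM_gens(3)]
    by (simp add: mor.scale_right_diff_distrib mor.scale_left_diff_distrib mor.scale_left_distrib)
qed

lemma sg_D_sg':
  assumes "l > 0"
  shows "sg l \<circ>\<^sub>v D (sg' l) =
      scl (pyb P l) (bpl 1 l \<circ>\<^sub>h idm [\<F>, \<E>] l)
    - scl (pxb P (l - 2) - (pxb P l + 2 * pyb P l) - (1 + pa P (l - 2))) (cls (xi' (l + 2)) \<circ>\<^sub>h idm [\<E>] l)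
    - scl (pa P (l - 2) - 1) (idm [\<F>] (l + 2) \<circ>\<^sub>h cls (xi l))
    - scl (pyb P (l - 2)) (idm [\<F>, \<E>] l \<circ>\<^sub>h bpl 1 l)"
proof -
  have uu0: "uu l 0 = (cls (eta' l) :: 'k mor)"
    by (simp add: uu_def xF_0 vcomp_idl[OF HOM_gens(7)])
  have *: "sg l \<circ>\<^sub>v sg' l \<circ>\<^sub>v f = - f" if "f \<in> HOM l [\<F>, \<E>] [\<F>, \<E>]" for f :: "'k mor"
    using that by (simp add: sg_sg'[OF assms] comp_minus vcomp_idl flip: vcomp_assoc)
  have eta: "sg l \<circ>\<^sub>v cls (eta' l) \<circ>\<^sub>v f = 0" for f :: "'k mor"
    by (simp add: sg_uu assms flip: vcomp_assoc uu0)
  have 1: "sg l \<circ>\<^sub>v sg' l \<circ>\<^sub>v (bpl 1 l \<circ>\<^sub>h idm [\<F>, \<E>] l) = - (bpl 1 l \<circ>\<^sub>h idm [\<F>, \<E>] l :: 'k mor)"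
    by (rule *) (rule HOM_intros HOM_bubble | simp)+
  have 2: "sg l \<circ>\<^sub>v sg' l \<circ>\<^sub>v (idm [\<F>, \<E>] l \<circ>\<^sub>h bpl 1 l) = - (idm [\<F>, \<E>] l \<circ>\<^sub>h bpl 1 l :: 'k mor)"
    by (rule *) (rule HOM_intros HOM_bubble | simp)+
  have 3: "sg l \<circ>\<^sub>v sg' l \<circ>\<^sub>v (cls (xi' (l + 2)) \<circ>\<^sub>h idm [\<E>] l) = - (cls (xi' (l + 2)) \<circ>\<^sub>h idm [\<E>] l :: 'k mor)"
    by (rule *) (rule HOM_intros HOM_bubble | simp)+
  have 4: "sg l \<circ>\<^sub>v sg' l \<circ>\<^sub>v (idm [\<F>] (l + 2) \<circ>\<^sub>h cls (xi l)) = - (idm [\<F>] (l + 2) \<circ>\<^sub>h cls (xi l) :: 'k mor)"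
    by (rule *) (rule HOM_intros HOM_bubble | simp)+
  show ?thesis
    unfolding D_sg' by (simp add: comp_add comp_diff comp_scl 1 2 3 4 eta)
qed

lemma D_left_if_D_comp_zero:
  assumes "v \<in> HOM l w x" "u \<in> HOM l y w" "D (v \<circ>\<^sub>v u) = 0"
  shows "D v \<circ>\<^sub>v u = - (v \<circ>\<^sub>v D u)"
  using assms(3) by (simp add: D_vcomp[OF assms(1,2)] eq_neg_iff_add_eq_0)

end

section \<open>Residues of rational functions\<close>

definition rat_fps :: "'a::field set \<Rightarrow> 'a set \<Rightarrow> 'a fps" where
  "rat_fps A B = (\<Prod>b\<in>B. 1 - fps_const b * fps_X) * inverse (\<Prod>a\<in>A. 1 - fps_const a * fps_X)"

definition rat_coeff :: "'a::field set \<Rightarrow> 'a set \<Rightarrow> int \<Rightarrow> 'a" where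
  "rat_coeff A B k = (if k < 0 then 0 else fps_nth (rat_fps A B) (nat k))"

definition residue_at :: "'a::field set \<Rightarrow> 'a set \<Rightarrow> 'a \<Rightarrow> 'a" where
  "residue_at A B a = (\<Prod>b\<in>B. a - b) / (\<Prod>a'\<in>A - {a}. a - a')"

lemma rat_coeff_neg [simp]: "k < 0 \<Longrightarrow> rat_coeff A B k = 0"
  by (simp add: rat_coeff_def)

lemma fps_nth_0_linear_prod: "fps_nth (\<Prod>a\<in>A. 1 - fps_const a * fps_X) 0 = (1 :: 'a::field)"
  by (induction A rule: infinite_finite_induct) auto

lemma fps_nth_0_rat_fps: "fps_nth (rat_fps A B) 0 = 1"
  by (simp add: rat_fps_def fps_nth_0_linear_prod)

lemma rat_coeff_0 [simp]: "rat_coeff A B 0 = 1"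
  by (simp add: rat_coeff_def fps_nth_0_rat_fps)

lemma fps_nth_linear_mult:
  fixes f :: "'a::field fps"
  shows "fps_nth ((1 - fps_const c * fps_X) * f) n = fps_nth f n - (if n = 0 then 0 else c * fps_nth f (n - 1))"
  by (simp add: left_diff_distrib mult.assoc)

lemma rat_coeff_linear_mult:
  assumes "rat_fps A B = (1 - fps_const c * fps_X) * rat_fps A' B'"
  shows "rat_coeff A B k = rat_coeff A' B' k - c * rat_coeff A' B' (k - 1)"
proof -
  have "nat k - Suc 0 = nat (k - 1)" by auto
  then show ?thesis by (auto simp: rat_coeff_def assms fps_nth_linear_mult)
qed

lemma rat_coeff_insert_zero:
  assumes "finite B" "b \<notin> B"
  shows "rat_coeff A (insert b B) k = rat_coeff A B k - b * rat_coeff A B (k - 1)"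
  using assms by (intro rat_coeff_linear_mult) (simp add: rat_fps_def mult.assoc)

lemma rat_coeff_insert_pole:
  assumes "finite A" "a \<notin> A"
  shows "rat_coeff A B k = rat_coeff (insert a A) B k - a * rat_coeff (insert a A) B (k - 1)"
proof (rule rat_coeff_linear_mult)
  let ?p = "1 - fps_const a * fps_X"
  have 1: "?p * inverse ?p = 1" by (subst mult.commute, rule inverse_mult_eq_1) simp
  have "rat_fps A B = (?p * inverse ?p) * rat_fps A B" by (simp only: 1 mult_1)
  also have "\<dots> = ?p * rat_fps (insert a A) B"
    using assms by (simp add: rat_fps_def fps_inverse_mult mult.left_commute mult.assoc)
  finally show "rat_fps A B = ?p * rat_fps (insert a A) B" .
qed

lemma rat_coeff_convolution:
  "(\<Sum>j\<in>{0..m}. rat_coeff A B j * rat_coeff B A (m - j)) = (if m = 0 then 1 else 0 :: 'a::field)"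
proof (cases "m < 0")
  case False
  let ?p = "\<lambda>A. \<Prod>a\<in>A. 1 - fps_const a * fps_X :: 'a fps"
  have unit: "?p A * inverse (?p A) = 1" for A
    by (subst mult.commute, rule inverse_mult_eq_1) (simp add: fps_nth_0_linear_prod)
  have "rat_fps A B * rat_fps B A = (?p A * inverse (?p A)) * (?p B * inverse (?p B))"
    by (simp add: rat_fps_def algebra_simps)
  then have 1: "rat_fps A B * rat_fps B A = 1" by (simp add: unit)
  have "{0..m} = int ` {0..nat m}" using False by (auto simp: image_iff intro!: bexI[of _ "nat _"])
  then have "(\<Sum>j\<in>{0..m}. rat_coeff A B j * rat_coeff B A (m - j))
      = (\<Sum>j\<in>{0..nat m}. rat_coeff A B (int j) * rat_coeff B A (m - int j))"
    by (simp add: sum.reindex)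
  also have "\<dots> = (\<Sum>j\<in>{0..nat m}. fps_nth (rat_fps A B) j * fps_nth (rat_fps B A) (nat m - j))"
    using False by (intro sum.cong) (auto simp: rat_coeff_def nat_diff_distrib)
  also have "\<dots> = fps_nth (rat_fps A B * rat_fps B A) (nat m)"
    by (simp add: fps_mult_nth)
  finally show ?thesis using False 1 by auto
qed auto

lemma geometric_recursion:
  fixes f g :: "int \<Rightarrow> 'a::field"
  assumes "\<And>k. f k = g k - a * g (k - 1)" "\<And>k. k < 0 \<Longrightarrow> g k = 0"
  shows "g k = (\<Sum>c\<in>{0..k}. f (k - c) * a ^ nat c)"
proof (cases "k < 0")
  case False
  have "g (int n) = (\<Sum>c\<le>n. f (int n - int c) * a ^ c)" for n
  proof (induction n)
    case 0
    then show ?case using assms(1)[of 0] assms(2)[of "-1"] by simp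
  next
    case (Suc n)
    have "g (int (Suc n)) = f (int (Suc n)) + a * g (int n)" using assms(1)[of "int (Suc n)"] by simp
    also have "\<dots> = (\<Sum>c\<le>Suc n. f (int (Suc n) - int c) * a ^ c)"
      by (simp add: sum.atMost_Suc_shift Suc sum_distrib_left algebra_simps del: sum.atMost_Suc)
    finally show ?case .
  qed
  from this[of "nat k"] False have "g k = (\<Sum>c\<le>nat k. f (k - int c) * a ^ c)" by simp
  also have "\<dots> = (\<Sum>c\<in>int ` {..nat k}. f (k - c) * a ^ nat c)" by (simp add: sum.reindex)
  also have "int ` {..nat k} = {0..k}" using False by (auto simp: image_iff intro!: bexI[of _ "nat _"])
  finally show ?thesis .
qed (simp add: assms)

lemma residue_at_insert_pole:
  assumes "finite A" "b \<notin> A" "a \<in> A"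
  shows "residue_at (insert b A) B a = residue_at A B a / (a - b)"
proof -
  have "insert b A - {a} = insert b (A - {a})" using assms by auto
  then show ?thesis using assms by (simp add: residue_at_def)
qed

lemma residue_at_zero: "finite B \<Longrightarrow> a \<in> B \<Longrightarrow> residue_at A B a = 0"
  by (auto simp: residue_at_def)

lemma residue_at_insert_zero:
  assumes "finite B" "b \<notin> B"
  shows "residue_at A (insert b B) a = (a - b) * residue_at A B a"
  using assms by (simp add: residue_at_def)

lemma residue_sum_no_zeros:
  fixes A :: "'a::field set"
  assumes "finite A"
  shows "(\<Sum>a\<in>A. a ^ n * residue_at A {} a) = rat_coeff A {} (int n + 1 - int (card A))"
proof -
  define f where "f A n = (\<Sum>a\<in>A. a ^ n * residue_at A {} a)" for A :: "'a set" and n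
  have step: "f (insert b A) (Suc n) = b * f (insert b A) n + f A n" if "finite A" "b \<notin> A" for A b n
  proof -
    have "f (insert b A) (Suc n) - b * f (insert b A) n
        = (\<Sum>a\<in>insert b A. (a - b) * a ^ n * residue_at (insert b A) {} a)"
      by (simp add: f_def sum_distrib_left algebra_simps flip: sum_subtractf)
    also have "\<dots> = (\<Sum>a\<in>A. (a - b) * a ^ n * residue_at (insert b A) {} a)"
      using that by simp
    also have "\<dots> = f A n" unfolding f_def
    proof (rule sum.cong[OF HOL.refl])
      fix a assume a: "a \<in> A"
      then have "a - b \<noteq> 0" using that by auto
      then show "(a - b) * a ^ n * residue_at (insert b A) {} a = a ^ n * residue_at A {} a"
        using a that by (simp add: residue_at_insert_pole)
    qed
    finally show ?thesis by (simp add: algebra_simps)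
  qed
  have single: "f {b} 0 = 1" for b by (simp add: f_def residue_at_def)
  have zero: "f A 0 = 0" if "card A = Suc (Suc k)" for A k
    using that
  proof (induction k arbitrary: A)
    case 0
    then obtain b c where A: "A = {b, c}" "b \<noteq> c" by (auto simp: card_Suc_eq numeral_2_eq_2)
    have "b * f A 0 + f {c} 0 = c * f A 0 + f {b} 0"
      using step[of "{c}" b 0] step[of "{b}" c 0] A by (simp add: insert_commute)
    then show ?case using A(2) by (simp add: single)
  next
    case (Suc k)
    then have fin: "finite A" by (metis card.infinite nat.distinct(1))
    from Suc.prems obtain b A1 where A1: "A = insert b A1" "b \<notin> A1" "card A1 = Suc (Suc k)"
      by (metis card_Suc_eq)
    from A1(3) obtain c where c: "c \<in> A1" by (metis card.empty ex_in_conv nat.distinct(1))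
    have "card (A - {c}) = Suc (Suc k)" using Suc.prems fin c A1 by simp
    then have "f (A - {c}) 0 = 0" "f (A - {b}) 0 = 0"
      using Suc.IH A1 by auto
    moreover have "insert c (A - {c}) = A" "insert b (A - {b}) = A" using c A1 by auto
    ultimately have "f A 1 = c * f A 0" "f A 1 = b * f A 0"
      using step[of "A - {c}" c 0] step[of "A - {b}" b 0] fin by simp_all
    then show ?case using c A1 by auto
  qed
  have "f A n = rat_coeff A {} (int n + 1 - int (card A))"
    using assms
  proof (induction A arbitrary: n rule: finite_induct)
    case empty
    then show ?case by (simp add: f_def rat_coeff_def rat_fps_def)
  next
    case (insert b A)
    show ?case
    proof (induction n)
      case 0
      show ?case
      proof (cases "card A")
        case 0
        then show ?thesis using insert by (simp add: single)
      next
        case (Suc k)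
        then show ?thesis using insert zero[of "insert b A" k] by simp
      qed
    next
      case (Suc n)
      show ?case
        using insert.hyps by (simp add: step Suc insert.IH rat_coeff_insert_pole[OF insert.hyps]
            diff_diff_eq algebra_simps)
    qed
  qed
  then show ?thesis by (simp add: f_def)
qed

lemma residue_sum:
  assumes "finite A" "finite B"
  shows "(\<Sum>a\<in>A. a ^ n * residue_at A B a) = rat_coeff A B (int n + 1 + int (card B) - int (card A))"
  using assms(2)
proof (induction B arbitrary: n rule: finite_induct)
  case empty
  then show ?case using residue_sum_no_zeros[OF assms(1)] by simp
next
  case (insert b B)
  have "(\<Sum>a\<in>A. a ^ n * residue_at A (insert b B) a)
      = (\<Sum>a\<in>A. a ^ Suc n * residue_at A B a) - b * (\<Sum>a\<in>A. a ^ n * residue_at A B a)"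
    using insert.hyps
    by (simp add: residue_at_insert_zero sum_distrib_left algebra_simps flip: sum_subtractf)
  then show ?case unfolding insert.IH using insert.hyps by (simp add: rat_coeff_insert_zero algebra_simps)
qed

lemma residue_sum_divided:
  assumes "finite A" "finite B" "z \<notin> A" "z \<in> B"
  defines "m \<equiv> int (card B) - int (card A)"
  shows "(\<Sum>a\<in>A. residue_at A B a / (a - z)) = (\<Sum>c\<in>{0..m}. rat_coeff A B (m - c) * z ^ nat c)"
proof -
  have "(\<Sum>a\<in>A. residue_at A B a / (a - z)) = (\<Sum>a\<in>A. residue_at (insert z A) B a)"
    using assms by (intro sum.cong) (auto simp: residue_at_insert_pole)
  also have "\<dots> = (\<Sum>a\<in>insert z A. residue_at (insert z A) B a)"
    using assms by (simp add: residue_at_zero)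
  also have "\<dots> = rat_coeff (insert z A) B m"
    using residue_sum[of "insert z A" B 0] assms by (simp add: algebra_simps)
  also have "\<dots> = (\<Sum>c\<in>{0..m}. rat_coeff A B (m - c) * z ^ nat c)"
    using assms by (intro geometric_recursion rat_coeff_insert_pole) auto
  finally show ?thesis .
qed

lemma residue_sum_twice_divided:
  assumes "finite A" "finite B" "A \<inter> B = {}" "z \<in> B" "w \<in> B"
  defines "m \<equiv> int (card B) - int (card A)"
  shows "(\<Sum>a\<in>A. residue_at A B a / ((a - z) * (a - w))) + (if z = w then 1 / residue_at B A z else 0)
    = (\<Sum>c\<in>{0..m - 1}. (\<Sum>d\<in>{0..m - 1 - c}. rat_coeff A B (m - 1 - c - d) * z ^ nat d) * w ^ nat c)"
proof -
  have z: "z \<notin> A" and w: "w \<notin> A" using assms by auto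
  have single: "rat_coeff (insert z A) B k = (\<Sum>d\<in>{0..k}. rat_coeff A B (k - d) * z ^ nat d)" for k
    using assms z by (intro geometric_recursion rat_coeff_insert_pole) auto
  show ?thesis
  proof (cases "z = w")
    case False
    have "(\<Sum>a\<in>A. residue_at A B a / ((a - z) * (a - w))) = (\<Sum>a\<in>A. residue_at (insert w (insert z A)) B a)"
      using assms z w False by (intro sum.cong) (auto simp: residue_at_insert_pole)
    also have "\<dots> = (\<Sum>a\<in>insert w (insert z A). residue_at (insert w (insert z A)) B a)"
      using assms z w False by (simp add: residue_at_zero)
    also have "\<dots> = rat_coeff (insert w (insert z A)) B (m - 1)"
      using residue_sum[of "insert w (insert z A)" B 0] assms z w False by (simp add: algebra_simps)
    also have "\<dots> = (\<Sum>c\<in>{0..m - 1}. rat_coeff (insert z A) B (m - 1 - c) * w ^ nat c)"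
      using assms z w False by (intro geometric_recursion rat_coeff_insert_pole) auto
    finally show ?thesis using False by (simp add: single)
  next
    case True
    let ?B = "B - {z}"
    have B: "insert z ?B = B" using assms by auto
    have 1: "residue_at A B a / ((a - z) * (a - z)) = residue_at (insert z A) ?B a" if "a \<in> A" for a
    proof -
      have "residue_at A B a = (a - z) * residue_at A ?B a"
        using residue_at_insert_zero[of ?B z A a] assms B by simp
      moreover have "a - z \<noteq> 0" using that z by auto
      ultimately show ?thesis using that assms z by (simp add: residue_at_insert_pole)
    qed
    have 2: "1 / residue_at B A z = residue_at (insert z A) ?B z"
      using z by (simp add: residue_at_def)
    have "(\<Sum>a\<in>A. residue_at A B a / ((a - z) * (a - w))) + (if z = w then 1 / residue_at B A z else 0)
       = (\<Sum>a\<in>insert z A. residue_at (insert z A) ?B a)"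
    proof -
      have "(\<Sum>a\<in>A. residue_at A B a / ((a - z) * (a - z))) = (\<Sum>a\<in>A. residue_at (insert z A) ?B a)"
        by (rule sum.cong[OF HOL.refl 1])
      then show ?thesis using assms(1) z by (simp add: 2 flip: True)
    qed
    also have "\<dots> = rat_coeff (insert z A) ?B (m - 1)"
    proof -
      have "int (card ?B) = int (card B) - 1"
        using assms by (metis One_nat_def Suc_pred card_Diff_singleton card_gt_0_iff empty_iff of_nat_1 of_nat_Suc add_diff_cancel_left')
      then show ?thesis using residue_sum[of "insert z A" ?B 0] assms z by (simp add: algebra_simps)
    qed
    also have "\<dots> = (\<Sum>c\<in>{0..m - 1}. rat_coeff (insert z A) B (m - 1 - c) * z ^ nat c)"
      using rat_coeff_insert_zero[of ?B z "insert z A"] assms B by (intro geometric_recursion) auto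
    finally show ?thesis unfolding single by (simp only: True)
  qed
qed

section \<open>A localized 2-representation\<close>

type_synonym 'a path = "(letter \<times> 'a) list"

fun path_end :: "'a set \<Rightarrow> 'a path \<Rightarrow> 'a set" where
  "path_end S [] = S"
| "path_end S ((\<E>, i) # p) = insert i (path_end S p)"
| "path_end S ((\<F>, i) # p) = path_end S p - {i}"

fun valid_path :: "'a set \<Rightarrow> 'a set \<Rightarrow> 'a path \<Rightarrow> bool" where
  "valid_path X S [] \<longleftrightarrow> S \<subseteq> X"
| "valid_path X S ((\<E>, i) # p) \<longleftrightarrow> valid_path X S p \<and> i \<in> X \<and> i \<notin> path_end S p"
| "valid_path X S ((\<F>, i) # p) \<longleftrightarrow> valid_path X S p \<and> i \<in> path_end S p"

fun splits :: "'b list \<Rightarrow> ('b list \<times> 'b list) list" where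
  "splits [] = [([], [])]"
| "splits (a # p) = ([], a # p) # map (\<lambda>(u, v). (a # u, v)) (splits p)"

lemma splits_append: "(u, v) \<in> set (splits p) \<Longrightarrow> u @ v = p"
  by (induction p arbitrary: u) auto

lemma sum_list_map_neutral: "(\<And>x. x \<in> set xs \<Longrightarrow> f x = 0) \<Longrightarrow> (\<Sum>x\<leftarrow>xs. f x) = (0 :: 'a::comm_monoid_add)"
  by (induction xs) auto

lemma sum_splits_only:
  assumes "\<And>u v. u @ v = p1 @ p2 \<Longrightarrow> length u \<noteq> length p1 \<Longrightarrow> f u v = (0 :: 'a::comm_monoid_add)"
  shows "(\<Sum>(u, v)\<leftarrow>splits (p1 @ p2). f u v) = f p1 p2"
  using assms
proof (induction p1 arbitrary: f)
  case Nil
  have "(\<Sum>(u, v)\<leftarrow>map (\<lambda>(u, v). (a # u, v)) (splits q). f u v) = 0" if "p2 = a # q" for a q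
    by (rule sum_list_map_neutral) (auto dest!: splits_append simp: that intro!: Nil)
  then show ?case by (cases p2) simp_all
next
  case (Cons a p1)
  have "f [] (a # p1 @ p2) = 0" by (rule Cons.prems) auto
  moreover have "(\<Sum>(u, v)\<leftarrow>splits (p1 @ p2). f (a # u) v) = f (a # p1) p2"
    by (rule Cons.IH) (rule Cons.prems, auto)
  ultimately show ?case by (simp add: o_def case_prod_unfold)
qed

lemma sum_splits_assoc:
  fixes f :: "'b list \<Rightarrow> 'b list \<Rightarrow> 'b list \<Rightarrow> 'a::comm_monoid_add"
  shows "(\<Sum>(r, w)\<leftarrow>splits p. \<Sum>(u, v)\<leftarrow>splits r. f u v w) = (\<Sum>(u, r)\<leftarrow>splits p. \<Sum>(v, w)\<leftarrow>splits r. f u v w)"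
proof (induction p arbitrary: f)
  case (Cons a p)
  show ?case
    using Cons.IH[of "\<lambda>u. f (a # u)"]
    by (simp add: o_def case_prod_unfold sum_list_addf add.assoc)
qed simp

locale localized_model =
  fixes emb :: "'k::field \<Rightarrow> 'a::field" and X :: "'a set"
  assumes finite_X [simp]: "finite X"
    and emb_add: "emb (c + d) = emb c + emb d"
    and emb_mult: "emb (c * d) = emb c * emb d"
    and emb_1 [simp]: "emb 1 = 1"
begin

abbreviation "valid \<equiv> valid_path X"

definition weight :: "'a set \<Rightarrow> int" where "weight S = int (card S) - int (card (X - S))"

definition eta_coeff :: "'a set \<Rightarrow> 'a \<Rightarrow> 'a" where "eta_coeff S i = 1 / (\<Prod>j\<in>X - S - {i}. i - j)"
definition eps_coeff :: "'a set \<Rightarrow> 'a \<Rightarrow> 'a" where "eps_coeff S i = (\<Prod>j\<in>S. i - j)"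
definition eta'_coeff :: "'a set \<Rightarrow> 'a \<Rightarrow> 'a" where "eta'_coeff S i = 1 / (\<Prod>j\<in>S - {i}. i - j)"
definition eps'_coeff :: "'a set \<Rightarrow> 'a \<Rightarrow> 'a" where "eps'_coeff S i = (\<Prod>j\<in>X - S. i - j)"

fun gen_sem :: "gen \<Rightarrow> 'a set \<Rightarrow> ('a path \<Rightarrow> 'a) \<Rightarrow> 'a path \<Rightarrow> 'a" where
  "gen_sem (Xi l) S \<phi> p = snd (p ! 0) * \<phi> p"
| "gen_sem (Xi' l) S \<phi> p = snd (p ! 0) * \<phi> p"
| "gen_sem (Tau l) S \<phi> p = (\<phi> p + \<phi> [p ! 1, p ! 0]) / (snd (p ! 0) - snd (p ! 1))"
| "gen_sem (Tau' l) S \<phi> p = (\<phi> p + \<phi> [p ! 1, p ! 0]) / (snd (p ! 1) - snd (p ! 0))"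
| "gen_sem (Eta l) S \<phi> p = (\<Sum>i\<in>X - S. eta_coeff S i * \<phi> [(\<F>, i), (\<E>, i)])"
| "gen_sem (Eps l) S \<phi> p = (if snd (p ! 0) = snd (p ! 1) then eps_coeff S (snd (p ! 0)) * \<phi> [] else 0)"
| "gen_sem (Eta' l) S \<phi> p = (\<Sum>i\<in>S. eta'_coeff S i * \<phi> [(\<E>, i), (\<F>, i)])"
| "gen_sem (Eps' l) S \<phi> p = (if snd (p ! 0) = snd (p ! 1) then eps'_coeff S (snd (p ! 0)) * \<phi> [] else 0)"

text \<open>
  2-morphisms act on functions on paths, by the transposes of their matrices; hence the reversed
  order in vertical composition.  In this form \<open>sem\<close> needs no finiteness of the set of paths and is
  defined on all terms, as it must be because the linear axioms are imposed on ill-typed terms too.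
\<close>

primrec sem :: "'k tm \<Rightarrow> 'a set \<Rightarrow> ('a path \<Rightarrow> 'a) \<Rightarrow> 'a path \<Rightarrow> 'a" where
  "sem Zero S \<phi> p = 0"
| "sem (Gen g) S \<phi> p =
     (if valid S p \<and> weight S = gen_wt g \<and> map fst p = gen_dom g then gen_sem g S \<phi> p else 0)"
| "sem (Id w m) S \<phi> p = (if valid S p \<and> weight S = m \<and> map fst p = w then \<phi> p else 0)"
| "sem (Add s t) S \<phi> p = sem s S \<phi> p + sem t S \<phi> p"
| "sem (Scl c t) S \<phi> p = emb c * sem t S \<phi> p"
| "sem (VC s t) S \<phi> p = sem t S (sem s S \<phi>) p"
| "sem (HC s t) S \<phi> p =
     (\<Sum>(p1, p2)\<leftarrow>splits p. sem t S (\<lambda>q2. sem s (path_end S p2) (\<lambda>q1. \<phi> (q1 @ q2)) p1) p2)"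

lemma emb_0 [simp]: "emb 0 = 0" by (metis add.right_neutral add_left_cancel emb_add)
lemma emb_uminus: "emb (- c) = - emb c" using emb_add[of "- c" c] by (simp add: eq_neg_iff_add_eq_0)

lemma sem_add: "sem t S (\<lambda>q. \<phi> q + \<psi> q) p = sem t S \<phi> p + sem t S \<psi> p"
proof (induction t arbitrary: S \<phi> \<psi> p)
  case (Gen g) show ?case
    by (cases g) (auto simp: algebra_simps add_divide_distrib sum.distrib)
next
  case (VC s t)
  have "sem s S (\<lambda>q. \<phi> q + \<psi> q) = (\<lambda>q. sem s S \<phi> q + sem s S \<psi> q)" by (rule ext) (rule VC)
  then show ?case by (simp add: VC)
qed (simp_all add: algebra_simps sum_list_addf case_prod_unfold)

lemma sem_mult: "sem t S (\<lambda>q. c * \<phi> q) p = c * sem t S \<phi> p"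
proof (induction t arbitrary: S \<phi> p)
  case (Gen g) show ?case
    by (cases g) (auto simp: algebra_simps add_divide_distrib sum_distrib_left)
next
  case (VC s t)
  have "sem s S (\<lambda>q. c * \<phi> q) = (\<lambda>q. c * sem s S \<phi> q)" by (rule ext) (rule VC)
  then show ?case by (simp add: VC)
qed (simp_all add: algebra_simps sum_list_const_mult case_prod_unfold)

lemma sem_zero [simp]: "sem t S (\<lambda>q. 0) p = 0"
  using sem_mult[of t S 0 "\<lambda>q. 0" p] by simp

lemma sem_sum_list: "sem t S (\<lambda>q. \<Sum>x\<leftarrow>xs. f x q) p = (\<Sum>x\<leftarrow>xs. sem t S (f x) p)"
  by (induction xs) (simp_all add: sem_add)

lemma sem_linear_commute:
  assumes add: "\<And>f g. L (\<lambda>q. f q + g q) = L f + L g" and mult: "\<And>c f. L (\<lambda>q. c * f q) = c * L f"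
  shows "L (\<lambda>q1. sem t S (F q1) p) = sem t S (\<lambda>q2. L (\<lambda>q1. F q1 q2)) p"
proof -
  have zero: "L (\<lambda>q. 0) = 0" using mult[of 0 "\<lambda>q. 0"] by simp
  have sum_list: "L (\<lambda>q. \<Sum>x\<leftarrow>xs. f x q) = (\<Sum>x\<leftarrow>xs. L (f x))" for f and xs :: "'c list"
    by (induction xs) (simp_all add: zero add)
  have sum: "L (\<lambda>q. \<Sum>x\<in>I. f x q) = (\<Sum>x\<in>I. L (f x))" for f and I :: "'c set"
    by (induction I rule: infinite_finite_induct) (simp_all add: zero add)
  have divide: "L (\<lambda>q. f q / c) = L f / c" for f c
    using mult[of "1 / c" f] by simp
  show ?thesis
  proof (induction t arbitrary: S F p)
    case (Gen g) show ?case
      by (cases g) (auto simp: zero add mult sum divide)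
  qed (auto simp add: zero add mult sum_list case_prod_unfold)
qed

lemma sem_commute:
  "sem s S (\<lambda>q1. sem t T (F q1) p2) p1 = sem t T (\<lambda>q2. sem s S (\<lambda>q1. F q1 q2) p1) p2"
  by (rule sem_linear_commute) (simp_all add: sem_add sem_mult)

lemma path_end_append: "path_end S (p @ q) = path_end (path_end S q) p"
  by (induction S p rule: path_end.induct) auto

lemma valid_subset: "valid S p \<Longrightarrow> S \<subseteq> X"
  by (induction X S p rule: valid_path.induct) auto

lemma path_end_subset: "valid S p \<Longrightarrow> path_end S p \<subseteq> X"
  by (induction X S p rule: valid_path.induct) auto

lemma valid_append: "valid S (p @ q) \<longleftrightarrow> valid S q \<and> valid (path_end S q) p"
proof (induction p)
  case Nil then show ?case using path_end_subset by auto
next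
  case (Cons a p)
  obtain c i where "a = (c, i)" by force
  then show ?case using Cons by (cases c) (auto simp: path_end_append)
qed

lemma weight_insert: "i \<in> X \<Longrightarrow> i \<notin> S \<Longrightarrow> S \<subseteq> X \<Longrightarrow> weight (insert i S) = weight S + 2"
  and weight_remove: "i \<in> S \<Longrightarrow> S \<subseteq> X \<Longrightarrow> weight (S - {i}) = weight S - 2"
proof -
  have *: "weight (insert i S) = weight S + 2" if "i \<in> X" "i \<notin> S" "S \<subseteq> X" for i S
  proof -
    have "finite S" using that by (auto intro: finite_subset[OF _ finite_X])
    moreover have "X - S = insert i (X - insert i S)" using that by auto
    then have "card (X - S) = Suc (card (X - insert i S))"
      by (metis DiffD2 card_insert_disjoint finite_Diff finite_X insertI1)
    ultimately show ?thesis using that by (simp add: weight_def)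
  qed
  show "i \<in> X \<Longrightarrow> i \<notin> S \<Longrightarrow> S \<subseteq> X \<Longrightarrow> weight (insert i S) = weight S + 2" by (rule *)
  show "i \<in> S \<Longrightarrow> S \<subseteq> X \<Longrightarrow> weight (S - {i}) = weight S - 2"
    using *[of i "S - {i}"] by (auto simp: insert_absorb subset_iff)
qed

lemma weight_path_end: "valid S p \<Longrightarrow> weight (path_end S p) = weight S + wt (map fst p)"
proof (induction p)
  case (Cons a p)
  obtain c i where "a = (c, i)" by force
  then show ?case using Cons path_end_subset[of S p]
    by (cases c) (auto simp: weight_insert weight_remove)
qed simp

lemma sem_typed_zero:
  "typed t l u v \<Longrightarrow> \<not> (weight S = l \<and> map fst p = u \<and> valid S p) \<Longrightarrow> sem t S \<phi> p = 0"
proof (induction t arbitrary: l u v S p \<phi>)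
  case (VC s t)
  then show ?case by (auto 4 3)
next
  case (HC s t)
  then obtain u1 u2 v1 v2 where st: "u = u1 @ u2" "typed s (l + wt u2) u1 v1" "typed t l u2 v2" by auto
  show ?case unfolding sem.simps
  proof (rule sum_list_map_neutral, clarify)
    fix p1 p2 assume "(p1, p2) \<in> set (splits p)"
    then have p: "p = p1 @ p2" by (simp add: splits_append)
    show "sem t S (\<lambda>q2. sem s (path_end S p2) (\<lambda>q1. \<phi> (q1 @ q2)) p1) p2 = 0"
    proof (cases "weight S = l \<and> map fst p2 = u2 \<and> valid S p2")
      case True
      then have "\<not> (weight (path_end S p2) = l + wt u2 \<and> map fst p1 = u1 \<and> valid (path_end S p2) p1)"
        using HC.prems(2) by (auto simp: p st valid_append)
      then show ?thesis by (simp add: HC.IH(1)[OF st(2)])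
    qed (rule HC.IH(2)[OF st(3)])
  qed
qed auto

lemma sem_HC_typed:
  assumes "typed s (l + wt u2) u1 v1" "typed t l u2 v2" "length p1 = length u1"
  shows "sem (s \<star> t) S \<phi> (p1 @ p2) = sem t S (\<lambda>q2. sem s (path_end S p2) (\<lambda>q1. \<phi> (q1 @ q2)) p1) p2"
  unfolding sem.simps
proof (rule sum_splits_only)
  fix a b :: "'a path" assume "length a \<noteq> length p1"
  then have "sem s (path_end S b) (\<lambda>q1. \<phi> (q1 @ q2)) a = 0" for q2
    using assms by (intro sem_typed_zero) auto
  then show "sem t S (\<lambda>q2. sem s (path_end S b) (\<lambda>q1. \<phi> (q1 @ q2)) a) b = 0" by simp
qed

lemma sem_typed_local:
  assumes "typed t l u v"
    and "\<And>q. valid S q \<Longrightarrow> map fst q = v \<Longrightarrow> path_end S q = path_end S p \<Longrightarrow> \<phi> q = \<psi> q"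
  shows "sem t S \<phi> p = sem t S \<psi> p"
  using assms
proof (induction t arbitrary: l u v S p \<phi> \<psi>)
  case (Gen g)
  show ?case
  proof (cases "valid S p \<and> map fst p = gen_dom g")
    case True
    then have S: "S \<subseteq> X" using valid_subset by auto
    have g: "v = gen_cod g" using Gen.prems by simp
    show ?thesis
    proof (cases g)
      case (Xi l) then show ?thesis using True g Gen.prems(2)[of p] by simp
    next
      case (Xi' l) then show ?thesis using True g Gen.prems(2)[of p] by simp
    next
      case (Tau l)
      then obtain i j where "p = [(\<E>, i), (\<E>, j)]" using True by (auto simp: map_eq_Cons_conv)
      then show ?thesis using True g Tau Gen.prems(2)[of p] Gen.prems(2)[of "[(\<E>, j), (\<E>, i)]"]
        by (auto simp: insert_commute)
    next
      case (Tau' l)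
      then obtain i j where "p = [(\<F>, i), (\<F>, j)]" using True by (auto simp: map_eq_Cons_conv)
      then show ?thesis using True g Tau' Gen.prems(2)[of p] Gen.prems(2)[of "[(\<F>, j), (\<F>, i)]"]
        by (auto simp: Diff_insert[symmetric] insert_commute)
    next
      case (Eta l)
      then have "p = []" using True by simp
      then have "\<phi> [(\<F>, i), (\<E>, i)] = \<psi> [(\<F>, i), (\<E>, i)]" if "i \<in> X - S" for i
        using that g Eta S by (intro Gen.prems(2)) auto
      then have "(\<Sum>i\<in>X - S. eta_coeff S i * \<phi> [(\<F>, i), (\<E>, i)]) = (\<Sum>i\<in>X - S. eta_coeff S i * \<psi> [(\<F>, i), (\<E>, i)])"
        by (intro sum.cong) auto
      then show ?thesis using Eta S by simp
    next
      case (Eta' l)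
      then have "p = []" using True by simp
      then have "\<phi> [(\<E>, i), (\<F>, i)] = \<psi> [(\<E>, i), (\<F>, i)]" if "i \<in> S" for i
        using that g Eta' S by (intro Gen.prems(2)) auto
      then have "(\<Sum>i\<in>S. eta'_coeff S i * \<phi> [(\<E>, i), (\<F>, i)]) = (\<Sum>i\<in>S. eta'_coeff S i * \<psi> [(\<E>, i), (\<F>, i)])"
        by (intro sum.cong) auto
      then show ?thesis using Eta' S by simp
    next
      case (Eps l)
      then obtain i j where "p = [(\<F>, i), (\<E>, j)]" using True by (auto simp: map_eq_Cons_conv)
      then show ?thesis using True g Eps S Gen.prems(2)[of "[]"] by auto
    next
      case (Eps' l)
      then obtain i j where p: "p = [(\<E>, i), (\<F>, j)]" using True by (auto simp: map_eq_Cons_conv)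
      then have "j \<in> S" using True by simp
      then have "path_end S p = S" if "i = j" using that unfolding p by auto
      then have "\<phi> [] = \<psi> []" if "i = j"
        using that g Eps' S Gen.prems(2)[of "[]"] by auto
      then show ?thesis unfolding Eps' sem.simps gen_sem.simps by (cases "i = j") (simp_all add: p)
    qed
  qed auto
next
  case (VC s t)
  then obtain w where st: "typed s l w v" "typed t l u w" by auto
  have "sem t S (sem s S \<phi>) p = sem t S (sem s S \<psi>) p"
  proof (rule VC.IH(2)[OF st(2)])
    fix q assume "path_end S q = path_end S p"
    then show "sem s S \<phi> q = sem s S \<psi> q" using VC.prems(2) by (intro VC.IH(1)[OF st(1)]) auto
  qed
  then show ?case by simp
next
  case (HC s t)
  then obtain u1 u2 v1 v2 where st: "v = v1 @ v2" "typed s (l + wt u2) u1 v1" "typed t l u2 v2" by auto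
  show ?case unfolding sem.simps
  proof (rule arg_cong[of _ _ sum_list], rule map_cong[OF HOL.refl], clarify)
    fix p1 p2 assume "(p1, p2) \<in> set (splits p)"
    then have p: "p = p1 @ p2" by (simp add: splits_append)
    show "sem t S (\<lambda>q2. sem s (path_end S p2) (\<lambda>q1. \<phi> (q1 @ q2)) p1) p2
        = sem t S (\<lambda>q2. sem s (path_end S p2) (\<lambda>q1. \<psi> (q1 @ q2)) p1) p2"
    proof (rule HC.IH(2)[OF st(3)])
      fix q2 assume q2: "valid S q2" "map fst q2 = v2" "path_end S q2 = path_end S p2"
      show "sem s (path_end S p2) (\<lambda>q1. \<phi> (q1 @ q2)) p1 = sem s (path_end S p2) (\<lambda>q1. \<psi> (q1 @ q2)) p1"
      proof (rule HC.IH(1)[OF st(2)])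
        fix q1 assume "valid (path_end S p2) q1" "map fst q1 = v1" "path_end (path_end S p2) q1 = path_end (path_end S p2) p1"
        then show "\<phi> (q1 @ q2) = \<psi> (q1 @ q2)"
          using q2 by (intro HC.prems(2)) (auto simp: valid_append path_end_append p st)
      qed
    qed
  qed
next
  case (Id w m)
  then show ?case using Id.prems(2)[of p] by simp
next
  case (Add s t)
  then have st: "typed s l u v" "typed t l u v" by auto
  show ?case unfolding sem.simps using Add.IH(1)[OF st(1) Add.prems(2)] Add.IH(2)[OF st(2) Add.prems(2)] by simp
next
  case (Scl c t)
  then have t: "typed t l u v" by auto
  show ?case unfolding sem.simps using Scl.IH[OF t Scl.prems(2)] by simp
qed simp

lemma sem_typed_ext:
  assumes "typed s l u v" "typed t l u v"
    and "\<And>S \<phi> p. weight S = l \<Longrightarrow> map fst p = u \<Longrightarrow> valid S p \<Longrightarrow> sem s S \<phi> p = sem t S \<phi> p"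
  shows "sem s = sem t"
proof (intro ext)
  fix S \<phi> p
  show "sem s S \<phi> p = sem t S \<phi> p"
    using assms(3) sem_typed_zero[OF assms(1)] sem_typed_zero[OF assms(2)] by metis
qed

lemma sem_VC_Id_left: assumes "typed t l u v" shows "sem (Id v l \<bullet> t) = sem t"
proof (rule sem_typed_ext)
  show "typed (Id v l \<bullet> t) l u v" "typed t l u v" using assms by auto
  fix S \<phi> p assume *: "weight S = l"
  show "sem (Id v l \<bullet> t) S \<phi> p = sem t S \<phi> p"
    by (simp, rule sem_typed_local[OF assms]) (simp add: *)
qed

lemma sem_VC_Id_right: assumes "typed t l u v" shows "sem (t \<bullet> Id u l) = sem t"
  by (rule sem_typed_ext[where u = u and v = v]) (use assms in auto)

lemma sem_HC_Id_left: assumes "typed t l u v" shows "sem (Id [] (l + wt u) \<star> t) = sem t"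
proof (rule sem_typed_ext)
  show t: "typed (Id [] (l + wt u) \<star> t) l u v" "typed t l u v" using assms by auto
  fix S \<phi> p assume *: "weight S = l" "map fst p = u" "valid S p"
  have "sem (Id [] (l + wt u) \<star> t) S \<phi> ([] @ p) = sem t S (\<lambda>q2. sem (Id [] (l + wt u)) (path_end S p) (\<lambda>q1. \<phi> (q1 @ q2)) []) p"
    by (rule sem_HC_typed[OF _ assms]) auto
  then show "sem (Id [] (l + wt u) \<star> t) S \<phi> p = sem t S \<phi> p"
    using * weight_path_end[of S p] path_end_subset[of S p] by simp
qed

lemma sem_HC_Id_right: assumes "typed t l u v" shows "sem (t \<star> Id [] l) = sem t"
proof (rule sem_typed_ext)
  show t: "typed (t \<star> Id [] l) l u v" "typed t l u v" using assms by auto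
  fix S \<phi> p assume *: "weight S = l" "map fst p = u" "valid S p"
  have "sem (t \<star> Id [] l) S \<phi> (p @ []) = sem (Id [] l) S (\<lambda>q2. sem t (path_end S []) (\<lambda>q1. \<phi> (q1 @ q2)) p) []"
    by (rule sem_HC_typed[where ?u2.0 = "[]" and ?v1.0 = v]) (use assms * in auto)
  then show "sem (t \<star> Id [] l) S \<phi> p = sem t S \<phi> p"
    using * valid_subset by simp
qed

lemma sem_HC_Id: "sem (Id u (l + wt v) \<star> Id v l) = sem (Id (u @ v) l)"
proof (rule sem_typed_ext)
  show "typed (Id u (l + wt v) \<star> Id v l) l (u @ v) (u @ v)" "typed (Id (u @ v) l) l (u @ v) (u @ v)" by auto
  fix S \<phi> p assume *: "weight S = l" "map fst p = u @ v" "valid S p"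
  then obtain p1 p2 where p: "p = p1 @ p2" "map fst p1 = u" "map fst p2 = v" by (auto simp: map_eq_append_conv)
  have "sem (Id u (l + wt v) \<star> Id v l) S \<phi> (p1 @ p2)
     = sem (Id v l) S (\<lambda>q2. sem (Id u (l + wt v)) (path_end S p2) (\<lambda>q1. \<phi> (q1 @ q2)) p1) p2"
    by (rule sem_HC_typed[where ?u1.0 = u]) (use p in auto)
  then show "sem (Id u (l + wt v) \<star> Id v l) S \<phi> p = sem (Id (u @ v) l) S \<phi> p"
    using * p weight_path_end[of S p2] by (auto simp: valid_append)
qed

lemma sem_HC_assoc: "sem ((s \<star> t) \<star> r) = sem (s \<star> (t \<star> r))"
proof (intro ext)
  fix S \<phi> p
  define f where "f u v w = sem r S (\<lambda>q3. sem t (path_end S w) (\<lambda>q2. sem s (path_end (path_end S w) v)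
    (\<lambda>q1. \<phi> (q1 @ q2 @ q3)) u) v) w" for u v w
  have "sem ((s \<star> t) \<star> r) S \<phi> p = (\<Sum>(x, w)\<leftarrow>splits p. \<Sum>(u, v)\<leftarrow>splits x. f u v w)"
    by (simp add: f_def case_prod_unfold sem_sum_list)
  also have "\<dots> = (\<Sum>(u, x)\<leftarrow>splits p. \<Sum>(v, w)\<leftarrow>splits x. f u v w)" by (rule sum_splits_assoc)
  also have "\<dots> = sem (s \<star> (t \<star> r)) S \<phi> p" unfolding sem.simps
  proof (intro arg_cong[of _ _ sum_list] map_cong HOL.refl, clarify)
    fix u x :: "'a path"
    have "path_end (path_end S w) v = path_end S x" if "(v, w) \<in> set (splits x)" for v w
      using that by (simp add: path_end_append[symmetric] splits_append)
    then show "(\<Sum>(v, w)\<leftarrow>splits x. f u v w) = (\<Sum>(p1, p2)\<leftarrow>splits x. sem r S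
        (\<lambda>q2. sem t (path_end S p2) (\<lambda>q1. sem s (path_end S x) (\<lambda>q1a. \<phi> (q1a @ q1 @ q2)) u) p1) p2)"
      unfolding f_def by (intro arg_cong[of _ _ sum_list] map_cong HOL.refl) auto
  qed
  finally show "sem ((s \<star> t) \<star> r) S \<phi> p = sem (s \<star> (t \<star> r)) S \<phi> p" .
qed

lemma sem_interchange:
  assumes "typed s (l + wt u2) u1 v1" "typed s' (l + wt u2) v1 w1" "typed t l u2 v2" "typed t' l v2 w2"
  shows "sem ((s' \<bullet> s) \<star> (t' \<bullet> t)) = sem ((s' \<star> t') \<bullet> (s \<star> t))"
proof (rule sem_typed_ext)
  have wt: "wt u2 = wt v2" using typed_wt assms(3) by blast
  then have s': "typed s' (l + wt v2) v1 w1" using assms by simp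
  show "typed ((s' \<bullet> s) \<star> (t' \<bullet> t)) l (u1 @ u2) (w1 @ w2)" using assms by simp blast
  show "typed ((s' \<star> t') \<bullet> (s \<star> t)) l (u1 @ u2) (w1 @ w2)"
  proof -
    have "typed (s' \<star> t') l (v1 @ v2) (w1 @ w2)" using assms s' by simp blast
    moreover have "typed (s \<star> t) l (u1 @ u2) (v1 @ v2)" using assms by simp blast
    ultimately show ?thesis unfolding typed.simps(6) by blast
  qed
  fix S \<phi> p assume *: "weight S = l" "map fst p = u1 @ u2" "valid S p"
  then obtain p1 p2 where p: "p = p1 @ p2" "map fst p1 = u1" "map fst p2 = u2" by (auto simp: map_eq_append_conv)
  have len: "length p1 = length u1" using p by auto
  have "sem ((s' \<bullet> s) \<star> (t' \<bullet> t)) S \<phi> p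
     = sem (t' \<bullet> t) S (\<lambda>q2. sem (s' \<bullet> s) (path_end S p2) (\<lambda>q1. \<phi> (q1 @ q2)) p1) p2"
    unfolding p by (rule sem_HC_typed[OF _ _ len]) (use assms in auto)
  also have "\<dots> = sem t S (\<lambda>q. sem s (path_end S p2) (\<lambda>r. sem t' S
      (\<lambda>q2. sem s' (path_end S p2) (\<lambda>q1. \<phi> (q1 @ q2)) r) q) p1) p2"
  proof -
    have "sem t' S (\<lambda>q2. sem s (path_end S p2) (sem s' (path_end S p2) (\<lambda>q1. \<phi> (q1 @ q2))) p1)
       = (\<lambda>q. sem s (path_end S p2) (\<lambda>r. sem t' S (\<lambda>q2. sem s' (path_end S p2) (\<lambda>q1. \<phi> (q1 @ q2)) r) q) p1)"
      by (rule ext, rule sem_commute[symmetric])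
    then show ?thesis by simp
  qed
  also have "\<dots> = sem t S (\<lambda>q. sem s (path_end S p2) (\<lambda>r. sem (s' \<star> t') S \<phi> (r @ q)) p1) p2"
  proof (rule sem_typed_local[OF assms(3)])
    fix q assume q: "path_end S q = path_end S p2"
    show "sem s (path_end S p2) (\<lambda>r. sem t' S (\<lambda>q2. sem s' (path_end S p2) (\<lambda>q1. \<phi> (q1 @ q2)) r) q) p1
        = sem s (path_end S p2) (\<lambda>r. sem (s' \<star> t') S \<phi> (r @ q)) p1"
    proof (rule sem_typed_local[OF assms(1)])
      fix r :: "'a path" assume "map fst r = v1"
      then have "length r = length v1" by auto
      then show "sem t' S (\<lambda>q2. sem s' (path_end S p2) (\<lambda>q1. \<phi> (q1 @ q2)) r) q = sem (s' \<star> t') S \<phi> (r @ q)"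
        by (subst sem_HC_typed[OF s' assms(4)]) (simp_all add: q)
    qed
  qed
  also have "\<dots> = sem (s \<star> t) S (sem (s' \<star> t') S \<phi>) p"
    unfolding p by (rule sem_HC_typed[OF assms(1,3) len, symmetric])
  finally show "sem ((s' \<bullet> s) \<star> (t' \<bullet> t)) S \<phi> p = sem ((s' \<star> t') \<bullet> (s \<star> t)) S \<phi> p" by simp
qed

lemma sem_neg [simp]: "sem (neg t) S \<phi> p = - sem t S \<phi> p"
  by (simp add: neg_def emb_uminus)

lemma sem_Sums: "sem (Sums ts) S \<phi> p = (\<Sum>t\<leftarrow>ts. sem t S \<phi> p)"
  by (induction ts) (simp_all add: Sums_def)

lemma sem_unapplied:
  "sem (s \<boxplus> t) S \<phi> = (\<lambda>p. sem s S \<phi> p + sem t S \<phi> p)"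
  "sem (c \<cdot> t) S \<phi> = (\<lambda>p. emb c * sem t S \<phi> p)"
  "sem (s \<bullet> t) S \<phi> = sem t S (sem s S \<phi>)"
  by (rule ext, simp)+

theorem sem_eqv:
  assumes rel: "\<And>s t. rel s t \<Longrightarrow> sem s = sem t" and "s \<simeq> t"
  shows "sem s = sem t"
  using assms(2)
proof (induction rule: eqv.induct)
  case (cong_Add s s' t t') then show ?case by (intro ext) simp
next
  case (cong_Scl t t' c) then show ?case by (intro ext) simp
next
  case (cong_VC s s' t t') then show ?case by (intro ext) simp
next
  case (cong_HC s s' t t') then show ?case by (intro ext) simp
next
  case (rel s t) then show ?case by (rule assms(1))
next
  case (VC_idl t l u v) then show ?case by (rule sem_VC_Id_left)
next
  case (VC_idr t l u v) then show ?case by (rule sem_VC_Id_right)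
next
  case (HC_idl t l u v) then show ?case by (rule sem_HC_Id_left)
next
  case (HC_idr t l u v) then show ?case by (rule sem_HC_Id_right)
next
  case (HC_id u l v) show ?case by (rule sem_HC_Id)
next
  case (HC_assoc s t r) show ?case by (rule sem_HC_assoc)
next
  case (interchange s l u2 u1 v1 s' w1 t v2 t' w2) then show ?case by (rule sem_interchange)
qed (simp_all add: fun_eq_iff sem_unapplied emb_add emb_mult algebra_simps sem_add sem_mult sum_list_addf
    sum_list_const_mult case_prod_unfold)

end

lemma typed_gens:
  "typed (xi l) l [\<E>] [\<E>]" "typed (xi' l) l [\<F>] [\<F>]"
  "typed (tau l) l [\<E>, \<E>] [\<E>, \<E>]" "typed (tau' l) l [\<F>, \<F>] [\<F>, \<F>]"
  "typed (eta l) l [] [\<F>, \<E>]" "typed (eps l) l [\<F>, \<E>] []"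
  "typed (eta' l) l [] [\<E>, \<F>]" "typed (eps' l) l [\<E>, \<F>] []" "typed (Id w l) l w w"
  by simp_all

lemma typed_VC: "typed s l v w \<Longrightarrow> typed t l u v \<Longrightarrow> typed (s \<bullet> t) l u w" by auto
lemma typed_HC:
  "typed s m u1 v1 \<Longrightarrow> typed t l u2 v2 \<Longrightarrow> m = l + wt u2 \<Longrightarrow> u = u1 @ u2 \<Longrightarrow> v = v1 @ v2
    \<Longrightarrow> typed (s \<star> t) l u v" by auto
lemma typed_Add: "typed s l u v \<Longrightarrow> typed t l u v \<Longrightarrow> typed (s \<boxplus> t) l u v" by auto
lemma typed_neg: "typed t l u v \<Longrightarrow> typed (neg t) l u v" by (simp add: neg_def)
lemmas typed_intros = typed_gens typed_VC typed_HC typed_Add typed_neg typed_xipow typed_xipow_F typed_F_xipow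
  typed_bubble_plus typed_bubble_minus

context localized_model
begin

lemma finite_subset_X: "S \<subseteq> X \<Longrightarrow> finite S" by (rule finite_subset[OF _ finite_X])

lemma sem_xipow:
  "sem (xipow n l) S \<phi> p = (if valid S p \<and> weight S = l \<and> map fst p = [\<E>] then snd (p ! 0) ^ nat n * \<phi> p else 0)"
proof -
  have "sem (((\<lambda>t. xi l \<bullet> t) ^^ m) (Id [\<E>] l)) S \<phi> p
     = (if valid S p \<and> weight S = l \<and> map fst p = [\<E>] then snd (p ! 0) ^ m * \<phi> p else 0)" for m \<phi>
    by (induction m arbitrary: \<phi>) auto
  then show ?thesis by (simp add: xipow_def)
qed

lemma residue_plus: "eta'_coeff S i * eps'_coeff S i = residue_at S (X - S) i"
  by (simp add: eta'_coeff_def eps'_coeff_def residue_at_def)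
lemma residue_minus: "eta_coeff S i * eps_coeff S i = residue_at (X - S) S i"
  by (simp add: eta_coeff_def eps_coeff_def residue_at_def)

lemma sem_real_bubble_plus:
  assumes "S \<subseteq> X" "weight S = l" "k \<ge> 1 - l"
  shows "sem (real_bubble_plus k l) S \<phi> [] = rat_coeff S (X - S) k * \<phi> []"
proof -
  have "sem (real_bubble_plus k l) S \<phi> [] = (\<Sum>i\<in>S. i ^ nat (k + l - 1) * residue_at S (X - S) i) * \<phi> []"
    using assms(1,2)
    by (auto simp: real_bubble_plus_def xipow_F_def sem_xipow weight_remove insert_absorb sum_distrib_right sum_distrib_left
        mult_ac subset_iff simp flip: residue_plus intro!: sum.cong)
  also have "\<dots> = rat_coeff S (X - S) k * \<phi> []"
    using residue_sum[of S "X - S" "nat (k + l - 1)"] assms finite_subset_X[of S]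
    by (simp add: weight_def algebra_simps)
  finally show ?thesis .
qed

lemma sem_real_bubble_minus:
  assumes "S \<subseteq> X" "weight S = l" "k \<ge> 1 + l"
  shows "sem (real_bubble_minus k l) S \<phi> [] = rat_coeff (X - S) S k * \<phi> []"
proof -
  have "sem (real_bubble_minus k l) S \<phi> [] = (\<Sum>i\<in>X - S. i ^ nat (k - l - 1) * residue_at (X - S) S i) * \<phi> []"
    using assms(1,2)
    by (auto simp: real_bubble_minus_def F_xipow_def sem_xipow weight_insert sum_distrib_right sum_distrib_left
        mult_ac subset_iff simp flip: residue_minus intro!: sum.cong)
  also have "\<dots> = rat_coeff (X - S) S k * \<phi> []"
    using residue_sum[of "X - S" S "nat (k - l - 1)"] assms finite_subset_X[of S]
    by (simp add: weight_def algebra_simps)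
  finally show ?thesis .
qed

lemma rat_coeff_recursion:
  assumes "k > 0"
  shows "rat_coeff A B (int k) = - (\<Sum>j<k. rat_coeff A B (int j) * rat_coeff B A (int k - int j))"
proof -
  have "(\<Sum>j<Suc k. rat_coeff A B (int j) * rat_coeff B A (int k - int j)) = 0"
    using rat_coeff_convolution[of A B "int k"] assms
    by (simp add: sum_int_atLeastAtMost_0 nat_add_distrib)
  then show ?thesis by (simp add: eq_neg_iff_add_eq_0 add.commute)
qed

lemma sem_fake_bubble_plus:
  assumes "S \<subseteq> X" "weight S = l" "int k < 1 - l"
  shows "sem (fake_bubble_plus k l) S \<phi> [] = rat_coeff S (X - S) k * \<phi> []"
  using assms(3)
proof (induction k arbitrary: \<phi> rule: less_induct)
  case (less k)
  show ?case
  proof (cases "k = 0")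
    case True then show ?thesis using assms by (subst fake_bubble_plus.simps) simp
  next
    case False
    have "sem (fake_bubble_plus k l) S \<phi> [] = - (\<Sum>a\<leftarrow>[0..<k]. rat_coeff (X - S) S (int k - int a) * (rat_coeff S (X - S) a * \<phi> []))"
      using less False assms
      by (subst fake_bubble_plus.simps) (auto simp: sem_Sums o_def sem_real_bubble_minus intro!: arg_cong[of _ _ sum_list])
    then show ?thesis
      using False by (simp add: rat_coeff_recursion[of k] sum_distrib_right sum_distrib_left sum_list_distinct_conv_sum_set mult_ac
          atLeast0LessThan)
  qed
qed

lemma sem_fake_bubble_minus:
  assumes "S \<subseteq> X" "weight S = l" "int k < 1 + l"
  shows "sem (fake_bubble_minus k l) S \<phi> [] = rat_coeff (X - S) S k * \<phi> []"
  using assms(3)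
proof (induction k arbitrary: \<phi> rule: less_induct)
  case (less k)
  show ?case
  proof (cases "k = 0")
    case True then show ?thesis using assms by (subst fake_bubble_minus.simps) simp
  next
    case False
    have "sem (fake_bubble_minus k l) S \<phi> [] = - (\<Sum>a\<leftarrow>[0..<k]. rat_coeff (X - S) S a * (rat_coeff S (X - S) (int k - int a) * \<phi> []))"
      using less False assms
      by (subst fake_bubble_minus.simps) (auto simp: sem_Sums o_def sem_real_bubble_plus intro!: arg_cong[of _ _ sum_list])
    then show ?thesis
      using False by (simp add: rat_coeff_recursion[of k] sum_distrib_right sum_distrib_left sum_list_distinct_conv_sum_set mult_ac
          atLeast0LessThan)
  qed
qed

lemma sem_bubble_plus [simp]:
  "sem (bubble_plus k l) S \<phi> p = (if p = [] \<and> S \<subseteq> X \<and> weight S = l then rat_coeff S (X - S) k * \<phi> [] else 0)"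
proof (cases "p = [] \<and> S \<subseteq> X \<and> weight S = l")
  case True then show ?thesis by (auto simp: bubble_plus_def sem_real_bubble_plus sem_fake_bubble_plus)
next
  case False
  then have "sem (bubble_plus k l) S \<phi> p = 0" by (intro sem_typed_zero[OF typed_bubble_plus]) auto
  then show ?thesis using False by auto
qed

lemma sem_bubble_minus [simp]:
  "sem (bubble_minus k l) S \<phi> p = (if p = [] \<and> S \<subseteq> X \<and> weight S = l then rat_coeff (X - S) S k * \<phi> [] else 0)"
proof (cases "p = [] \<and> S \<subseteq> X \<and> weight S = l")
  case True then show ?thesis by (auto simp: bubble_minus_def sem_real_bubble_minus sem_fake_bubble_minus)
next
  case False
  then have "sem (bubble_minus k l) S \<phi> p = 0" by (intro sem_typed_zero[OF typed_bubble_minus]) auto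
  then show ?thesis using False by auto
qed

lemma adj_coeff:
  assumes "i \<in> X" "i \<notin> S" "S \<subseteq> X"
  shows "eta_coeff S i * eps'_coeff (insert i S) i = 1" "eps_coeff S i * eta'_coeff (insert i S) i = 1"
proof -
  have "X - S - {i} = X - insert i S" by auto
  then show "eta_coeff S i * eps'_coeff (insert i S) i = 1"
    using assms by (simp add: eta_coeff_def eps'_coeff_def)
  have "insert i S - {i} = S" using assms by auto
  then show "eps_coeff S i * eta'_coeff (insert i S) i = 1"
    using assms finite_subset_X[OF assms(3)] by (auto simp: eps_coeff_def eta'_coeff_def)
qed

lemma sem_adj1: "sem ((eps' (l + 2) \<star> Id [\<E>] l) \<bullet> (Id [\<E>] l \<star> eta l)) = sem (Id [\<E>] l)"
  (is "sem ?L = _")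
proof (rule sem_typed_ext)
  show "typed ?L l [\<E>] [\<E>]" "typed (Id [\<E>] l) l [\<E>] [\<E>]"
    by (rule typed_intros | simp)+
  fix S \<phi> p assume *: "weight S = l" "map fst p = [\<E>]" "valid S p"
  then obtain i where p: "p = [(\<E>, i)]" "i \<in> X" "i \<notin> S" "S \<subseteq> X" by (auto simp: map_eq_Cons_conv)
  have "sem ?L S \<phi> p
    = (\<Sum>j\<in>X - S. if j = i then eta_coeff S j * eps'_coeff (insert j S) j * \<phi> p else 0)"
    using * p by (auto simp: weight_insert simp del: sum.delta sum.delta' intro!: sum.cong)
  then show "sem ?L S \<phi> p = sem (Id [\<E>] l) S \<phi> p"
    using * p by (simp add: adj_coeff)
qed

lemma sem_adj2: "sem ((Id [\<E>] l \<star> eps l) \<bullet> (eta' (l + 2) \<star> Id [\<E>] l)) = sem (Id [\<E>] l)"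
  (is "sem ?L = _")
proof (rule sem_typed_ext)
  show "typed ?L l [\<E>] [\<E>]" "typed (Id [\<E>] l) l [\<E>] [\<E>]"
    by (rule typed_intros | simp)+
  fix S \<phi> p assume *: "weight S = l" "map fst p = [\<E>]" "valid S p"
  then obtain i where p: "p = [(\<E>, i)]" "i \<in> X" "i \<notin> S" "S \<subseteq> X" by (auto simp: map_eq_Cons_conv)
  have "sem ?L S \<phi> p
    = (\<Sum>j\<in>insert i S. if j = i then eps_coeff S j * eta'_coeff (insert j S) j * \<phi> p else 0)"
    using * p by (auto simp: weight_insert simp del: sum.delta sum.delta' intro!: sum.cong)
  also have "\<dots> = \<phi> p" using * p by (subst sum.delta) (simp_all add: adj_coeff finite_subset_X)
  finally show "sem ?L S \<phi> p = sem (Id [\<E>] l) S \<phi> p"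
    using * by simp
qed

lemma adj_coeff_remove:
  assumes "i \<in> S" "S \<subseteq> X"
  shows "eta_coeff (S - {i}) i * eps'_coeff S i = 1" "eps_coeff (S - {i}) i * eta'_coeff S i = 1"
  using adj_coeff[of i "S - {i}"] assms by (auto simp: insert_absorb)

lemma sem_adj3: "sem ((eps (l - 2) \<star> Id [\<F>] l) \<bullet> (Id [\<F>] l \<star> eta' l)) = sem (Id [\<F>] l)"
  (is "sem ?L = _")
proof (rule sem_typed_ext)
  show "typed ?L l [\<F>] [\<F>]" "typed (Id [\<F>] l) l [\<F>] [\<F>]"
    by (rule typed_intros | simp)+
  fix S \<phi> p assume *: "weight S = l" "map fst p = [\<F>]" "valid S p"
  then obtain i where p: "p = [(\<F>, i)]" "i \<in> S" "S \<subseteq> X" by (auto simp: map_eq_Cons_conv)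
  then have i: "i \<in> X" by auto
  have "sem ?L S \<phi> p
    = (\<Sum>j\<in>S. if j = i then eps_coeff (S - {i}) i * eta'_coeff S i * \<phi> p else 0)"
    using * p i by (auto simp: weight_remove insert_absorb subset_iff simp del: sum.delta sum.delta' intro!: sum.cong)
  then show "sem ?L S \<phi> p = sem (Id [\<F>] l) S \<phi> p"
    using * p by (simp add: adj_coeff_remove finite_subset_X)
qed

lemma sem_adj4: "sem ((Id [\<F>] l \<star> eps' l) \<bullet> (eta (l - 2) \<star> Id [\<F>] l)) = sem (Id [\<F>] l)"
  (is "sem ?L = _")
proof (rule sem_typed_ext)
  show "typed ?L l [\<F>] [\<F>]" "typed (Id [\<F>] l) l [\<F>] [\<F>]"
    by (rule typed_intros | simp)+
  fix S \<phi> p assume *: "weight S = l" "map fst p = [\<F>]" "valid S p"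
  then obtain i where p: "p = [(\<F>, i)]" "i \<in> S" "S \<subseteq> X" by (auto simp: map_eq_Cons_conv)
  then have i: "i \<in> X" by auto
  have X: "X - (S - {i}) = insert i (X - S)" using i by auto
  have "sem ?L S \<phi> p
    = (\<Sum>j\<in>insert i (X - S). if j = i then eta_coeff (S - {i}) i * eps'_coeff S i * \<phi> p else 0)"
    using * p i by (auto simp: X weight_remove insert_absorb subset_iff simp del: sum.delta sum.delta' sum.insert intro!: sum.cong)
  then show "sem ?L S \<phi> p = sem (Id [\<F>] l) S \<phi> p"
    using * p i by (simp add: adj_coeff_remove)
qed

lemma sem_cyc_xi1: "sem (eps' l \<bullet> (xi (l - 2) \<star> Id [\<F>] l)) = sem (eps' l \<bullet> (Id [\<E>] (l - 2) \<star> xi' l))"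
  (is "sem ?L = _")
proof (rule sem_typed_ext)
  show "typed ?L l [\<E>, \<F>] []" "typed (eps' l \<bullet> (Id [\<E>] (l - 2) \<star> xi' l)) l [\<E>, \<F>] []"
    by (rule typed_intros | simp)+
  fix S \<phi> p assume *: "weight S = l" "map fst p = [\<E>, \<F>]" "valid S p"
  then obtain i j where p: "p = [(\<E>, j), (\<F>, i)]" "i \<in> S" "S \<subseteq> X" "j \<in> X" "j = i \<or> j \<notin> S"
    by (auto simp: map_eq_Cons_conv)
  from p(5) show "sem ?L S \<phi> p = sem (eps' l \<bullet> (Id [\<E>] (l - 2) \<star> xi' l)) S \<phi> p"
    using *(1) p(1-4) by (elim disjE) (simp_all add: weight_remove insert_absorb)
qed

lemma sem_cyc_xi2: "sem (eps l \<bullet> (xi' (l + 2) \<star> Id [\<E>] l)) = sem (eps l \<bullet> (Id [\<F>] (l + 2) \<star> xi l))"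
  (is "sem ?L = _")
proof (rule sem_typed_ext)
  show "typed ?L l [\<F>, \<E>] []" "typed (eps l \<bullet> (Id [\<F>] (l + 2) \<star> xi l)) l [\<F>, \<E>] []"
    by (rule typed_intros | simp)+
  fix S \<phi> p assume *: "weight S = l" "map fst p = [\<F>, \<E>]" "valid S p"
  then obtain i j where p: "p = [(\<F>, j), (\<E>, i)]" "i \<in> X" "i \<notin> S" "S \<subseteq> X" by (auto simp: map_eq_Cons_conv)
  show "sem ?L S \<phi> p = sem (eps l \<bullet> (Id [\<F>] (l + 2) \<star> xi l)) S \<phi> p"
    using * p by (auto simp: weight_insert)
qed

lemma eps'_coeff_remove: "a \<in> S \<Longrightarrow> S \<subseteq> X \<Longrightarrow> eps'_coeff (S - {a}) b = (b - a) * eps'_coeff S b"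
proof -
  assume "a \<in> S" "S \<subseteq> X"
  then have "X - (S - {a}) = insert a (X - S)" "a \<notin> X - S" by auto
  then show ?thesis by (simp add: eps'_coeff_def)
qed

lemma eps_coeff_insert: "a \<notin> S \<Longrightarrow> S \<subseteq> X \<Longrightarrow> eps_coeff (insert a S) b = (b - a) * eps_coeff S b"
  by (simp add: eps_coeff_def finite_subset_X)

lemma sem_cyc_tau1: "sem ((eps' l \<bullet> (Id [\<E>] (l - 2) \<star> eps' (l - 2) \<star> Id [\<F>] l)) \<bullet> (tau (l - 4) \<star> Id [\<F>, \<F>] l))
    = sem ((eps' l \<bullet> (Id [\<E>] (l - 2) \<star> eps' (l - 2) \<star> Id [\<F>] l)) \<bullet> (Id [\<E>, \<E>] (l - 4) \<star> tau' l))"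
  (is "sem ((?e \<bullet> ?e2) \<bullet> ?t) = sem ((?e \<bullet> ?e2) \<bullet> ?t')")
proof (rule sem_typed_ext)
  show "typed ((?e \<bullet> ?e2) \<bullet> ?t) l [\<E>, \<E>, \<F>, \<F>] []" "typed ((?e \<bullet> ?e2) \<bullet> ?t') l [\<E>, \<E>, \<F>, \<F>] []"
    by (rule typed_intros | simp)+
  fix S \<phi> p assume *: "weight S = l" "map fst p = [\<E>, \<E>, \<F>, \<F>]" "valid S p"
  then obtain a b c d where p: "p = [(\<E>, d), (\<E>, c), (\<F>, b), (\<F>, a)]" by (auto simp: map_eq_Cons_conv)
  have v: "a \<in> S" "b \<in> S" "b \<noteq> a" "a \<in> X" "b \<in> X" "S \<subseteq> X" "c \<noteq> d" "S - {a} \<subseteq> X"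
    using * p by auto
  have 1: "sem (?e \<bullet> ?e2) S \<phi> [(\<E>, d), (\<E>, c), (\<F>, b), (\<F>, a)]
     = (if c = b \<and> d = a then eps'_coeff (S - {a}) b * eps'_coeff S a * \<phi> [] else 0)"
    if "a \<in> S" "b \<in> S" "a \<noteq> b" "valid S [(\<E>, d), (\<E>, c), (\<F>, b), (\<F>, a)]" for a b c d
  proof -
    have "b \<in> S - {a}" "S - {a} \<subseteq> X" using that v by auto
    then have w: "weight (S - {a} - {b}) = l - 4" "weight (S - {a}) = l - 2"
      using *(1) that v(6) by (simp_all add: weight_remove)
    have sub: "S - {a} \<subseteq> X" using v by auto
    have x: "insert b (S - {a} - {b}) = S - {a}" "insert a (S - {a}) = S" using that by auto
    show ?thesis
    proof (cases "c = b")
      case True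
      then show ?thesis using that w x sub *(1) v(6) by (cases "d = a") (simp_all add: insert_absorb)
    next
      case False
      then show ?thesis using w *(1) by simp
    qed
  qed
  have w: "weight (S - {a} - {b}) = l - 4" "weight (S - {a}) = l - 2"
    using *(1) v weight_remove[of a S] weight_remove[of b "S - {a}"] by simp_all
  have sub: "S - {a} - {b} \<subseteq> X" using v by auto
  let ?q = "[(\<E>, d), (\<E>, c), (\<F>, b), (\<F>, a)]" and ?q1 = "[(\<E>, c), (\<E>, d), (\<F>, b), (\<F>, a)]"
    and ?q2 = "[(\<E>, d), (\<E>, c), (\<F>, a), (\<F>, b)]"
  have valid1: "valid S ?q" using *(3) unfolding p .
  have valid2: "valid S ?q1" "valid S ?q2"
    using *(3) v unfolding p by auto
  obtain g where g: "g = sem (?e \<bullet> ?e2) S \<phi>" by blast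
  have G: "sem ((?e \<bullet> ?e2) \<bullet> t) S \<phi> q = sem t S g q" "sem (?e \<bullet> ?e2) S \<phi> q = g q" for t q
    unfolding g by (rule sem.simps HOL.refl)+
  from valid2 have "sem ((?e \<bullet> ?e2) \<bullet> ?t) S \<phi> p = (sem (?e \<bullet> ?e2) S \<phi> ?q
      + sem (?e \<bullet> ?e2) S \<phi> ?q1) / (d - c)"
    using * w sub unfolding p G by simp
  also have "\<dots> = (sem (?e \<bullet> ?e2) S \<phi> ?q
      + sem (?e \<bullet> ?e2) S \<phi> ?q2) / (a - b)"
    unfolding 1[OF v(1,2) v(3)[symmetric] valid1] 1[OF v(1,2) v(3)[symmetric] valid2(1)] 1[OF v(2,1) v(3) valid2(2)]
      eps'_coeff_remove[OF v(1,6)] eps'_coeff_remove[OF v(2,6)]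
    using v(3) by (auto simp: field_simps)
  also have "\<dots> = sem ((?e \<bullet> ?e2) \<bullet> ?t') S \<phi> p"
    using * w sub unfolding p G by simp
  finally show "sem ((?e \<bullet> ?e2) \<bullet> ?t) S \<phi> p = sem ((?e \<bullet> ?e2) \<bullet> ?t') S \<phi> p" .
qed

lemma sem_cyc_tau2: "sem ((eps l \<bullet> (Id [\<F>] (l + 2) \<star> eps (l + 2) \<star> Id [\<E>] l)) \<bullet> (tau' (l + 4) \<star> Id [\<E>, \<E>] l))
    = sem ((eps l \<bullet> (Id [\<F>] (l + 2) \<star> eps (l + 2) \<star> Id [\<E>] l)) \<bullet> (Id [\<F>, \<F>] (l + 4) \<star> tau l))"
  (is "sem ((?e \<bullet> ?e2) \<bullet> ?t') = sem ((?e \<bullet> ?e2) \<bullet> ?t)")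
proof (rule sem_typed_ext)
  show "typed ((?e \<bullet> ?e2) \<bullet> ?t') l [\<F>, \<F>, \<E>, \<E>] []" "typed ((?e \<bullet> ?e2) \<bullet> ?t) l [\<F>, \<F>, \<E>, \<E>] []"
    by (rule typed_intros | simp)+
  fix S \<phi> p assume *: "weight S = l" "map fst p = [\<F>, \<F>, \<E>, \<E>]" "valid S p"
  then obtain a b c d where p: "p = [(\<F>, d), (\<F>, c), (\<E>, b), (\<E>, a)]" by (auto simp: map_eq_Cons_conv)
  have v: "a \<notin> S" "b \<notin> S" "b \<noteq> a" "a \<in> X" "b \<in> X" "S \<subseteq> X" "c \<noteq> d"
    using * p by auto
  have 1: "sem (?e \<bullet> ?e2) S \<phi> [(\<F>, d), (\<F>, c), (\<E>, b), (\<E>, a)]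
     = (if c = b \<and> d = a then eps_coeff (insert a S) b * eps_coeff S a * \<phi> [] else 0)"
    if "a \<notin> S" "b \<notin> S" "a \<in> X" "b \<in> X" "a \<noteq> b" "valid S [(\<F>, d), (\<F>, c), (\<E>, b), (\<E>, a)]" for a b c d
  proof -
    have w: "weight (insert b (insert a S)) = l + 4" "weight (insert a S) = l + 2"
      using *(1) that v(6) by (simp_all add: weight_insert)
    have x: "insert b (insert a S) - {b} = insert a S" "insert a S - {a} = S" using that by auto
    show ?thesis
    proof (cases "c = b")
      case True
      then show ?thesis using that w x *(1) v(6) by (cases "d = a") simp_all
    next
      case False
      then show ?thesis using w *(1) by simp
    qed
  qed
  have w: "weight (insert b (insert a S)) = l + 4" "weight (insert a S) = l + 2"
    using *(1) v weight_insert[of a S] weight_insert[of b "insert a S"] by simp_all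
  let ?q = "[(\<F>, d), (\<F>, c), (\<E>, b), (\<E>, a)]" and ?q1 = "[(\<F>, c), (\<F>, d), (\<E>, b), (\<E>, a)]"
    and ?q2 = "[(\<F>, d), (\<F>, c), (\<E>, a), (\<E>, b)]"
  have valid1: "valid S ?q" using *(3) unfolding p .
  have valid2: "valid S ?q1" "valid S ?q2"
    using *(3) v unfolding p by auto
  obtain g where g: "g = sem (?e \<bullet> ?e2) S \<phi>" by blast
  have G: "sem ((?e \<bullet> ?e2) \<bullet> t) S \<phi> q = sem t S g q" "sem (?e \<bullet> ?e2) S \<phi> q = g q" for t q
    unfolding g by (rule sem.simps HOL.refl)+
  from valid2 have "sem ((?e \<bullet> ?e2) \<bullet> ?t') S \<phi> p = (sem (?e \<bullet> ?e2) S \<phi> ?q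
      + sem (?e \<bullet> ?e2) S \<phi> ?q1) / (c - d)"
    using * w unfolding p G by simp
  also have "\<dots> = (sem (?e \<bullet> ?e2) S \<phi> ?q
      + sem (?e \<bullet> ?e2) S \<phi> ?q2) / (b - a)"
    unfolding 1[OF v(1,2,4,5) v(3)[symmetric] valid1] 1[OF v(1,2,4,5) v(3)[symmetric] valid2(1)]
      1[OF v(2,1,5,4) v(3) valid2(2)] eps_coeff_insert[OF v(1,6)] eps_coeff_insert[OF v(2,6)]
    using v(3) by (auto simp: field_simps)
  also have "\<dots> = sem ((?e \<bullet> ?e2) \<bullet> ?t) S \<phi> p"
    using * w unfolding p G by simp
  finally show "sem ((?e \<bullet> ?e2) \<bullet> ?t') S \<phi> p = sem ((?e \<bullet> ?e2) \<bullet> ?t) S \<phi> p" .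
qed

lemma divided_difference_dot:
  fixes i j A B :: 'a
  assumes "i \<noteq> j"
  shows "j * ((A + B) / (j - i)) - (i * A + j * B) / (j - i) = A"
    and "(j * A + i * B) / (j - i) - i * ((A + B) / (j - i)) = A"
proof -
  have "j * (A + B) - (i * A + j * B) = A * (j - i)" "j * A + i * B - i * (A + B) = A * (j - i)"
    by (simp_all add: algebra_simps)
  then show "j * ((A + B) / (j - i)) - (i * A + j * B) / (j - i) = A"
    "(j * A + i * B) / (j - i) - i * ((A + B) / (j - i)) = A"
    using assms by (simp_all flip: diff_divide_distrib)
qed

lemma divided_difference_braid:
  fixes i j k :: 'a
  assumes "i \<noteq> j" "j \<noteq> k" "i \<noteq> k"
  shows "(((kji + jki) / (k - j) + (kij + ikj) / (k - i)) / (j - i) + ((jki + kji) / (j - k) + (jik + ijk) / (j - i)) / (k - i)) / (k - j)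
    = (((kji + kij) / (j - i) + (jki + jik) / (k - i)) / (k - j) + ((kij + kji) / (i - j) + (ikj + ijk) / (k - j)) / (k - i)) / (j - i)"
proof -
  define u v w where "u = inverse (j - i)" and "v = inverse (k - j)" and "w = inverse (k - i)"
  have "(j - i) * u = 1" "(k - j) * v = 1" "(k - i) * w = 1" using assms by (auto simp: u_def v_def w_def)
  moreover have "u * v * ((k - i) * w) = w * (u * ((k - j) * v) + v * ((j - i) * u))" by (simp add: algebra_simps)
  ultimately have uvw: "u * v = w * (u + v)" by simp
  have "u * v * v - v * v * w = v * (u * v) - v * v * w" "u * u * v - u * u * w = u * (u * v) - u * u * w"
    by (simp_all add: algebra_simps)
  moreover have "v * (u * v) - v * v * w = v * (w * (u + v)) - v * v * w" "u * (u * v) - u * u * w = u * (w * (u + v)) - u * u * w"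
    by (simp_all only: uvw)
  ultimately have uvw2: "u * v * v - v * v * w = u * v * w" "u * u * v - u * u * w = u * v * w"
    by (simp_all add: algebra_simps)
  have "inverse (i - j) = - u" "inverse (j - k) = - v" unfolding u_def v_def
    by (metis inverse_minus_eq minus_diff_eq)+
  note inverses = this u_def[symmetric] v_def[symmetric] w_def[symmetric]
  have "(((kji + jki) * v + (kij + ikj) * w) * u + ((jki + kji) * - v + (jik + ijk) * u) * w) * v
    = (kji + jki) * (u * v * v - v * v * w) + u * v * w * (kij + ikj + jik + ijk)"
    "(((kji + kij) * u + (jki + jik) * w) * v + ((kij + kji) * - u + (ikj + ijk) * v) * w) * u
    = (kji + kij) * (u * u * v - u * u * w) + u * v * w * (jki + jik + ikj + ijk)"
    by (simp_all add: algebra_simps)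
  then show ?thesis unfolding divide_inverse inverses uvw2 by (simp add: algebra_simps)
qed

lemma sem_tau_sq: "sem (tau l \<bullet> tau l) = sem Zero"
  (is "sem ?L = _")
proof (rule sem_typed_ext)
  show "typed ?L l [\<E>, \<E>] [\<E>, \<E>]" "typed Zero l [\<E>, \<E>] [\<E>, \<E>]" by simp_all
  fix S \<phi> p assume *: "weight S = l" "map fst p = [\<E>, \<E>]" "valid S p"
  then obtain i j where p: "p = [(\<E>, j), (\<E>, i)]" and v: "i \<noteq> j" "i \<notin> S" "j \<notin> S" "i \<in> X" "j \<in> X" "S \<subseteq> X"
    by (auto simp: map_eq_Cons_conv)
  show "sem ?L S \<phi> p = sem Zero S \<phi> p"
    using * v unfolding p by (simp add: field_simps)
qed

lemma sem_dot1: "sem (tau l \<bullet> (xi (l + 2) \<star> Id [\<E>] l) \<boxplus> neg ((Id [\<E>] (l + 2) \<star> xi l) \<bullet> tau l)) = sem (Id [\<E>, \<E>] l)"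
  (is "sem ?L = _")
proof (rule sem_typed_ext)
  show "typed ?L l [\<E>, \<E>] [\<E>, \<E>]"
    "typed (Id [\<E>, \<E>] l) l [\<E>, \<E>] [\<E>, \<E>]"
    by (rule typed_intros | simp)+
  fix S \<phi> p assume *: "weight S = l" "map fst p = [\<E>, \<E>]" "valid S p"
  then obtain i j where p: "p = [(\<E>, j), (\<E>, i)]" and v: "i \<noteq> j" "i \<notin> S" "j \<notin> S" "i \<in> X" "j \<in> X" "S \<subseteq> X"
    by (auto simp: map_eq_Cons_conv)
  show "sem ?L S \<phi> p = sem (Id [\<E>, \<E>] l) S \<phi> p"
    using *(1) v divided_difference_dot[OF v(1)] unfolding p by (simp add: weight_insert)
qed

lemma sem_dot2: "sem ((xi (l + 2) \<star> Id [\<E>] l) \<bullet> tau l \<boxplus> neg (tau l \<bullet> (Id [\<E>] (l + 2) \<star> xi l))) = sem (Id [\<E>, \<E>] l)"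
  (is "sem ?L = _")
proof (rule sem_typed_ext)
  show "typed ?L l [\<E>, \<E>] [\<E>, \<E>]"
    "typed (Id [\<E>, \<E>] l) l [\<E>, \<E>] [\<E>, \<E>]"
    by (rule typed_intros | simp)+
  fix S \<phi> p assume *: "weight S = l" "map fst p = [\<E>, \<E>]" "valid S p"
  then obtain i j where p: "p = [(\<E>, j), (\<E>, i)]" and v: "i \<noteq> j" "i \<notin> S" "j \<notin> S" "i \<in> X" "j \<in> X" "S \<subseteq> X"
    by (auto simp: map_eq_Cons_conv)
  show "sem ?L S \<phi> p = sem (Id [\<E>, \<E>] l) S \<phi> p"
    using *(1) v divided_difference_dot[OF v(1)] unfolding p by (simp add: weight_insert)
qed

lemma sem_braid: "sem ((tau (l + 2) \<star> Id [\<E>] l) \<bullet> (Id [\<E>] (l + 4) \<star> tau l) \<bullet> (tau (l + 2) \<star> Id [\<E>] l))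
   = sem ((Id [\<E>] (l + 4) \<star> tau l) \<bullet> (tau (l + 2) \<star> Id [\<E>] l) \<bullet> (Id [\<E>] (l + 4) \<star> tau l))"
  (is "sem (?s \<bullet> ?t \<bullet> ?s) = sem (?t \<bullet> ?s \<bullet> ?t)")
proof (rule sem_typed_ext)
  show "typed (?s \<bullet> ?t \<bullet> ?s) l [\<E>, \<E>, \<E>] [\<E>, \<E>, \<E>]" "typed (?t \<bullet> ?s \<bullet> ?t) l [\<E>, \<E>, \<E>] [\<E>, \<E>, \<E>]"
    by (rule typed_intros | simp)+
  fix S \<phi> p assume *: "weight S = l" "map fst p = [\<E>, \<E>, \<E>]" "valid S p"
  then obtain i j k where p: "p = [(\<E>, k), (\<E>, j), (\<E>, i)]" and v: "i \<noteq> j" "j \<noteq> i" "i \<noteq> k" "k \<noteq> i" "j \<noteq> k" "k \<noteq> j"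
      "i \<notin> S" "j \<notin> S" "k \<notin> S" "i \<in> X" "j \<in> X" "k \<in> X" and S: "S \<subseteq> X"
    by (auto simp: map_eq_Cons_conv)
  have s: "sem ?s S \<psi> [(\<E>, k), (\<E>, j), (\<E>, i)]
      = (\<psi> [(\<E>, k), (\<E>, j), (\<E>, i)] + \<psi> [(\<E>, j), (\<E>, k), (\<E>, i)]) / (k - j)"
    and t: "sem ?t S \<psi> [(\<E>, k), (\<E>, j), (\<E>, i)]
      = (\<psi> [(\<E>, k), (\<E>, j), (\<E>, i)] + \<psi> [(\<E>, k), (\<E>, i), (\<E>, j)]) / (j - i)"
    if "i \<noteq> j" "j \<noteq> i" "i \<noteq> k" "k \<noteq> i" "j \<noteq> k" "k \<noteq> j" "i \<notin> S" "j \<notin> S" "k \<notin> S" "i \<in> X" "j \<in> X" "k \<in> X"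
    for i j k \<psi>
    using *(1) S that by (simp_all add: weight_insert)
  show "sem (?s \<bullet> ?t \<bullet> ?s) S \<phi> p = sem (?t \<bullet> ?s \<bullet> ?t) S \<phi> p"
    unfolding p sem.simps(6) using v
    by (simp add: s t del: sem.simps) (rule divided_difference_braid, auto)
qed

end

lemma sum_list_pairs_rev:
  fixes f :: "int \<Rightarrow> int \<Rightarrow> 'a::comm_monoid_add"
  shows "(\<Sum>(a, b)\<leftarrow>pairs m. f a b) = (\<Sum>b\<in>{0..m}. f (m - b) b)"
  unfolding sum_list_pairs
  by (rule sum.reindex_bij_witness[of _ "\<lambda>b. m - b" "\<lambda>a. m - a"]) auto

lemma typed_Sums_map:
  "(\<And>x. x \<in> set xs \<Longrightarrow> typed (f x) l u v) \<Longrightarrow> wt u = wt v \<Longrightarrow> typed (Sums (map f xs)) l u v"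
  by (auto simp: typed_Sums)

context localized_model
begin

lemma sem_curl1: "sem ((Id [\<E>] l \<star> eps' l) \<bullet> (tau (l - 2) \<star> Id [\<F>] l) \<bullet> (Id [\<E>] l \<star> eta' l))
    = sem (neg (Sums (map (\<lambda>(a, b). xipow b l \<star> bubble_plus a l) (pairs (- l)))))"
  (is "sem ?L = sem (neg (Sums (map ?f _)))")
proof (rule sem_typed_ext)
  show "typed ?L l [\<E>] [\<E>]" by (rule typed_intros | simp)+
  show "typed (neg (Sums (map ?f (pairs (- l))))) l [\<E>] [\<E>]"
    unfolding case_prod_unfold by (rule typed_neg typed_Sums_map typed_intros | simp)+
  fix S \<phi> p assume *: "weight S = l" "map fst p = [\<E>]" "valid S p"
  then obtain i where p: "p = [(\<E>, i)]" and v: "i \<in> X" "i \<notin> S" "S \<subseteq> X" by (auto simp: map_eq_Cons_conv)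
  have "sem ?L S \<phi> p = (\<Sum>j\<in>S. residue_at S (X - S) j / (i - j) * \<phi> p)"
    using *(1) v unfolding p
    by (auto simp: weight_insert weight_remove insert_absorb subset_iff simp flip: residue_plus intro!: sum.cong)
  also have "\<dots> = - (\<Sum>j\<in>S. residue_at S (X - S) j / (j - i)) * \<phi> p"
  proof -
    have "residue_at S (X - S) j / (i - j) = - (residue_at S (X - S) j / (j - i))" for j
      by (metis minus_diff_eq divide_minus_right)
    then show ?thesis by (simp add: sum_distrib_right flip: sum_negf)
  qed
  also have "(\<Sum>j\<in>S. residue_at S (X - S) j / (j - i)) = (\<Sum>b\<in>{0..- l}. rat_coeff S (X - S) (- l - b) * i ^ nat b)"
  proof -
    have "int (card (X - S)) - int (card S) = - l" using *(1) by (simp add: weight_def)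
    then show ?thesis using residue_sum_divided[of S "X - S" i] v finite_subset_X[of S] by simp
  qed
  also have "- (\<Sum>b\<in>{0..- l}. rat_coeff S (X - S) (- l - b) * i ^ nat b) * \<phi> p
      = - (\<Sum>(a, b)\<leftarrow>pairs (- l). rat_coeff S (X - S) a * i ^ nat b * \<phi> p)"
    by (simp add: sum_list_pairs_rev sum_distrib_right)
  also have "\<dots> = sem (neg (Sums (map ?f (pairs (- l))))) S \<phi> p"
    using * v by (simp add: sem_Sums p o_def case_prod_unfold sem_xipow mult_ac)
  finally show "sem ?L S \<phi> p = sem (neg (Sums (map ?f (pairs (- l))))) S \<phi> p" .
qed

lemma sem_curl2: "sem ((eps l \<star> Id [\<E>] (l - 2)) \<bullet> (Id [\<F>] (l + 2) \<star> tau (l - 2)) \<bullet> (eta l \<star> Id [\<E>] (l - 2)))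
    = sem (Sums (map (\<lambda>(a, b). bubble_minus a l \<star> xipow b (l - 2)) (pairs l)))"
  (is "sem ?L = sem (Sums (map ?f _))")
proof (rule sem_typed_ext)
  show "typed ?L (l - 2) [\<E>] [\<E>]" by (rule typed_intros | simp)+
  show "typed (Sums (map ?f (pairs l))) (l - 2) [\<E>] [\<E>]"
    unfolding case_prod_unfold by (rule typed_Sums_map typed_intros | simp)+
  fix S \<phi> p assume *: "weight S = l - 2" "map fst p = [\<E>]" "valid S p"
  then obtain i where p: "p = [(\<E>, i)]" and v: "i \<in> X" "i \<notin> S" "S \<subseteq> X" by (auto simp: map_eq_Cons_conv)
  let ?T = "insert i S"
  have T: "weight ?T = l" "?T \<subseteq> X" using * v by (simp_all add: weight_insert)
  have "sem ?L S \<phi> p = (\<Sum>j\<in>X - ?T. residue_at (X - ?T) ?T j / (j - i) * \<phi> p)"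
    using *(1) T v unfolding p
    by (auto simp: weight_insert insert_commute simp flip: residue_minus intro!: sum.cong)
  also have "\<dots> = (\<Sum>j\<in>X - ?T. residue_at (X - ?T) ?T j / (j - i)) * \<phi> p"
    by (simp add: sum_distrib_right)
  also have "(\<Sum>j\<in>X - ?T. residue_at (X - ?T) ?T j / (j - i)) = (\<Sum>b\<in>{0..l}. rat_coeff (X - ?T) ?T (l - b) * i ^ nat b)"
    using residue_sum_divided[of "X - ?T" ?T i] v finite_subset_X[OF T(2)] T(1) by (simp add: weight_def)
  also have "(\<Sum>b\<in>{0..l}. rat_coeff (X - ?T) ?T (l - b) * i ^ nat b) * \<phi> p
      = (\<Sum>(a, b)\<leftarrow>pairs l. rat_coeff (X - ?T) ?T a * i ^ nat b * \<phi> p)"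
    by (simp add: sum_list_pairs_rev sum_distrib_right)
  also have "\<dots> = sem (Sums (map ?f (pairs l))) S \<phi> p"
    using * v T by (simp add: sem_Sums p o_def case_prod_unfold sem_xipow mult_ac)
  finally show "sem ?L S \<phi> p = sem (Sums (map ?f (pairs l))) S \<phi> p" .
qed

lemma sem_sigma_neq:
  assumes "weight S = l" "S \<subseteq> X" "a \<in> S" "b \<in> X" "b \<notin> S"
  shows "sem (sigma l) S \<phi> [(\<E>, b), (\<F>, a)]
    = eta_coeff (insert b (S - {a})) a * eps'_coeff S a / (a - b) * \<phi> [(\<F>, a), (\<E>, b)]"
proof -
  let ?T = "insert b (S - {a})"
  have X: "X - ?T = insert a (X - insert b S)" "a \<in> X" "a \<noteq> b" "S - {a} \<subseteq> X" using assms by auto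
  have w: "weight ?T = l" "weight (S - {a}) = l - 2" using assms X by (simp_all add: weight_insert weight_remove)
  let ?Q = "(Id [\<F>] (l + 2) \<star> tau (l - 2) \<star> Id [\<F>] l)" and ?R = "Id [\<F>, \<E>] l \<star> eps' l"
  have "sem (sigma l) S \<phi> [(\<E>, b), (\<F>, a)]
    = (\<Sum>c\<in>insert a (X - insert b S). eta_coeff ?T c * sem ?Q S (sem ?R S \<phi>) [(\<F>, c), (\<E>, c), (\<E>, b), (\<F>, a)])"
    using assms X w unfolding sigma_def by simp
  also have "\<dots> = (\<Sum>c\<in>insert a (X - insert b S). if c = a then eta_coeff ?T a * eps'_coeff S a / (a - b) * \<phi> [(\<F>, a), (\<E>, b)] else 0)"
  proof (rule sum.cong[OF HOL.refl])
    fix c assume c: "c \<in> insert a (X - insert b S)"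
    have R1: "sem ?R S \<phi> [(\<F>, c), (\<E>, c), (\<E>, b), (\<F>, a)] = 0" using X by simp
    have R2: "sem ?R S \<phi> [(\<F>, c), (\<E>, b), (\<E>, c), (\<F>, a)] = (if c = a then eps'_coeff S a * \<phi> [(\<F>, a), (\<E>, b)] else 0)"
    proof (cases "c = a")
      case True then show ?thesis using assms X by (simp add: insert_absorb)
    next
      case False then show ?thesis by simp
    qed
    have "insert b (insert c (S - {a})) = insert c ?T" by auto
    then have Q: "sem ?Q S \<psi> [(\<F>, c), (\<E>, c), (\<E>, b), (\<F>, a)]
      = (\<psi> [(\<F>, c), (\<E>, c), (\<E>, b), (\<F>, a)] + \<psi> [(\<F>, c), (\<E>, b), (\<E>, c), (\<F>, a)]) / (c - b)" for \<psi>
      using assms c X w weight_insert[of c ?T] by (elim insertE) (simp_all add: insert_commute)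
    show "eta_coeff ?T c * sem ?Q S (sem ?R S \<phi>) [(\<F>, c), (\<E>, c), (\<E>, b), (\<F>, a)]
      = (if c = a then eta_coeff ?T a * eps'_coeff S a / (a - b) * \<phi> [(\<F>, a), (\<E>, b)] else 0)"
      unfolding Q R1 R2 by simp
  qed
  finally show ?thesis by simp
qed

lemma sem_sigma'_neq:
  assumes "weight S = l" "S \<subseteq> X" "a \<in> S" "b \<in> X" "b \<notin> S"
  shows "sem (sigma' l) S \<phi> [(\<F>, a), (\<E>, b)]
    = eta'_coeff S a * eps_coeff (insert b (S - {a})) a / (b - a) * \<phi> [(\<E>, b), (\<F>, a)]"
proof -
  let ?T = "insert b (S - {a})"
  have X: "a \<in> X" "a \<noteq> b" "b \<noteq> a" "S - {a} \<subseteq> X" "insert b S - {a} = ?T" using assms by auto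
  have w: "weight ?T = l" "weight (S - {a}) = l - 2" using assms X by (simp_all add: weight_insert weight_remove)
  let ?Q = "(Id [\<F>] (l + 2) \<star> tau (l - 2) \<star> Id [\<F>] l)" and ?R = "eps l \<star> Id [\<E>, \<F>] l"
  have "sem (sigma' l) S \<phi> [(\<F>, a), (\<E>, b)]
    = (\<Sum>d\<in>S. eta'_coeff S d * sem ?Q S (sem ?R S \<phi>) [(\<F>, a), (\<E>, b), (\<E>, d), (\<F>, d)])"
    using assms X w unfolding sigma'_def by (simp add: insert_absorb)
  also have "\<dots> = (\<Sum>d\<in>S. if d = a then eta'_coeff S a * eps_coeff ?T a / (b - a) * \<phi> [(\<E>, b), (\<F>, a)] else 0)"
  proof (rule sum.cong[OF HOL.refl])
    fix d assume d: "d \<in> S"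
    then have d': "d \<in> X" "d \<noteq> b" "S - {d} \<subseteq> X" using assms by auto
    have wd: "weight (S - {d}) = l - 2" "weight (insert b S) = l + 2"
      using assms d by (simp_all add: weight_insert weight_remove)
    have R1: "sem ?R S \<phi> [(\<F>, a), (\<E>, b), (\<E>, d), (\<F>, d)] = 0" using X by simp
    have R2: "sem ?R S \<phi> [(\<F>, a), (\<E>, d), (\<E>, b), (\<F>, d)] = (if d = a then eps_coeff ?T a * \<phi> [(\<E>, b), (\<F>, a)] else 0)"
    proof (cases "d = a")
      case True then show ?thesis using assms X w by simp
    next
      case False then show ?thesis by simp
    qed
    have Q: "sem ?Q S \<psi> [(\<F>, a), (\<E>, b), (\<E>, d), (\<F>, d)]
      = (\<psi> [(\<F>, a), (\<E>, b), (\<E>, d), (\<F>, d)] + \<psi> [(\<F>, a), (\<E>, d), (\<E>, b), (\<F>, d)]) / (b - d)" for \<psi>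
      using assms d d' X w wd by (simp add: insert_absorb)
    show "eta'_coeff S d * sem ?Q S (sem ?R S \<phi>) [(\<F>, a), (\<E>, b), (\<E>, d), (\<F>, d)]
      = (if d = a then eta'_coeff S a * eps_coeff ?T a / (b - a) * \<phi> [(\<E>, b), (\<F>, a)] else 0)"
      unfolding Q R1 R2 by simp
  qed
  finally show ?thesis using assms by (simp add: finite_subset_X)
qed

lemma sem_sigma_eq:
  assumes "weight S = l" "S \<subseteq> X" "a \<in> S"
  shows "sem (sigma l) S \<phi> [(\<E>, a), (\<F>, a)]
    = (\<Sum>c\<in>X - S. eta_coeff S c * eps'_coeff S a / (c - a) * \<phi> [(\<F>, c), (\<E>, c)])"
  using assms unfolding sigma_def
  by (auto simp: weight_insert weight_remove insert_absorb subset_iff intro!: sum.cong)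

lemma sem_sigma'_eq:
  assumes "weight S = l" "S \<subseteq> X" "b \<in> X" "b \<notin> S"
  shows "sem (sigma' l) S \<phi> [(\<F>, b), (\<E>, b)]
    = (\<Sum>d\<in>S. eta'_coeff S d * eps_coeff S b / (b - d) * \<phi> [(\<E>, d), (\<F>, d)])"
  using assms unfolding sigma'_def
  by (auto simp: weight_insert weight_remove insert_absorb subset_iff intro!: sum.cong)

lemma sigma_coeffs:
  assumes "S \<subseteq> X" "a \<in> S" "b \<in> X" "b \<notin> S"
  shows "eta_coeff (insert b (S - {a})) a * eps'_coeff S a = a - b"
    and "eta'_coeff S a * eps_coeff (insert b (S - {a})) a = a - b"
proof -
  have "X - insert b (S - {a}) - {a} = X - S - {b}" "X - S = insert b (X - S - {b})" using assms by auto
  then have "eta_coeff (insert b (S - {a})) a * eps'_coeff S a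
      = 1 / (\<Prod>j\<in>X - S - {b}. a - j) * (\<Prod>j\<in>insert b (X - S - {b}). a - j)"
    unfolding eta_coeff_def eps'_coeff_def by simp
  also have "(\<Prod>j\<in>insert b (X - S - {b}). a - j) = (a - b) * (\<Prod>j\<in>X - S - {b}. a - j)"
    by (rule prod.insert) simp_all
  also have "1 / (\<Prod>j\<in>X - S - {b}. a - j) * ((a - b) * (\<Prod>j\<in>X - S - {b}. a - j)) = a - b"
  proof -
    have "(\<Prod>j\<in>X - S - {b}. a - j) \<noteq> 0" using assms by auto
    then show ?thesis by simp
  qed
  finally show "eta_coeff (insert b (S - {a})) a * eps'_coeff S a = a - b" .
  have "(\<Prod>j\<in>S - {a}. a - j) \<noteq> 0" using finite_subset_X[OF assms(1)] by simp
  then show "eta'_coeff S a * eps_coeff (insert b (S - {a})) a = a - b"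
    using assms finite_subset_X[OF assms(1)] by (simp add: eta'_coeff_def eps_coeff_def)
qed

lemma sigma_coeffs_product:
  assumes "S \<subseteq> X" "a \<in> S" "b \<in> X" "b \<notin> S"
  shows "eta_coeff (insert b (S - {a})) a * eps'_coeff S a / (a - b) *
     (eta'_coeff S a * eps_coeff (insert b (S - {a})) a / (b - a) * c) = - c"
proof -
  have "a - b \<noteq> 0" using assms by auto
  then have "(a - b) / (b - a) = - 1" by (metis divide_self_if minus_diff_eq nonzero_minus_divide_divide divide_minus_right)
  then show ?thesis using sigma_coeffs[OF assms] \<open>a - b \<noteq> 0\<close> by simp
qed

lemma sem_dec_EF_term:
  assumes "weight S = l" "S \<subseteq> X" "i \<in> S" "j \<in> X" "j = i \<or> j \<notin> S"
  shows "sem (xipow_F c l \<bullet> eta' l \<bullet> bubble_minus b l \<bullet> eps' l \<bullet> xipow_F a l) S \<phi> [(\<E>, j), (\<F>, i)]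
    = (if j = i then (\<Sum>d\<in>S. eps'_coeff S i * eta'_coeff S d * \<phi> [(\<E>, d), (\<F>, d)] *
          (rat_coeff (X - S) S b * i ^ nat a * d ^ nat c)) else 0)"
proof (cases "j = i")
  case True
  have dX: "d \<in> X" if "d \<in> S" for d using that assms(2) by auto
  have xF: "sem (xipow_F n l) S \<psi> [(\<E>, d), (\<F>, d)] = d ^ nat n * \<psi> [(\<E>, d), (\<F>, d)]" if "d \<in> S" for n \<psi> d
  proof -
    have "S - {d} \<subseteq> X" using assms(2) by auto
    then show ?thesis using assms that dX by (simp add: xipow_F_def sem_xipow weight_remove)
  qed
  have "sem (xipow_F c l \<bullet> eta' l \<bullet> bubble_minus b l \<bullet> eps' l \<bullet> xipow_F a l) S \<phi> [(\<E>, i), (\<F>, i)]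
     = i ^ nat a * (eps'_coeff S i * (rat_coeff (X - S) S b *
         (\<Sum>d\<in>S. eta'_coeff S d * sem (xipow_F c l) S \<phi> [(\<E>, d), (\<F>, d)])))"
    using assms dX by (simp add: xF insert_absorb)
  also have "(\<Sum>d\<in>S. eta'_coeff S d * sem (xipow_F c l) S \<phi> [(\<E>, d), (\<F>, d)])
     = (\<Sum>d\<in>S. eta'_coeff S d * (d ^ nat c * \<phi> [(\<E>, d), (\<F>, d)]))"
    by (rule sum.cong[OF HOL.refl]) (simp only: xF)
  finally show ?thesis using True by (simp add: sum_distrib_left mult_ac)
next
  case False
  then show ?thesis using assms by (simp add: xipow_F_def sem_xipow weight_remove)
qed

lemma sem_dec_EF: "sem (Id [\<E>, \<F>] l) = sem (neg (sigma' l \<bullet> sigma l) \<boxplus>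
     Sums (map (\<lambda>(a, b, c). xipow_F c l \<bullet> eta' l \<bullet> bubble_minus b l \<bullet> eps' l \<bullet> xipow_F a l) (triples (l - 1))))"
  (is "_ = sem ?R" is "_ = sem (_ \<boxplus> ?S)" is "_ = sem (_ \<boxplus> Sums (map ?f _))")
proof (rule sem_typed_ext)
  show "typed (Id [\<E>, \<F>] l) l [\<E>, \<F>] [\<E>, \<F>]" by simp
  show "typed ?R l [\<E>, \<F>] [\<E>, \<F>]"
    unfolding case_prod_unfold sigma_def sigma'_def by (rule typed_Add typed_neg typed_Sums_map typed_intros | simp)+
  fix S \<phi> p assume *: "weight S = l" "map fst p = [\<E>, \<F>]" "valid S p"
  then obtain i j where p: "p = [(\<E>, j), (\<F>, i)]" and v: "i \<in> S" "S \<subseteq> X" "j \<in> X" "j = i \<or> j \<notin> S"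
    by (auto simp: map_eq_Cons_conv)
  have f: "sem (?f (a, b, c)) S \<phi> p = (if j = i then (\<Sum>d\<in>S. eps'_coeff S i * eta'_coeff S d * \<phi> [(\<E>, d), (\<F>, d)] *
          (rat_coeff (X - S) S b * i ^ nat a * d ^ nat c)) else 0)" for a b c
    unfolding p prod.case by (rule sem_dec_EF_term[OF *(1) v(2,1,3,4)])
  have Sums: "sem ?S S \<phi> p = (\<Sum>(a, b, c)\<leftarrow>triples (l - 1). sem (?f (a, b, c)) S \<phi> p)"
    unfolding sem_Sums map_map by (simp add: o_def case_prod_unfold del: sem.simps)
  show "sem (Id [\<E>, \<F>] l) S \<phi> p = sem ?R S \<phi> p"
  proof (cases "j = i")
    case False
    then have j: "j \<notin> S" using v by simp
    have "sem (sigma' l \<bullet> sigma l) S \<phi> p = - \<phi> p"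
      unfolding p sem.simps(6) sem_sigma_neq[OF *(1) v(2,1,3) j] sem_sigma'_neq[OF *(1) v(2,1,3) j]
      by (rule sigma_coeffs_product[OF v(2,1,3) j])
    moreover have "sem ?S S \<phi> p = 0"
      unfolding Sums f using False by (intro sum_list_map_neutral) auto
    ultimately show ?thesis using * by simp
  next
    case True
    let ?A = "X - S"
    have wt: "int (card S) - int (card ?A) = l" using *(1) by (simp add: weight_def)
    let ?g = "\<lambda>d. eps'_coeff S i * eta'_coeff S d * \<phi> [(\<E>, d), (\<F>, d)]"
    let ?h = "\<lambda>d. \<Sum>c\<in>{0..l - 1}. (\<Sum>a\<in>{0..l - 1 - c}. rat_coeff ?A S (l - 1 - c - a) * i ^ nat a) * d ^ nat c"
    let ?w = "\<lambda>d c a. ?g d * (rat_coeff ?A S (l - 1 - c - a) * i ^ nat a * d ^ nat c)"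
    have "sem ?S S \<phi> p
       = (\<Sum>(a, b, c)\<leftarrow>triples (l - 1). \<Sum>d\<in>S. ?g d * (rat_coeff ?A S b * i ^ nat a * d ^ nat c))"
      unfolding Sums f using True by simp
    also have "\<dots> = (\<Sum>d\<in>S. ?g d * ?h d)"
    proof -
      have "(\<Sum>d\<in>S. ?g d * ?h d) = (\<Sum>d\<in>S. \<Sum>c\<in>{0..l - 1}. \<Sum>a\<in>{0..l - 1 - c}. ?w d c a)"
        by (simp add: sum_distrib_left sum_distrib_right mult.assoc)
      also have "\<dots> = (\<Sum>c\<in>{0..l - 1}. \<Sum>d\<in>S. \<Sum>a\<in>{0..l - 1 - c}. ?w d c a)"
        by (rule sum.swap)
      also have "\<dots> = (\<Sum>c\<in>{0..l - 1}. \<Sum>a\<in>{0..l - 1 - c}. \<Sum>d\<in>S. ?w d c a)"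
        by (rule sum.cong[OF HOL.refl], rule sum.swap)
      finally show ?thesis unfolding sum_list_triples by simp
    qed
    finally have 1: "sem ?S S \<phi> p = (\<Sum>d\<in>S. ?g d * ?h d)" .
    have 2: "sem (sigma' l \<bullet> sigma l) S \<phi> p
       = (\<Sum>d\<in>S. ?g d * (\<Sum>c\<in>?A. residue_at ?A S c / ((c - i) * (c - d))))"
    proof -
      have "sem (sigma' l \<bullet> sigma l) S \<phi> p = (\<Sum>c\<in>?A. eta_coeff S c * eps'_coeff S i / (c - i) *
          (\<Sum>d\<in>S. eta'_coeff S d * eps_coeff S c / (c - d) * \<phi> [(\<E>, d), (\<F>, d)]))"
        unfolding p True sem.simps(6) sem_sigma_eq[OF *(1) v(2,1)]
        by (rule sum.cong[OF HOL.refl]) (simp add: sem_sigma'_eq[OF *(1) v(2)] del: sem.simps)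
      then show ?thesis
        by (simp add: sum_distrib_left sum.swap[of _ S] mult_ac flip: residue_minus)
    qed
    have "?h d - (\<Sum>c\<in>?A. residue_at ?A S c / ((c - i) * (c - d))) = (if i = d then 1 / residue_at S ?A i else 0)"
      if "d \<in> S" for d
    proof -
      have "(\<Sum>c\<in>?A. residue_at ?A S c / ((c - i) * (c - d))) + (if i = d then 1 / residue_at S ?A i else 0) = ?h d"
        unfolding wt[symmetric] by (rule residue_sum_twice_divided) (use that v finite_subset_X[OF v(2)] in auto)
      then show ?thesis unfolding diff_eq_eq by (rule HOL.trans[OF HOL.sym add.commute])
    qed
    then have "sem ?R S \<phi> p
       = (\<Sum>d\<in>S. ?g d * (if i = d then 1 / residue_at S ?A i else 0))"
      by (simp add: 1 2 sum_subtractf[symmetric] right_diff_distrib[symmetric] del: sem.simps(6))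
    also have "\<dots> = ?g i * (1 / residue_at S ?A i)"
      using v finite_subset_X[OF v(2)] by (simp add: if_distrib cong: if_cong)
    also have "\<dots> = \<phi> p"
    proof -
      have "residue_at S ?A i \<noteq> 0" using v finite_subset_X[OF v(2)] by (auto simp: residue_at_def)
      then show ?thesis by (simp add: p True flip: residue_plus)
    qed
    finally show ?thesis using * by simp
  qed
qed

lemma sem_dec_FE_term:
  assumes "weight S = l" "S \<subseteq> X" "i \<in> X" "i \<notin> S" "j \<in> insert i S"
  shows "sem (F_xipow c l \<bullet> eta l \<bullet> bubble_plus b l \<bullet> eps l \<bullet> F_xipow a l) S \<phi> [(\<F>, j), (\<E>, i)]
    = (if j = i then (\<Sum>d\<in>X - S. eps_coeff S i * eta_coeff S d * \<phi> [(\<F>, d), (\<E>, d)] *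
          (rat_coeff S (X - S) b * i ^ nat a * d ^ nat c)) else 0)"
proof (cases "j = i")
  case True
  have xF: "sem (F_xipow n l) S \<psi> [(\<F>, d), (\<E>, d)] = d ^ nat n * \<psi> [(\<F>, d), (\<E>, d)]" if "d \<in> X - S" for n \<psi> d
    using assms that by (simp add: F_xipow_def sem_xipow weight_insert)
  have "sem (F_xipow c l \<bullet> eta l \<bullet> bubble_plus b l \<bullet> eps l \<bullet> F_xipow a l) S \<phi> [(\<F>, i), (\<E>, i)]
     = i ^ nat a * (eps_coeff S i * (rat_coeff S (X - S) b *
         (\<Sum>d\<in>X - S. eta_coeff S d * sem (F_xipow c l) S \<phi> [(\<F>, d), (\<E>, d)])))"
    using assms by (simp add: xF)
  also have "(\<Sum>d\<in>X - S. eta_coeff S d * sem (F_xipow c l) S \<phi> [(\<F>, d), (\<E>, d)])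
     = (\<Sum>d\<in>X - S. eta_coeff S d * (d ^ nat c * \<phi> [(\<F>, d), (\<E>, d)]))"
    by (rule sum.cong[OF HOL.refl]) (simp only: xF)
  finally show ?thesis using True by (simp add: sum_distrib_left mult_ac)
next
  case False
  then show ?thesis using assms by (simp add: F_xipow_def sem_xipow weight_insert)
qed

lemma sem_dec_FE: "sem (Id [\<F>, \<E>] l) = sem (neg (sigma l \<bullet> sigma' l) \<boxplus>
     Sums (map (\<lambda>(a, b, c). F_xipow c l \<bullet> eta l \<bullet> bubble_plus b l \<bullet> eps l \<bullet> F_xipow a l) (triples (- l - 1))))"
  (is "_ = sem ?R" is "_ = sem (_ \<boxplus> ?S)" is "_ = sem (_ \<boxplus> Sums (map ?f _))")
proof (rule sem_typed_ext)
  show "typed (Id [\<F>, \<E>] l) l [\<F>, \<E>] [\<F>, \<E>]" by simp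
  show "typed ?R l [\<F>, \<E>] [\<F>, \<E>]"
    unfolding case_prod_unfold sigma_def sigma'_def by (rule typed_Add typed_neg typed_Sums_map typed_intros | simp)+
  fix S \<phi> p assume *: "weight S = l" "map fst p = [\<F>, \<E>]" "valid S p"
  then obtain i j where p: "p = [(\<F>, j), (\<E>, i)]" and v: "i \<in> X" "i \<notin> S" "S \<subseteq> X" "j \<in> insert i S"
    by (auto simp: map_eq_Cons_conv)
  have f: "sem (?f (a, b, c)) S \<phi> p = (if j = i then (\<Sum>d\<in>X - S. eps_coeff S i * eta_coeff S d * \<phi> [(\<F>, d), (\<E>, d)] *
          (rat_coeff S (X - S) b * i ^ nat a * d ^ nat c)) else 0)" for a b c
    unfolding p prod.case by (rule sem_dec_FE_term[OF *(1) v(3,1,2,4)])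
  have Sums: "sem ?S S \<phi> p = (\<Sum>(a, b, c)\<leftarrow>triples (- l - 1). sem (?f (a, b, c)) S \<phi> p)"
    unfolding sem_Sums map_map by (simp add: o_def case_prod_unfold del: sem.simps)
  show "sem (Id [\<F>, \<E>] l) S \<phi> p = sem ?R S \<phi> p"
  proof (cases "j = i")
    case False
    then have j: "j \<in> S" using v by simp
    have "sem (sigma l \<bullet> sigma' l) S \<phi> p = - \<phi> p"
      unfolding p sem.simps(6) sem_sigma_neq[OF *(1) v(3) j v(1,2)] sem_sigma'_neq[OF *(1) v(3) j v(1,2)]
      using sigma_coeffs_product[OF v(3) j v(1,2), of "\<phi> [(\<F>, j), (\<E>, i)]"] by (simp add: mult_ac)
    moreover have "sem ?S S \<phi> p = 0"
      unfolding Sums f using False by (intro sum_list_map_neutral) auto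
    ultimately show ?thesis using * by simp
  next
    case True
    let ?A = "X - S"
    have wt: "int (card ?A) - int (card S) = - l" using *(1) by (simp add: weight_def)
    let ?g = "\<lambda>d. eps_coeff S i * eta_coeff S d * \<phi> [(\<F>, d), (\<E>, d)]"
    let ?h = "\<lambda>d. \<Sum>c\<in>{0..- l - 1}. (\<Sum>a\<in>{0..- l - 1 - c}. rat_coeff S ?A (- l - 1 - c - a) * i ^ nat a) * d ^ nat c"
    let ?w = "\<lambda>d c a. ?g d * (rat_coeff S ?A (- l - 1 - c - a) * i ^ nat a * d ^ nat c)"
    have "sem ?S S \<phi> p
       = (\<Sum>(a, b, c)\<leftarrow>triples (- l - 1). \<Sum>d\<in>?A. ?g d * (rat_coeff S ?A b * i ^ nat a * d ^ nat c))"
      unfolding Sums f using True by simp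
    also have "\<dots> = (\<Sum>d\<in>?A. ?g d * ?h d)"
    proof -
      have "(\<Sum>d\<in>?A. ?g d * ?h d) = (\<Sum>d\<in>?A. \<Sum>c\<in>{0..- l - 1}. \<Sum>a\<in>{0..- l - 1 - c}. ?w d c a)"
        by (simp add: sum_distrib_left sum_distrib_right mult.assoc)
      also have "\<dots> = (\<Sum>c\<in>{0..- l - 1}. \<Sum>d\<in>?A. \<Sum>a\<in>{0..- l - 1 - c}. ?w d c a)"
        by (rule sum.swap)
      also have "\<dots> = (\<Sum>c\<in>{0..- l - 1}. \<Sum>a\<in>{0..- l - 1 - c}. \<Sum>d\<in>?A. ?w d c a)"
        by (rule sum.cong[OF HOL.refl], rule sum.swap)
      finally show ?thesis unfolding sum_list_triples by simp
    qed
    finally have 1: "sem ?S S \<phi> p = (\<Sum>d\<in>?A. ?g d * ?h d)" .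
    have 2: "sem (sigma l \<bullet> sigma' l) S \<phi> p
       = (\<Sum>d\<in>?A. ?g d * (\<Sum>c\<in>S. residue_at S ?A c / ((c - i) * (c - d))))"
    proof -
      have "sem (sigma l \<bullet> sigma' l) S \<phi> p = (\<Sum>c\<in>S. eta'_coeff S c * eps_coeff S i / (i - c) *
          (\<Sum>d\<in>?A. eta_coeff S d * eps'_coeff S c / (d - c) * \<phi> [(\<F>, d), (\<E>, d)]))"
        unfolding p True sem.simps(6) sem_sigma'_eq[OF *(1) v(3,1,2)]
        by (rule sum.cong[OF HOL.refl]) (simp add: sem_sigma_eq[OF *(1) v(3)] del: sem.simps)
      also have "\<dots> = (\<Sum>d\<in>?A. \<Sum>c\<in>S. ?g d * (eta'_coeff S c * eps'_coeff S c / ((i - c) * (d - c))))"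
        unfolding sum_distrib_left by (subst sum.swap) (simp add: mult_ac)
      also have "\<dots> = (\<Sum>d\<in>?A. ?g d * (\<Sum>c\<in>S. residue_at S ?A c / ((c - i) * (c - d))))"
        unfolding sum_distrib_left residue_plus by (simp add: algebra_simps)
      finally show ?thesis .
    qed
    have "?h d - (\<Sum>c\<in>S. residue_at S ?A c / ((c - i) * (c - d))) = (if i = d then 1 / residue_at ?A S i else 0)"
      if "d \<in> ?A" for d
    proof -
      have "(\<Sum>c\<in>S. residue_at S ?A c / ((c - i) * (c - d))) + (if i = d then 1 / residue_at ?A S i else 0) = ?h d"
        unfolding wt[symmetric] by (rule residue_sum_twice_divided) (use that v finite_subset_X[OF v(3)] in auto)
      then show ?thesis unfolding diff_eq_eq by (rule HOL.trans[OF HOL.sym add.commute])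
    qed
    then have "sem ?R S \<phi> p
       = (\<Sum>d\<in>?A. ?g d * (if i = d then 1 / residue_at ?A S i else 0))"
      by (simp add: 1 2 sum_subtractf[symmetric] right_diff_distrib[symmetric] del: sem.simps(6))
    also have "\<dots> = ?g i * (1 / residue_at ?A S i)"
      using v by (simp add: if_distrib cong: if_cong)
    also have "\<dots> = \<phi> p"
    proof -
      have "residue_at ?A S i \<noteq> 0" using v finite_subset_X[OF v(3)] by (auto simp: residue_at_def)
      then show ?thesis by (simp add: p True flip: residue_minus)
    qed
    finally show ?thesis using * by simp
  qed
qed

lemma sem_bubble_sum:
  "sem (Sums (map (\<lambda>(a, b). bubble_plus a l \<bullet> bubble_minus b l) (pairs m))) = sem (if m = 0 then Id [] l else Zero)"
proof (rule sem_typed_ext)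
  show "typed (Sums (map (\<lambda>(a, b). bubble_plus a l \<bullet> bubble_minus b l) (pairs m))) l [] []"
    unfolding case_prod_unfold by (rule typed_Sums_map typed_intros | simp)+
  show "typed (if m = 0 then Id [] l else Zero) l [] []" by simp
  fix S \<phi> p assume *: "weight S = l" "map fst p = []" "valid S p"
  then have p: "p = []" "S \<subseteq> X" by auto
  have "sem (Sums (map (\<lambda>(a, b). bubble_plus a l \<bullet> bubble_minus b l) (pairs m))) S \<phi> p
    = (\<Sum>(a, b)\<leftarrow>pairs m. rat_coeff S (X - S) a * rat_coeff (X - S) S b * \<phi> [])"
    unfolding sem_Sums map_map using * p by (simp add: o_def case_prod_unfold mult_ac)
  also have "\<dots> = (if m = 0 then \<phi> [] else 0)"
    unfolding sum_list_pairs by (simp add: rat_coeff_convolution flip: sum_distrib_right)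
  finally show "sem (Sums (map (\<lambda>(a, b). bubble_plus a l \<bullet> bubble_minus b l) (pairs m))) S \<phi> p
    = sem (if m = 0 then Id [] l else Zero) S \<phi> p" using * p by simp
qed

theorem sem_rel: "rel s t \<Longrightarrow> sem s = sem t"
proof (induction rule: rel.induct)
  case (bubble_plus_neg k l) then show ?case by (intro ext) simp
next
  case (bubble_minus_neg k l) then show ?case by (intro ext) simp
next
  case (bubble_plus_0 l) show ?case by (intro ext) (auto dest: valid_subset)
next
  case (bubble_minus_0 l) show ?case by (intro ext) (auto dest: valid_subset)
qed (rule sem_adj1 sem_adj2 sem_adj3 sem_adj4 sem_cyc_xi1 sem_cyc_xi2 sem_cyc_tau1 sem_cyc_tau2 sem_bubble_sum
    sem_tau_sq sem_braid sem_dot1 sem_dot2 sem_curl1 sem_curl2 sem_dec_EF sem_dec_FE)+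

theorem sem_cls: "cls s = cls t \<Longrightarrow> sem s = sem t"
  by (rule sem_eqv[OF sem_rel]) (simp_all add: mor.abs_eq_iff)

end

section \<open>Linear independence\<close>

lemma rat_coeff_1:
  assumes "finite A" "finite B"
  shows "rat_coeff A B 1 = \<Sum>A - \<Sum>B"
  using assms(1)
proof (induction A rule: finite_induct)
  case empty
  from assms(2) have "rat_coeff {} B 1 = - \<Sum>B"
    by (induction B rule: finite_induct) (simp_all add: rat_coeff_insert_zero, simp add: rat_coeff_def rat_fps_def)
  then show ?case by simp
next
  case (insert a A)
  then show ?case using rat_coeff_insert_pole[OF insert.hyps, of B 1] by (simp add: algebra_simps)
qed

context localized_model
begin

lemma weight_remove_one: "i \<in> X \<Longrightarrow> weight (X - {i}) = int (card X) - 2"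
proof -
  assume i: "i \<in> X"
  then have "X - (X - {i}) = {i}" by auto
  moreover have "card X > 0" using i by (auto simp: card_gt_0_iff)
  ultimately show ?thesis using i by (simp add: weight_def of_nat_diff)
qed

lemma bubble_relation:
  assumes "scl c (bpl 1 l) = 0" "i \<in> X" "l = int (card X) - 2"
  shows "emb c * (\<Sum>X - 2 * i) = 0"
proof -
  let ?S = "X - {i}"
  have "cls (c \<cdot> bubble_plus 1 l) = cls Zero" using assms(1) by (simp add: cls_simps)
  from sem_cls[OF this] have "sem (c \<cdot> bubble_plus 1 l) ?S (\<lambda>_. 1) [] = 0" by (simp only: sem.simps(1))
  moreover have "X - ?S = {i}" using assms(2) by auto
  ultimately show ?thesis
    using assms(2,3) by (simp add: weight_remove_one rat_coeff_1 sum_diff1 algebra_simps)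
qed

lemma FE_relation:
  assumes "scl \<alpha> (cls (xi' (l + 2)) \<circ>\<^sub>h idm [\<E>] l) + scl \<beta> (idm [\<F>] (l + 2) \<circ>\<^sub>h cls (xi l))
     + scl \<gamma> (bpl 1 l \<circ>\<^sub>h idm [\<F>, \<E>] l) + scl \<delta> (idm [\<F>, \<E>] l \<circ>\<^sub>h bpl 1 l) = 0"
    and ij: "i \<in> X" "j \<in> X" "i \<noteq> j" and l: "l = int (card X) - 2"
  shows "emb \<alpha> * j + emb \<beta> * i + emb \<gamma> * (\<Sum>X - 2 * j) + emb \<delta> * (\<Sum>X - 2 * i) = 0"
proof -
  let ?S = "X - {i}" and ?T = "X - {j}"
  let ?p = "[(\<F>, j), (\<E>, i)]"
  let ?t = "\<alpha> \<cdot> (xi' (l + 2) \<star> Id [\<E>] l) \<boxplus> \<beta> \<cdot> (Id [\<F>] (l + 2) \<star> xi l)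
    \<boxplus> \<gamma> \<cdot> (bubble_plus 1 l \<star> Id [\<F>, \<E>] l) \<boxplus> \<delta> \<cdot> (Id [\<F>, \<E>] l \<star> bubble_plus 1 l)"
  have "cls ?t = cls Zero" using assms(1) by (simp add: cls_simps)
  from sem_cls[OF this] have "sem ?t ?S (\<lambda>_. 1) ?p = 0" by (simp only: sem.simps(1))
  moreover have "X - ?S = {i}" "X - ?T = {j}" "insert i ?S = X" using ij by auto
  moreover have "weight X = l + 2" "weight ?S = l" "weight ?T = l"
    using weight_remove_one[OF ij(1)] weight_remove_one[OF ij(2)] l by (simp, simp_all add: weight_def)
  ultimately show ?thesis
    using ij by (simp add: rat_coeff_1 sum_diff1 algebra_simps)
qed

end

lemma localized_model_fls: "finite X \<Longrightarrow> localized_model fls_const (X :: 'k::field fls set)"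
  by unfold_locales (auto intro: fls_eqI)

definition fls_points :: "int \<Rightarrow> 'k::field fls set" where
  "fls_points l = (\<lambda>n. fls_X ^ n) ` {..<nat l + 2}"

lemma inj_fls_X_power: "inj (\<lambda>n. fls_X ^ n :: 'k::field fls)"
  by (rule injI) (metis fls_X_power_nth of_nat_eq_iff zero_neq_one)

lemma card_fls_points: "l > 0 \<Longrightarrow> int (card (fls_points l :: 'k::field fls set)) - 2 = l"
  unfolding fls_points_def by (subst card_image) (auto intro: inj_on_subset[OF inj_fls_X_power])

lemma nth_sum_fls_points:
  "fls_nth (\<Sum>(fls_points l)) (int k) = (if k < nat l + 2 then 1 else 0 :: 'k::field)"
proof -
  have "(\<Sum>(fls_points l) :: 'k fls) = (\<Sum>n<nat l + 2. fls_X ^ n)"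
    unfolding fls_points_def by (subst sum.reindex) (auto intro: inj_on_subset[OF inj_fls_X_power])
  then show ?thesis by (simp add: fls_nth_sum del: sum.lessThan_Suc add_2_eq_Suc')
qed

lemma fls_points_power: "n < nat l + 2 \<Longrightarrow> fls_X ^ n \<in> fls_points l"
  by (auto simp: fls_points_def)

interpretation fls_model: localized_model fls_const "fls_points l :: 'k::field fls set" for l
  by (rule localized_model_fls) (simp add: fls_points_def)

lemma scl_bubble_eq_0:
  fixes c :: "'k::field"
  assumes "l > 0" "scl c (bpl 1 l) = 0"
  shows "c = 0"
proof -
  have "fls_const c * (\<Sum>(fls_points l) - 2 * fls_X ^ 0) = 0"
    by (rule fls_model.bubble_relation[OF assms(2) fls_points_power]) (use assms(1) in \<open>simp_all add: card_fls_points\<close>)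
  then have "fls_nth (fls_const c * (\<Sum>(fls_points l) - fls_const 2 * fls_X ^ 0)) (int 1) = 0"
    by (simp only: fls_const_numeral fls_zero_nth)
  then show ?thesis
    unfolding fls_mult_const_nth fls_minus_nth nth_sum_fls_points using assms(1) by simp
qed

lemma FE_independent:
  fixes \<alpha> \<beta> \<gamma> \<delta> :: "'k::field"
  assumes l: "l > 0"
    and eq: "scl \<alpha> (cls (xi' (l + 2)) \<circ>\<^sub>h idm [\<E>] l) + scl \<beta> (idm [\<F>] (l + 2) \<circ>\<^sub>h cls (xi l))
     + scl \<gamma> (bpl 1 l \<circ>\<^sub>h idm [\<F>, \<E>] l) + scl \<delta> (idm [\<F>, \<E>] l \<circ>\<^sub>h bpl 1 l) = 0"
    and \<gamma>\<delta>: "\<gamma> = 0 \<or> \<delta> = 0"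
  shows "\<alpha> = 0 \<and> \<beta> = 0 \<and> \<gamma> = 0 \<and> \<delta> = 0"
proof -
  let ?X = "fls_points l :: 'k fls set"
  have "fls_const \<alpha> * fls_X ^ 1 + fls_const \<beta> * fls_X ^ 0 + fls_const \<gamma> * (\<Sum>?X - 2 * fls_X ^ 1)
      + fls_const \<delta> * (\<Sum>?X - 2 * fls_X ^ 0) = 0"
  proof (rule fls_model.FE_relation[OF eq])
    show "(fls_X ^ 0 :: 'k fls) \<noteq> fls_X ^ 1" using inj_fls_X_power[THEN injD, of 0 1] by auto
    show "l = int (card ?X) - 2" using l by (simp add: card_fls_points)
    show "fls_X ^ 0 \<in> ?X" "fls_X ^ 1 \<in> ?X" by (rule fls_points_power, use l in simp)+
  qed
  then have nth: "fls_nth (fls_const \<alpha> * fls_X ^ 1 + fls_const \<beta> * fls_X ^ 0 + fls_const \<gamma> * (\<Sum>?X - fls_const 2 * fls_X ^ 1)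
      + fls_const \<delta> * (\<Sum>?X - fls_const 2 * fls_X ^ 0)) (int k) = 0" for k
    by (simp only: fls_const_numeral fls_zero_nth)
  note nth' = nth[unfolded fls_plus_nth fls_minus_nth fls_mult_const_nth nth_sum_fls_points]
  have "\<gamma> + \<delta> = 0" using nth'[of 2] l by simp
  then have "\<gamma> = 0" "\<delta> = 0" using \<gamma>\<delta> by auto
  moreover from this have "\<alpha> = 0" "\<beta> = 0" using nth'[of 1] nth'[of 0] by simp_all
  ultimately show ?thesis by simp
qed

section \<open>The endomorphism algebra\<close>

lemma has_deg_VC: "has_deg s a \<Longrightarrow> has_deg t b \<Longrightarrow> d = a + b \<Longrightarrow> has_deg (s \<bullet> t) d" by auto
lemma has_deg_HC: "has_deg s a \<Longrightarrow> has_deg t b \<Longrightarrow> d = a + b \<Longrightarrow> has_deg (s \<star> t) d" by auto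
lemma has_deg_neg: "has_deg (neg t) d = has_deg t d" by (simp add: neg_def)
lemma has_deg_Sums: "has_deg (Sums ts) d \<longleftrightarrow> (\<forall>t\<in>set ts. has_deg t d)"
  by (induction ts) (simp_all add: Sums_def)

lemma has_deg_xipow: "n \<ge> 0 \<Longrightarrow> has_deg (xipow n l) (2 * n)"
proof -
  assume n: "n \<ge> 0"
  have "has_deg (((\<lambda>t. xi l \<bullet> t) ^^ m) (Id [\<E>] l)) (2 * int m)" for m
    by (induction m) (auto intro: exI[of _ "2 * int _"])
  from this[of "nat n"] n show ?thesis by (simp add: xipow_def)
qed
lemma has_deg_xipow_F: "n \<ge> 0 \<Longrightarrow> has_deg (xipow_F n l) (2 * n)"
  unfolding xipow_F_def by (rule has_deg_HC[OF has_deg_xipow, of _ _ 0]) auto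
lemma has_deg_F_xipow: "n \<ge> 0 \<Longrightarrow> has_deg (F_xipow n l) (2 * n)"
  unfolding F_xipow_def by (rule has_deg_HC[OF _ has_deg_xipow, of _ 0]) auto
lemma has_deg_real_bubble_plus: "k \<ge> 1 - l \<Longrightarrow> has_deg (real_bubble_plus k l) (2 * k)"
  unfolding real_bubble_plus_def
  by (rule has_deg_VC[of _ "1 - l"], simp, rule has_deg_VC[OF has_deg_xipow_F, of _ _ "1 - l"]) auto
lemma has_deg_real_bubble_minus: "k \<ge> 1 + l \<Longrightarrow> has_deg (real_bubble_minus k l) (2 * k)"
  unfolding real_bubble_minus_def
  by (rule has_deg_VC[of _ "1 + l"], simp, rule has_deg_VC[OF has_deg_F_xipow, of _ _ "1 + l"]) auto
lemma has_deg_fake_bubble_minus: "l > 0 \<Longrightarrow> has_deg (fake_bubble_minus k l :: 'k::field tm) (2 * int k)"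
proof (induction k rule: less_induct)
  case (less k)
  have "has_deg (real_bubble_plus (int k - int b) l \<bullet> (fake_bubble_minus b l :: 'k tm)) (2 * int k)" if "b < k" for b
    by (rule has_deg_VC[OF has_deg_real_bubble_plus less.IH]) (use that less.prems in auto)
  then show ?case by (subst fake_bubble_minus.simps) (auto simp: has_deg_neg has_deg_Sums)
qed
lemma has_deg_bubble_minus: "l > 0 \<Longrightarrow> has_deg (bubble_minus k l) (2 * k)"
  unfolding bubble_minus_def
  using has_deg_real_bubble_minus[of l k] has_deg_fake_bubble_minus[of l "nat k"] by auto

lemma has_deg_sigma: "has_deg (sigma l) 0"
  unfolding sigma_def
  by (rule has_deg_VC[of _ "1 - l" _ "l - 1"], simp, rule has_deg_VC[of _ "- 2" _ "1 + l"], simp_all)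
lemma has_deg_sigma': "has_deg (sigma' l) 0"
  unfolding sigma'_def
  by (rule has_deg_VC[of _ "1 + l" _ "- 1 - l"], simp, rule has_deg_VC[of _ "- 2" _ "1 - l"], simp_all)

lemma length_EF_sum [simp]: "length (EF_sum l) = Suc (Suc (nat l))"
  by (simp add: EF_sum_def)
lemma nth_EF_sum:
  "EF_sum l ! 0 = ([\<E>, \<F>], 0)" "EF_sum l ! Suc 0 = ([\<F>, \<E>], 0)"
  "c < nat l \<Longrightarrow> EF_sum l ! (Suc (Suc c)) = ([], 1 - l + 2 * int c)"
  by (simp_all add: EF_sum_def)
lemma wt_EF_sum: "i < Suc (Suc (nat l)) \<Longrightarrow> wt (fst (EF_sum l ! i)) = 0"
  by (cases i; cases "i - 1") (auto simp: nth_EF_sum)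

definition EF_pos :: "int \<Rightarrow> nat \<Rightarrow> nat" where "EF_pos l c = (if int c < l then c + 2 else 1)"
definition EF_word :: "int \<Rightarrow> nat \<Rightarrow> word" where "EF_word l c = (if int c < l then [] else [\<F>, \<E>])"
definition um :: "int \<Rightarrow> nat \<Rightarrow> 'k::field mor" where "um l c = (if int c < l then uu l c else sg' l)"
definition vm :: "int \<Rightarrow> nat \<Rightarrow> 'k::field mor" where "vm l c = (if int c < l then vv l c else - sg l)"

lemma EF_u_eq: "EF_u l c = matrix_unit 0 (EF_pos l c) (um l c)"
  by (simp add: EF_u_def EF_pos_def um_def cls_EF_u)
lemma EF_v_eq: "EF_v l c = matrix_unit (EF_pos l c) 0 (vm l c)"
  by (simp add: EF_v_def EF_pos_def vm_def cls_EF_v cls_neg)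

lemma HOM_um: "um l c \<in> HOM l (EF_word l c) [\<E>, \<F>]"
  by (simp add: um_def EF_word_def HOM_uu HOM_sigma')
lemma HOM_vm: "vm l c \<in> HOM l [\<E>, \<F>] (EF_word l c)"
  by (simp add: vm_def EF_word_def HOM_vv HOM_sigma HOM_uminus)
lemma EF_pos_less: "EF_pos l c < Suc (Suc (nat l))" by (auto simp: EF_pos_def)
lemma nth_EF_pos: "fst (EF_sum l ! EF_pos l c) = EF_word l c"
  by (auto simp: EF_pos_def EF_word_def nth_EF_sum)

lemma vm_um:
  assumes "l > 0" "i \<le> nat l" "j \<le> nat l"
  shows "vm l i \<circ>\<^sub>v um l j = (if i = j then idm (EF_word l i) l else 0)"
proof -
  have "int i < l \<or> i = nat l" "int j < l \<or> j = nat l" using assms by auto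
  then show ?thesis
    using assms(1) by (auto simp: vm_def um_def EF_word_def vv_uu sg_uu vv_sg' sg_sg' comp_minus)
qed

lemma sum_um_vm:
  assumes "l > 0"
  shows "(\<Sum>i\<le>nat l. um l i \<circ>\<^sub>v vm l i) = idm [\<E>, \<F>] l"
proof -
  have "(\<Sum>i\<le>nat l. um l i \<circ>\<^sub>v vm l i) = (\<Sum>i<nat l. uu l i \<circ>\<^sub>v vv l i) - sg' l \<circ>\<^sub>v sg l"
    using assms by (simp add: lessThan_Suc_atMost[symmetric] um_def vm_def comp_minus zless_nat_eq_int_zless[symmetric])
  then show ?thesis unfolding decomposition[of l] by simp
qed

lemma END_simps [simp]:
  "zero (END l X) = (\<lambda>i j. 0)" "add (END l X) M N = (\<lambda>i j. M i j + N i j)"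
  by (simp_all add: END_def)

lemma carrier_EF:
  "M \<in> carrier (END l (EF_sum l)) \<longleftrightarrow> (\<forall>i j. if i < Suc (Suc (nat l)) \<and> j < Suc (Suc (nat l))
     then M i j \<in> HOM l (fst (EF_sum l ! j)) (fst (EF_sum l ! i)) else M i j = 0)"
  by (simp add: END_def)

lemma abelian_monoid_END_EF: "abelian_monoid (END l (EF_sum l) :: (nat \<Rightarrow> nat \<Rightarrow> 'k::field mor) ring)"
  by (rule abelian_monoidI) (auto simp: carrier_EF HOM_add HOM_zero wt_EF_sum add_ac)

lemma finsum_END_EF:
  assumes "finite I" "\<And>k. k \<in> I \<Longrightarrow> f k \<in> carrier (END l (EF_sum l))"
  shows "finsum (END l (EF_sum l)) f I = (\<lambda>i j. \<Sum>k\<in>I. f k i j :: 'k::field mor)"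
proof -
  interpret R: abelian_monoid "END l (EF_sum l) :: (nat \<Rightarrow> nat \<Rightarrow> 'k mor) ring" by (rule abelian_monoid_END_EF)
  show ?thesis using assms
    by (induction I rule: finite_induct) (auto simp: R.finsum_insert Pi_def)
qed

lemma matrix_unit_carrier:
  assumes "i < Suc (Suc (nat l))" "j < Suc (Suc (nat l))" "f \<in> HOM l (fst (EF_sum l ! j)) (fst (EF_sum l ! i))"
  shows "matrix_unit i j f \<in> carrier (END l (EF_sum l))"
  using assms by (auto simp: carrier_EF matrix_unit_def HOM_zero wt_EF_sum)

lemma matrix_unit_mult:
  assumes "j < Suc (Suc (nat l))"
  shows "(\<otimes>\<^bsub>END l (EF_sum l)\<^esub>) (matrix_unit i j f) (matrix_unit k m g)
     = (if j = k then matrix_unit i m (f \<circ>\<^sub>v g) else (\<lambda>i j. 0))"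
proof (intro ext)
  fix a b
  have "(\<otimes>\<^bsub>END l (EF_sum l)\<^esub>) (matrix_unit i j f) (matrix_unit k m g) a b
     = (\<Sum>c<Suc (Suc (nat l)). if c = j then (if a = i \<and> j = k \<and> b = m then f \<circ>\<^sub>v g else 0) else 0)"
    unfolding END_def monoid.simps length_EF_sum by (rule sum.cong) (auto simp: matrix_unit_def)
  then show "(\<otimes>\<^bsub>END l (EF_sum l)\<^esub>) (matrix_unit i j f) (matrix_unit k m g) a b
     = (if j = k then matrix_unit i m (f \<circ>\<^sub>v g) else (\<lambda>i j. 0)) a b"
    using assms by (simp add: matrix_unit_def del: sum.lessThan_Suc add_2_eq_Suc')
qed

lemma matrix_unit_0: "matrix_unit i j 0 = (\<lambda>i j. 0)"
  by (simp add: matrix_unit_def fun_eq_iff)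
lemma matrix_unit_eq_0_iff: "matrix_unit i j f = (\<lambda>i j. 0) \<longleftrightarrow> f = 0"
  by (auto simp: matrix_unit_def fun_eq_iff)

lemma EF_u_carrier: "EF_u l c \<in> carrier (END l (EF_sum l))"
  unfolding EF_u_eq by (rule matrix_unit_carrier) (simp_all add: EF_pos_less nth_EF_pos nth_EF_sum HOM_um)
lemma EF_v_carrier: "EF_v l c \<in> carrier (END l (EF_sum l))"
  unfolding EF_v_eq by (rule matrix_unit_carrier) (simp_all add: EF_pos_less nth_EF_pos nth_EF_sum HOM_vm)

lemma EF_u_v: "(\<otimes>\<^bsub>END l (EF_sum l)\<^esub>) (EF_u l i) (EF_v l j) =
    (if EF_pos l i = EF_pos l j then matrix_unit 0 0 (um l i \<circ>\<^sub>v vm l j) else (\<lambda>i j. 0))"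
  unfolding EF_u_eq EF_v_eq by (rule matrix_unit_mult[OF EF_pos_less])
lemma EF_v_u: "(\<otimes>\<^bsub>END l (EF_sum l)\<^esub>) (EF_v l i) (EF_u l j) = matrix_unit (EF_pos l i) (EF_pos l j) (vm l i \<circ>\<^sub>v um l j)"
  unfolding EF_u_eq EF_v_eq by (subst matrix_unit_mult) simp_all

lemma finsum_matrix_unit_00:
  assumes "finite I" "\<And>k. k \<in> I \<Longrightarrow> f k \<in> HOM l [\<E>, \<F>] [\<E>, \<F>]"
  shows "finsum (END l (EF_sum l)) (\<lambda>k. matrix_unit 0 0 (f k)) I = matrix_unit 0 0 (\<Sum>k\<in>I. f k)"
  by (subst finsum_END_EF[OF assms(1)])
    (auto simp: matrix_unit_def fun_eq_iff nth_EF_sum intro!: matrix_unit_carrier[unfolded matrix_unit_def] assms(2))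

lemma finsum_EF_u_v:
  assumes "l > 0"
  shows "finsum (END l (EF_sum l)) (\<lambda>i. (\<otimes>\<^bsub>END l (EF_sum l)\<^esub>) (EF_u l i) (EF_v l i)) {0..nat l}
     = matrix_unit 0 0 (idm [\<E>, \<F>] l)"
proof -
  show ?thesis
    by (simp add: EF_u_v finsum_matrix_unit_00 HOM_vcomp[OF HOM_um HOM_vm] atLeast0AtMost sum_um_vm[OF assms])
qed

lemma HOM_deg_zero: "wt u = wt v \<Longrightarrow> 0 \<in> HOM_deg d l u v"
  unfolding HOM_deg_def using cls_Zero by (metis (mono_tags, lifting) has_deg.simps(1) mem_Collect_eq typed.simps(1))

lemma matrix_unit_END_deg:
  assumes "i < Suc (Suc (nat l))" "j < Suc (Suc (nat l))"
    and "f \<in> HOM_deg (snd (EF_sum l ! j) - snd (EF_sum l ! i)) l (fst (EF_sum l ! j)) (fst (EF_sum l ! i))"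
  shows "matrix_unit i j f \<in> END_deg 0 l (EF_sum l)"
proof -
  have "f \<in> HOM l (fst (EF_sum l ! j)) (fst (EF_sum l ! i))"
    using assms(3) by (auto simp: HOM_deg_def HOM_def)
  then have "matrix_unit i j f \<in> carrier (END l (EF_sum l))" by (rule matrix_unit_carrier[OF assms(1,2)])
  then show ?thesis
    using assms by (auto simp: END_deg_def matrix_unit_def HOM_deg_zero wt_EF_sum)
qed

lemma HOM_deg_cls: "typed t l u v \<Longrightarrow> has_deg t d \<Longrightarrow> cls t \<in> HOM_deg d l u v"
  by (auto simp: HOM_deg_def)

lemma typed_sigma: "typed (sigma l) l [\<E>, \<F>] [\<F>, \<E>]" and typed_sigma': "typed (sigma' l) l [\<F>, \<E>] [\<E>, \<F>]"
  unfolding sigma_def sigma'_def by (rule typed_intros | simp)+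

lemma EF_u_END_deg: "EF_u l c \<in> END_deg 0 l (EF_sum l)"
proof (cases "int c < l")
  case True
  have "cls (xipow_F (int c) l \<bullet> eta' l) \<in> HOM_deg (1 - l + 2 * int c) l [] [\<E>, \<F>]"
    by (rule HOM_deg_cls, rule typed_VC[OF typed_xipow_F], simp, rule has_deg_VC[OF has_deg_xipow_F, of _ _ "1 - l"]) auto
  then show ?thesis using True unfolding EF_u_def
    by (auto intro!: matrix_unit_END_deg simp: nth_EF_sum)
next
  case False
  have "cls (sigma' l) \<in> HOM_deg 0 l [\<F>, \<E>] [\<E>, \<F>]" by (rule HOM_deg_cls[OF typed_sigma' has_deg_sigma'])
  then show ?thesis using False unfolding EF_u_def by (auto intro!: matrix_unit_END_deg simp: nth_EF_sum)
qed

lemma EF_v_END_deg: "l > 0 \<Longrightarrow> EF_v l c \<in> END_deg 0 l (EF_sum l)"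
proof (cases "int c < l")
  case True
  assume l: "l > 0"
  let ?f = "\<lambda>(a, b). bubble_minus b l \<bullet> eps' l \<bullet> xipow_F a l"
  have "has_deg (?f x) (l - 1 - 2 * int c)" if "x \<in> set (pairs (l - 1 - int c))" for x
  proof -
    obtain a b where x: "x = (a, b)" "a \<ge> 0" "a + b = l - 1 - int c" using \<open>x \<in> _\<close> by (auto simp: pairs_def split: if_splits)
    show ?thesis unfolding x(1) prod.case
      by (rule has_deg_VC[OF has_deg_bubble_minus[OF l]], rule has_deg_VC[OF _ has_deg_xipow_F[OF x(2)], of _ "1 - l"])
        (use x(3) in auto)
  qed
  moreover have typed: "typed (?f x) l [\<E>, \<F>] []" for x
    unfolding case_prod_unfold by (rule typed_intros)+
  ultimately have "cls (Sums (map ?f (pairs (l - 1 - int c)))) \<in> HOM_deg (l - 1 - 2 * int c) l [\<E>, \<F>] []"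
    using typed by (intro HOM_deg_cls typed_Sums_map) (auto simp: has_deg_Sums)
  then show ?thesis using True unfolding EF_v_def
    by (auto intro!: matrix_unit_END_deg simp: nth_EF_sum)
next
  case False
  have "cls (neg (sigma l)) \<in> HOM_deg 0 l [\<E>, \<F>] [\<F>, \<E>]"
    by (rule HOM_deg_cls[OF typed_neg[OF typed_sigma]]) (simp add: has_deg_neg has_deg_sigma)
  then show ?thesis using False unfolding EF_v_def by (auto intro!: matrix_unit_END_deg simp: nth_EF_sum)
qed

context p_differential
begin

lemma END_diff_matrix_unit: "END_diff D (matrix_unit i j f) = matrix_unit i j (D f)"
  by (auto simp: END_diff_def matrix_unit_def fun_eq_iff D_zero)

lemma EF_fantastic_imp:
  assumes "l > 0" "EF_fantastic D l" "i \<le> nat l"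
  shows "vm l i \<circ>\<^sub>v D (um l i) = 0"
proof -
  have "(\<otimes>\<^bsub>END l (EF_sum l)\<^esub>) (EF_v l i) (END_diff D (EF_u l i)) = zero (END l (EF_sum l))"
    using assms unfolding EF_fantastic_def fantastic_filtration_def by (meson atLeastAtMost_iff le0)
  then show ?thesis
    by (simp add: EF_u_eq EF_v_eq END_diff_matrix_unit matrix_unit_mult matrix_unit_eq_0_iff)
qed

lemma vv_uu_top: assumes "l > 0" shows "vv l (nat l - 1) \<circ>\<^sub>v uu l (nat l) = (bpl 1 l :: 'k mor)"
proof -
  have 1: "nat l - (nat l - 1) = Suc 0" "int (nat l - 1) = l - 1" using assms by auto
  have "vv l (nat l - 1) = (bmi 0 l \<circ>\<^sub>v cls (eps' l) \<circ>\<^sub>v xF 0 l :: 'k mor)"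
    unfolding vv_def 1 by simp
  then have "vv l (nat l - 1) = (cls (eps' l) :: 'k mor)"
    by (simp add: bubble_0 xF_0 vcomp_idl[OF HOM_gens(8)] vcomp_idr[OF HOM_gens(8)])
  then show ?thesis using assms xF_eps_eta[of l "nat l"] by (simp add: uu_def)
qed

lemma fantastic_bubble_coeffs:
  assumes "l > 0" "EF_fantastic D l"
  shows "pxb P (l - 2) + pyb P (l - 2) = 1 - of_int l" and "l \<ge> 2 \<Longrightarrow> pyb P (l - 2) = 0"
proof -
  have vuD: "vv l c \<circ>\<^sub>v uu l c \<circ>\<^sub>v bpl 1 l = (bpl 1 l :: 'k mor)" if "int c < l" for c
    using that by (simp add: vv_uu vcomp_idl[OF HOM_bubble(1)] flip: vcomp_assoc)
  have eq: "scl (of_nat c + pxb P (l - 2)) (vv l c \<circ>\<^sub>v uu l (Suc c)) + scl (pyb P (l - 2)) (bpl 1 l) = 0"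
    if "int c < l" for c
    using EF_fantastic_imp[OF assms, of c] that
    by (simp add: um_def vm_def D_uu comp_add comp_scl vuD nat_le_iff)
  have 1: "int (nat l - 1) = l - 1" "Suc (nat l - 1) = nat l" using assms by auto
  have "scl (of_nat (nat l - 1) + pxb P (l - 2) + pyb P (l - 2)) (bpl 1 l) = 0"
    using eq[of "nat l - 1"] unfolding 1 vv_uu_top[OF assms(1)] by (simp add: mor.scale_left_distrib)
  then have 2: "of_nat (nat l - 1) + pxb P (l - 2) + pyb P (l - 2) = 0" by (rule scl_bubble_eq_0[OF assms(1)])
  have "(of_nat (nat l - 1) :: 'k) = of_int (int (nat l - 1))" by simp
  then have 3: "(of_nat (nat l - 1) :: 'k) = of_int l - 1" unfolding 1 by simp
  from 2 show "pxb P (l - 2) + pyb P (l - 2) = 1 - of_int l" unfolding 3 by (simp add: algebra_simps eq_neg_iff_add_eq_0)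
  show "pyb P (l - 2) = 0" if "l \<ge> 2"
  proof (rule scl_bubble_eq_0[OF assms(1)])
    show "scl (pyb P (l - 2)) (bpl 1 l) = 0" using eq[of 0] that by (simp add: vv_uu)
  qed
qed

lemma fantastic_crossing_coeffs:
  assumes "l > 0" "EF_fantastic D l" "pyb P l = 0 \<or> pyb P (l - 2) = 0"
  shows "pxb P (l - 2) - (pxb P l + 2 * pyb P l) - (1 + pa P (l - 2)) = 0 \<and> pa P (l - 2) = 1
    \<and> pyb P l = 0 \<and> pyb P (l - 2) = 0"
proof -
  let ?A = "pxb P (l - 2) - (pxb P l + 2 * pyb P l) - (1 + pa P (l - 2))"
  have "sg l \<circ>\<^sub>v D (sg' l) = 0"
    using EF_fantastic_imp[OF assms(1,2), of "nat l"] assms(1) by (simp add: um_def vm_def comp_minus)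
  then have "scl (- ?A) (cls (xi' (l + 2)) \<circ>\<^sub>h idm [\<E>] l) + scl (- (pa P (l - 2) - 1)) (idm [\<F>] (l + 2) \<circ>\<^sub>h cls (xi l))
     + scl (pyb P l) (bpl 1 l \<circ>\<^sub>h idm [\<F>, \<E>] l) + scl (- pyb P (l - 2)) (idm [\<F>, \<E>] l \<circ>\<^sub>h bpl 1 l) = 0"
    unfolding sg_D_sg'[OF assms(1)] mor.scale_minus_left by (simp only: diff_conv_add_uminus add_ac)
  from FE_independent[OF assms(1) this] assms(3) show ?thesis by auto
qed

end

lemma fantastic_parameters:
  fixes P :: "'k::field pars"
  assumes "admissible P" "differential P D" "l \<ge> 2" "EF_fantastic D l"
  shows "same_xy P pars1 (l - 2) \<and> same_xy P pars1 l \<and> same_a P pars1 (l - 2)"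
proof -
  interpret p_differential P D by unfold_locales (rule assms(2))
  have l: "l > 0" using assms(3) by simp
  have adm: "pa P m - pab P m = px P (m + 2) - px P m - 2 * py P m" "px P m + pxb P m = - of_int m"
     "py P m + pyb P m = - 1" for m
    using assms(1) unfolding admissible_def by auto
  have y: "pyb P (l - 2) = 0" by (rule fantastic_bubble_coeffs(2)[OF l assms(4,3)])
  have x: "pxb P (l - 2) = 1 - of_int l" using fantastic_bubble_coeffs(1)[OF l assms(4)] y by simp
  have c: "pxb P (l - 2) - (pxb P l + 2 * pyb P l) - (1 + pa P (l - 2)) = 0" "pa P (l - 2) = 1" "pyb P l = 0"
    using fantastic_crossing_coeffs[OF l assms(4)] y by auto
  have x': "pxb P l = - 1 - of_int l" using c x by (simp add: algebra_simps)
  have px: "px P (l - 2) = 1" "px P l = 1" using adm(2)[of "l - 2"] adm(2)[of l] x x' by (simp_all add: algebra_simps)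
  have py: "py P (l - 2) = - 1" "py P l = - 1" using adm(3)[of "l - 2"] adm(3)[of l] y c by simp_all
  have "pab P (l - 2) = - 1" using adm(1)[of "l - 2"] px py c by (simp add: algebra_simps add_eq_0_iff)
  then show ?thesis using x x' y c px py by (simp add: same_xy_def same_a_def pars1_def)
qed

lemma fantastic_parameters_minus_one:
  fixes P :: "'k::field pars"
  assumes "admissible P" "differential P D" "EF_fantastic D 1" "same_xy P pars1 1"
  shows "same_xy P pars1 (- 1) \<and> same_a P pars1 (- 1)"
proof -
  interpret p_differential P D by unfold_locales (rule assms(2))
  have adm: "pa P m - pab P m = px P (m + 2) - px P m - 2 * py P m" "px P m + pxb P m = - of_int m"
     "py P m + pyb P m = - 1" for m
    using assms(1) unfolding admissible_def by auto
  have 1: "pyb P 1 = 0" "pxb P 1 = - 2" "px P 1 = 1" using assms(4) by (simp_all add: same_xy_def pars1_def)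
  have c: "pa P (- 1) = 1" "pyb P (- 1) = 0"
    using fantastic_crossing_coeffs[OF _ assms(3)] 1 by auto
  then have x: "pxb P (- 1) = 0" using fantastic_bubble_coeffs(1)[OF _ assms(3)] by simp
  then have px: "px P (- 1) = 1" using adm(2)[of "- 1"] by simp
  have py: "py P (- 1) = - 1" using adm(3)[of "- 1"] c by simp
  have "pab P (- 1) = - 1" using adm(1)[of "- 1"] c px py 1 by (simp add: algebra_simps add_eq_0_iff)
  then show ?thesis using x c px py by (simp add: same_xy_def same_a_def pars1_def)
qed

definition EF_rank :: "int \<Rightarrow> nat \<Rightarrow> nat" where "EF_rank l c = (if int c < l then Suc c else 0)"
definition EF_order :: "int \<Rightarrow> nat rel" where
  "EF_order l = {(a, b). a \<le> nat l \<and> b \<le> nat l \<and> EF_rank l a \<le> EF_rank l b}"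

lemma linear_order_EF_order: "l > 0 \<Longrightarrow> linear_order_on {0..nat l} (EF_order l)"
  unfolding linear_order_on_def partial_order_on_def preorder_on_def
  by (auto simp: EF_order_def EF_rank_def refl_on_def trans_def antisym_def total_on_def split: if_splits)

lemma vm_D_um_pars1:
  fixes D :: "'k::field mor \<Rightarrow> 'k mor"
  assumes "differential pars1 D" "l > 0" "i \<le> nat l" "k \<le> nat l" "EF_rank l i \<le> EF_rank l k"
  shows "vm l i \<circ>\<^sub>v D (um l k) = 0"
proof -
  interpret p_differential pars1 D by unfold_locales (rule assms(1))
  show ?thesis
  proof (cases "int k < l")
    case True
    have Duu: "D (uu l k) = scl (of_nat k + 1 - of_int l) (uu l (Suc k))"
      by (simp add: D_uu pars1_def algebra_simps)
    show ?thesis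
    proof (cases "int (Suc k) < l")
      case k: True
      have "vm l i \<circ>\<^sub>v uu l (Suc k) = (0 :: 'k mor)"
        using vm_um[OF assms(2,3), of "Suc k"] k True assms(5) zless_nat_eq_int_zless[of "Suc k" l] by (auto simp: um_def EF_rank_def split: if_splits)
      then show ?thesis using True by (simp add: um_def Duu comp_scl)
    next
      case False
      then have "int k + 1 = l" using True by simp
      then have "(of_nat k + 1 - of_int l :: 'k) = 0" by (metis diff_self of_int_1 of_int_add of_int_of_nat_eq)
      then show ?thesis using True by (simp add: um_def Duu)
    qed
  next
    case False
    then have "\<not> int i < l" using assms(5) by (auto simp: EF_rank_def split: if_splits)
    then show ?thesis using False assms(2)
      by (simp add: um_def vm_def comp_minus sg_D_sg' pars1_def)
  qed
qed

lemma EF_fantastic_pars1: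
  fixes D :: "'k::field mor \<Rightarrow> 'k mor"
  assumes D: "differential pars1 D" and l: "l > 0"
  shows "EF_fantastic D l"
proof -
  interpret p_differential pars1 D by unfold_locales (rule D)
  let ?R = "END l (EF_sum l) :: (nat \<Rightarrow> nat \<Rightarrow> 'k mor) ring"
  let ?I = "{0..nat l}"
  have idl: "(vm l i \<circ>\<^sub>v um l i) \<circ>\<^sub>v vm l i = (vm l i :: 'k mor)" if "i \<le> nat l" for i
    using that by (simp add: vm_um[OF l] vcomp_idl[OF HOM_vm])
  have idr: "um l i \<circ>\<^sub>v vm l i \<circ>\<^sub>v um l i = (um l i :: 'k mor)" if "i \<le> nat l" for i
    using that by (simp add: vm_um[OF l] vcomp_idr[OF HOM_um])
  have inc: "EF_u l i \<otimes>\<^bsub>?R\<^esub> END_diff D (EF_v l i) \<in> Fc_less ?R ?I (EF_order l) (EF_u l) (EF_v l) i" if i: "i \<le> nat l" for i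
  proof -
    let ?m = "um l i \<circ>\<^sub>v D (vm l i)"
    let ?K = "{k \<in> ?I. (k, i) \<in> EF_order l \<and> k \<noteq> i}"
    have m: "?m \<in> HOM l [\<E>, \<F>] [\<E>, \<F>]" by (rule HOM_vcomp[OF HOM_um D_HOM[OF HOM_vm]])
    have M: "EF_u l i \<otimes>\<^bsub>?R\<^esub> END_diff D (EF_v l i) = matrix_unit 0 0 ?m"
      by (simp add: EF_u_eq EF_v_eq END_diff_matrix_unit matrix_unit_mult EF_pos_less)
    have zero: "?m \<circ>\<^sub>v um l k \<circ>\<^sub>v vm l k = 0" if "k \<in> {..nat l} - ?K" for k
    proof -
      have k: "k \<le> nat l" "EF_rank l i \<le> EF_rank l k" using that i by (auto simp: EF_order_def)
      have "D (vm l i \<circ>\<^sub>v um l k) = 0" by (simp add: vm_um[OF l i k(1)] D_id D_zero)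
      then have "D (vm l i) \<circ>\<^sub>v um l k = 0"
        using D_left_if_D_comp_zero[OF HOM_vm HOM_um] vm_D_um_pars1[OF D l i k] by simp
      then show ?thesis by (simp add: vcomp_assoc) (simp flip: vcomp_assoc)
    qed
    have "?m = (\<Sum>k\<le>nat l. ?m \<circ>\<^sub>v um l k \<circ>\<^sub>v vm l k)"
      using vcomp_idr[OF m] by (simp add: sum_um_vm[OF l] flip: vcomp_sum_right)
    also have "\<dots> = (\<Sum>k\<in>?K. ?m \<circ>\<^sub>v um l k \<circ>\<^sub>v vm l k)"
      using zero by (intro sum.mono_neutral_right) auto
    finally have m_eq: "?m = (\<Sum>k\<in>?K. ?m \<circ>\<^sub>v um l k \<circ>\<^sub>v vm l k)" .
    have "matrix_unit 0 0 ?m \<otimes>\<^bsub>?R\<^esub> EF_u l k \<otimes>\<^bsub>?R\<^esub> EF_v l k = matrix_unit 0 0 (?m \<circ>\<^sub>v um l k \<circ>\<^sub>v vm l k)" for k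
      by (simp add: EF_u_eq EF_v_eq matrix_unit_mult EF_pos_less vcomp_assoc)
    then have "matrix_unit 0 0 ?m = (\<Oplus>\<^bsub>?R\<^esub>k\<in>?K. matrix_unit 0 0 ?m \<otimes>\<^bsub>?R\<^esub> EF_u l k \<otimes>\<^bsub>?R\<^esub> EF_v l k)"
      using m_eq by (simp add: finsum_matrix_unit_00 HOM_vcomp[OF m HOM_vcomp[OF HOM_um HOM_vm]])
    moreover have "matrix_unit 0 0 ?m \<in> carrier ?R"
      using m by (intro matrix_unit_carrier) (simp_all add: nth_EF_sum)
    ultimately show ?thesis unfolding M Fc_less_def by (intro CollectI exI[of _ "\<lambda>_. matrix_unit 0 0 ?m"]) auto
  qed
  show ?thesis unfolding EF_fantastic_def fantastic_filtration_def
  proof (intro conjI ballI impI exI[of _ "EF_order l"])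
    fix i j assume i: "i \<in> ?I" and j: "j \<in> ?I" and ij: "i \<noteq> j"
    then show "EF_v l i \<otimes>\<^bsub>?R\<^esub> EF_u l j = \<zero>\<^bsub>?R\<^esub>" using l by (simp add: EF_v_u vm_um matrix_unit_0)
  next
    fix i assume i: "i \<in> ?I"
    then have i': "i \<le> nat l" by simp
    show "EF_u l i \<in> carrier ?R" "EF_v l i \<in> carrier ?R" by (rule EF_u_carrier EF_v_carrier)+
    show "EF_u l i \<otimes>\<^bsub>?R\<^esub> EF_v l i \<otimes>\<^bsub>?R\<^esub> EF_u l i = EF_u l i"
      unfolding EF_u_v by (simp add: EF_u_eq matrix_unit_mult vcomp_assoc idr[OF i'])
    show "EF_v l i \<otimes>\<^bsub>?R\<^esub> EF_u l i \<otimes>\<^bsub>?R\<^esub> EF_v l i = EF_v l i"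
      unfolding EF_v_u by (simp add: EF_v_eq matrix_unit_mult EF_pos_less idl[OF i'])
    show "END_diff D (EF_v l i \<otimes>\<^bsub>?R\<^esub> EF_u l i) = \<zero>\<^bsub>?R\<^esub>"
      unfolding EF_v_u by (simp add: END_diff_matrix_unit vm_um[OF l i' i'] D_id matrix_unit_0)
    show "EF_v l i \<otimes>\<^bsub>?R\<^esub> END_diff D (EF_u l i) = \<zero>\<^bsub>?R\<^esub>"
      by (simp add: EF_u_eq EF_v_eq END_diff_matrix_unit matrix_unit_mult vm_D_um_pars1[OF D l i' i'] matrix_unit_0)
    show "EF_u l i \<otimes>\<^bsub>?R\<^esub> END_diff D (EF_v l i) \<in> Fc_less ?R ?I (EF_order l) (EF_u l) (EF_v l) i"
      by (rule inc[OF i'])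
  next
    show "END_diff D (\<Oplus>\<^bsub>?R\<^esub>i\<in>?I. EF_u l i \<otimes>\<^bsub>?R\<^esub> EF_v l i) = \<zero>\<^bsub>?R\<^esub>"
      by (simp add: finsum_EF_u_v[OF l] END_diff_matrix_unit D_id matrix_unit_0)
    show "linear_order_on ?I (EF_order l)" by (rule linear_order_EF_order[OF l])
  qed simp
qed

theorem proposition5p10:
  assumes "CHAR('k::field) > 0"
  shows
    "(\<forall>l>0.
        (\<forall>i\<in>{0..nat l}. EF_u l i \<in> END_deg 0 l (EF_sum l) \<and>
                         (EF_v l i :: nat \<Rightarrow> nat \<Rightarrow> 'k mor) \<in> END_deg 0 l (EF_sum l)) \<and>
        (\<Oplus>\<^bsub>END l (EF_sum l)\<^esub>i\<in>{0..nat l}. EF_u l i \<otimes>\<^bsub>END l (EF_sum l)\<^esub> EF_v l i)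
          = matrix_unit 0 0 (cls (Id [\<E>, \<F>] l :: 'k tm)) \<and>
        (\<forall>D :: 'k mor \<Rightarrow> 'k mor. differential pars1 D \<longrightarrow> EF_fantastic D l))
     \<and>
     (\<forall>(P :: 'k pars) D. admissible P \<and> differential P D \<longrightarrow>
        ((\<forall>l>0. EF_fantastic D l) \<longrightarrow> (\<forall>m\<ge>-1. same_xy P pars1 m \<and> same_a P pars1 m)) \<and>
        (\<forall>l\<ge>2. EF_fantastic D l \<longrightarrow>
           same_xy P pars1 (l - 2) \<and> same_xy P pars1 l \<and> same_a P pars1 (l - 2)))"
proof -
  have "same_xy P pars1 m \<and> same_a P pars1 m"
    if P: "admissible P" "differential P D" and fant: "\<forall>l>0. EF_fantastic D l" and m: "m \<ge> - 1"
    for P :: "'k pars" and D and m :: int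
  proof (cases "m = - 1")
    case True
    have "same_xy P pars1 1" using fantastic_parameters[OF P, of 3] fant by simp
    then show ?thesis using fantastic_parameters_minus_one[OF P] fant True by simp
  next
    case False
    then show ?thesis using fantastic_parameters[OF P, of "m + 2"] fant m by simp
  qed
  then show ?thesis
    by (auto simp: EF_u_END_deg EF_v_END_deg finsum_EF_u_v EF_fantastic_pars1 dest: fantastic_parameters)
qed

end
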